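(* Let $n\ge1$ and let $\Omega$ be a smooth bounded domain in $\mathbb{H}^{n+1}$. If $p\ge1$, then $$\int_{\partial\Omega}\cosh r\,(\cosh r-\tilde u)^p\,d\mu\ \ge\ \omega_n\,\mathcal{S}^n(\Omega)\sqrt{\mathcal{S}^2(\Omega)+1}\left(\mathcal{S}(\Omega)+\sqrt{\mathcal{S}^2(\Omega)+1}\right)^{-p}.$$ Equality holds if and only if $\Omega$ is a geodesic ball centered at the origin.
   Context: $\mathbb{H}^{n+1}$ is hyperbolic space of curvature $-1$ with a fixed origin; $r$ is the distance to the origin; $\nu$ is the outward unit normal and $d\mu$ the area element of $\partial\Omega$; $\tilde u=\langle V,\nu\rangle$ with $V=\sinh r\,\partial_r$; $\omega_n$ is the area of the unit sphere $\mathbb{S}^n$. $\mathrm{Vol}_w(\Omega)=\int_\Omega\cosh r\,dv$ and $\mathcal{S}(\Omega)=(n+1)^{\frac1{n+1}}\omega_n^{-\frac1{n+1}}\mathrm{Vol}_w(\Omega)^{\frac1{n+1}}$. A bounded domain is a compact connected set with nonempty interior; smooth means with smooth boundary. *)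

theory Defs
  imports "HOL-Analysis.Analysis"
begin

subsection \<open>Smooth maps on open sets\<close>

fun Ck_on :: "nat \<Rightarrow> ('a::real_normed_vector \<Rightarrow> 'b::real_normed_vector) \<Rightarrow> 'a set \<Rightarrow> bool" where
  "Ck_on 0 f U \<longleftrightarrow> continuous_on U f"
| "Ck_on (Suc k) f U \<longleftrightarrow>
     f differentiable_on U \<and> (\<forall>v. Ck_on k (\<lambda>x. frechet_derivative f (at x) v) U)"

text \<open>Only meaningful for open \<open>U\<close>, since the derivatives are unrestricted ones.\<close>

definition smooth_on :: "('a::real_normed_vector \<Rightarrow> 'b::real_normed_vector) \<Rightarrow> 'a set \<Rightarrow> bool" where
  "smooth_on f U \<longleftrightarrow> (\<forall>k. Ck_on k f U)"

subsection \<open>Area of hypersurfaces in a Riemannian chart domain\<close>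

text \<open>
  A Riemannian metric on a space covered by one global chart is given by
  \<open>g x v w\<close>, the inner product at the point \<open>x\<close> of the tangent vectors \<open>v\<close> and \<open>w\<close>.
  The density of a parametrisation \<open>\<phi>\<close> is the square root of the Gram determinant of its
  coordinate vector fields; for \<open>\<phi>\<close> the identity it is the Riemannian volume density.
\<close>

definition riem_density ::
  "(real^'m::finite \<Rightarrow> real^'m \<Rightarrow> real^'m \<Rightarrow> real) \<Rightarrow> (real^'k::finite \<Rightarrow> real^'m) \<Rightarrow> real^'k \<Rightarrow> real" where
  "riem_density g \<phi> y =
     sqrt (det (\<chi> i j. g (\<phi> y) (frechet_derivative \<phi> (at y) (axis i 1))
                               (frechet_derivative \<phi> (at y) (axis j 1))))"

definition riem_volume :: "(real^'m::finite \<Rightarrow> real^'m \<Rightarrow> real^'m \<Rightarrow> real) \<Rightarrow> (real^'m) measure" where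
  "riem_volume g = density lborel (\<lambda>x. ennreal (riem_density g (\<lambda>z. z) x))"

text \<open>
  The ambient space has index type \<open>'n option\<close>, so that its dimension is \<open>CARD('n) + 1\<close> and its
  hypersurfaces are parametrised by \<open>real^'n\<close>.
\<close>

definition local_parametrization ::
  "(real^('n::finite option)) set \<Rightarrow> (real^'n) set \<Rightarrow> (real^'n \<Rightarrow> real^('n option)) \<Rightarrow> bool" where
  "local_parametrization S W \<phi> \<longleftrightarrow>
     open W \<and> smooth_on \<phi> W \<and> (\<forall>y\<in>W. inj (frechet_derivative \<phi> (at y))) \<and>
     openin (top_of_set S) (\<phi> ` W) \<and> (\<exists>\<psi>. homeomorphism W (\<phi> ` W) \<phi> \<psi>)"

definition is_riem_area ::
  "(real^('n::finite option) \<Rightarrow> real^('n option) \<Rightarrow> real^('n option) \<Rightarrow> real) \<Rightarrow>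
   (real^('n option)) set \<Rightarrow> (real^('n option)) measure \<Rightarrow> bool" where
  "is_riem_area g S \<mu> \<longleftrightarrow>
     sets \<mu> = sets borel \<and> emeasure \<mu> (- S) = 0 \<and>
     (\<forall>W \<phi>. local_parametrization S W \<phi> \<longrightarrow>
        (\<forall>A\<in>sets borel. A \<subseteq> \<phi> ` W \<longrightarrow>
           emeasure \<mu> A =
             (\<integral>\<^sup>+y. ennreal (riem_density g \<phi> y) * indicator {y\<in>W. \<phi> y \<in> A} y \<partial>lborel)))"

text \<open>
  For a compact smooth hypersurface \<open>S\<close> the area measure exists (the formulas in the different
  charts agree on overlaps) and is unique (finitely many charts cover \<open>S\<close>).
\<close>

definition riem_area ::
  "(real^('n::finite option) \<Rightarrow> real^('n option) \<Rightarrow> real^('n option) \<Rightarrow> real) \<Rightarrow>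
   (real^('n option)) set \<Rightarrow> (real^('n option)) measure" where
  "riem_area g S = (THE \<mu>. is_riem_area g S \<mu>)"

text \<open>The area of the unit sphere in Euclidean space of dimension \<open>CARD('n) + 1\<close>.\<close>

definition unit_sphere_area :: "'n::finite itself \<Rightarrow> real" where
  "unit_sphere_area _ =
     measure (riem_area (\<lambda>x. (\<bullet>)) (sphere (0 :: real^('n option)) 1)) (sphere 0 1)"

subsection \<open>Hyperbolic space\<close>

text \<open>
  Hyperbolic space of curvature \<open>-1\<close> is the hyperboloid \<open>\<langle>X, X\<rangle> = -1\<close>, \<open>X\<^sub>0 > 0\<close> in Minkowski
  space, seen in the global chart that forgets the time coordinate: the point \<open>x\<close> of the chart
  stands for \<open>hyp_embed x\<close>. Its metric is the one induced by the Minkowski form, and the distance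
  is \<open>cosh d(X, Y) = -\<langle>X, Y\<rangle>\<close>. The origin is \<open>0\<close>, that is, the point \<open>(0, 1)\<close> of the hyperboloid.
\<close>

definition minkowski :: "'a::real_inner \<times> real \<Rightarrow> 'a \<times> real \<Rightarrow> real" where
  "minkowski X Y = fst X \<bullet> fst Y - snd X * snd Y"

definition hyp_embed :: "'a::real_inner \<Rightarrow> 'a \<times> real" where
  "hyp_embed x = (x, sqrt (1 + x \<bullet> x))"

definition hyp_metric :: "'a::real_inner \<Rightarrow> 'a \<Rightarrow> 'a \<Rightarrow> real" where
  "hyp_metric x v w =
     minkowski (frechet_derivative hyp_embed (at x) v) (frechet_derivative hyp_embed (at x) w)"

definition hyp_dist :: "'a::real_inner \<Rightarrow> 'a \<Rightarrow> real" where
  "hyp_dist x y = arcosh (- minkowski (hyp_embed x) (hyp_embed y))"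

abbreviation hyp_r :: "'a::real_inner \<Rightarrow> real" where
  "hyp_r x \<equiv> hyp_dist 0 x"

text \<open>
  The unit speed geodesics from the origin are \<open>t \<mapsto> sinh t *\<^sub>R \<theta>\<close> with \<open>norm \<theta> = 1\<close>, so
  \<open>\<partial>\<^sub>r\<close> is the unit vector in the direction of \<open>x\<close>. The value at the origin is \<open>0\<close>, which is
  irrelevant because of the factor \<open>sinh r\<close> in \<open>V\<close>.
\<close>

definition hyp_radial :: "'a::real_inner \<Rightarrow> 'a" where
  "hyp_radial x = x /\<^sub>R sqrt (hyp_metric x x x)"

definition hyp_V :: "'a::real_inner \<Rightarrow> 'a" where
  "hyp_V x = sinh (hyp_r x) *\<^sub>R hyp_radial x"

lemma hyp_embed_has_derivative:
  "(hyp_embed has_derivative (\<lambda>v. (v, (x \<bullet> v) / sqrt (1 + x \<bullet> x)))) (at x)"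
proof -
  have pos: "1 + x \<bullet> x > 0"
    by (simp add: add_pos_nonneg)
  show ?thesis
    unfolding hyp_embed_def
    by (rule derivative_eq_intros refl pos)+
       (use pos in \<open>auto simp: fun_eq_iff inner_commute divide_simps\<close>)
qed

lemma hyp_metric_eq: "hyp_metric x v w = v \<bullet> w - (x \<bullet> v) * (x \<bullet> w) / (1 + x \<bullet> x)"
proof -
  have "1 + x \<bullet> x \<ge> 0"
    by (simp add: add_nonneg_nonneg)
  then show ?thesis
    unfolding hyp_metric_def minkowski_def
    by (simp add: frechet_derivative_at[OF hyp_embed_has_derivative, symmetric])
qed

lemma hyp_r_eq: "hyp_r x = arcosh (sqrt (1 + x \<bullet> x))"
  by (simp add: hyp_dist_def minkowski_def hyp_embed_def)

subsection \<open>Smooth bounded domains\<close>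

text \<open>Near its boundary, \<open>\<Omega>\<close> is a sublevel set of a smooth function without critical points.\<close>

definition defining_function ::
  "'a::real_normed_vector set \<Rightarrow> 'a set \<Rightarrow> ('a \<Rightarrow> real) \<Rightarrow> bool" where
  "defining_function \<Omega> U f \<longleftrightarrow>
     open U \<and> smooth_on f U \<and> \<Omega> \<inter> U = {y\<in>U. f y \<le> 0} \<and>
     (\<forall>y\<in>U. \<exists>v. frechet_derivative f (at y) v \<noteq> 0)"

definition smooth_bounded_domain :: "'a::real_normed_vector set \<Rightarrow> bool" where
  "smooth_bounded_domain \<Omega> \<longleftrightarrow>
     compact \<Omega> \<and> connected \<Omega> \<and> interior \<Omega> \<noteq> {} \<and>
     (\<forall>x\<in>frontier \<Omega>. \<exists>U f. x \<in> U \<and> defining_function \<Omega> U f)"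

text \<open>The tangent space of the boundary at \<open>x\<close> is the kernel of the derivative of \<open>f\<close>.\<close>

definition is_outward_unit_normal :: "'a::real_inner set \<Rightarrow> 'a \<Rightarrow> 'a \<Rightarrow> bool" where
  "is_outward_unit_normal \<Omega> x \<nu> \<longleftrightarrow>
     hyp_metric x \<nu> \<nu> = 1 \<and>
     (\<exists>U f. x \<in> U \<and> defining_function \<Omega> U f \<and>
        (\<forall>v. frechet_derivative f (at x) v = 0 \<longrightarrow> hyp_metric x \<nu> v = 0) \<and>
        frechet_derivative f (at x) \<nu> > 0)"

definition hyp_normal :: "'a::real_inner set \<Rightarrow> 'a \<Rightarrow> 'a" where
  "hyp_normal \<Omega> x = (THE \<nu>. is_outward_unit_normal \<Omega> x \<nu>)"

definition hyp_u :: "'a::real_inner set \<Rightarrow> 'a \<Rightarrow> real" where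
  "hyp_u \<Omega> x = hyp_metric x (hyp_V x) (hyp_normal \<Omega> x)"

definition hyp_ball :: "'a::real_inner \<Rightarrow> real \<Rightarrow> 'a set" where
  "hyp_ball c R = {x. hyp_dist c x \<le> R}"

definition Vol_w :: "(real^'m::finite) set \<Rightarrow> real" where
  "Vol_w \<Omega> = (LINT x:\<Omega>|riem_volume hyp_metric. cosh (hyp_r x))"

definition hyp_S :: "(real^('n::finite option)) set \<Rightarrow> real" where
  "hyp_S \<Omega> =
     (real CARD('n) + 1) powr (1 / (real CARD('n) + 1)) *
     unit_sphere_area TYPE('n) powr (- 1 / (real CARD('n) + 1)) *
     Vol_w \<Omega> powr (1 / (real CARD('n) + 1))"

end

theory Submission
  imports Defs "HOL-Library.Option_ord"
begin

text \<open>
  In the chart, whose radial coordinate is \<open>sinh r\<close>, the weighted volume \<open>Vol_w\<close> is Lebesgue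
  measure. Let \<open>N\<close> be the Euclidean outward normal and \<open>s = x \<bullet> N\<close> the Euclidean support function. With
  \<open>h s = sqrt (1 + s\<^sup>2) * (sqrt (1 + s\<^sup>2) - s) powr p\<close>, the hyperbolic boundary integral becomes
  the Euclidean surface integral of \<open>h s\<close> times the \<open>p\<close>-th power of
  \<open>sqrt ((1 + (norm x)\<^sup>2) / (1 + s\<^sup>2)) \<ge> 1\<close>. The tangent \<open>a - b * s\<close> of \<open>h\<close> at \<open>s = S\<close> lies
  below \<open>h\<close>, with \<open>a\<close> and \<open>b\<close> positive. By the divergence theorem the integral of \<open>s\<close> is
  \<open>n + 1\<close> times the volume, and by the Euclidean isoperimetric inequality the area is at least
  \<open>\<omega>\<^sub>n * S ^ n\<close>; together they bound the integral of \<open>a - b * s\<close>. Equality forces \<open>s = S\<close> and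
  \<open>norm x = \<bar>s\<bar>\<close>, so that the boundary lies on a sphere.

  The isoperimetric inequality comes from mollifying the indicator function of the domain: the
  divergence theorem bounds the increments of the mollified function by a boundary integral, and
  the Brunn-Minkowski inequality, itself a consequence of the Prekopa-Leindler inequality,
  compares its superlevel sets.
\<close>

subsection \<open>The Brunn-Minkowski inequality\<close>

text \<open>On the centred ball with the weighted volume of the domain, \<open>s\<close> is
  constantly \<open>S\<close>; this is why the tangent is taken at \<open>S\<close> and why every
  step is sharp there. The term linear in \<open>s\<close> integrates exactly, so the area is the
  only quantity that is estimated, and it enters with the factor \<open>a\<close>, whose sign
  therefore matters. Equality is read off pointwise, from the strictness of the tangent bound away
  from \<open>S\<close> and from Cauchy-Schwarz; this works because the area charges every open
  piece of the boundary.

  The obstacle is that \<open>riem_area\<close> is a definite description over all local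
  parametrizations: nothing can be integrated before a measure meeting all these conditions is
  exhibited. Graphs over hyperplanes serve as reference charts; they also make both area elements
  explicit and carry the divergence theorem.

  The classical derivation of the isoperimetric inequality expands the volume of outer parallel
  sets, which calls for a tubular neighbourhood of the boundary. Mollification trades this expansion
  for the divergence theorem and two limits, first in the shift \<open>\<epsilon>\<close>, then in
  the radius \<open>\<delta>\<close> of the kernel.\<close>

lemma nn_integral_layer_cake:
  fixes f :: "'a \<Rightarrow> real"
  assumes "sigma_finite_measure M" and [measurable]: "f \<in> borel_measurable M"
    and "\<And>x. x \<in> space M \<Longrightarrow> 0 \<le> f x"
  shows "(\<integral>\<^sup>+x. ennreal (f x) \<partial>M) =
         (\<integral>\<^sup>+t. indicator {0<..} t * emeasure M {x\<in>space M. t < f x} \<partial>lborel)"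
proof -
  interpret M: sigma_finite_measure M by fact
  interpret pair_sigma_finite M "lborel :: real measure" ..
  \<comment> \<open>\<open>f x\<close> is the length of the interval \<open>{0<..<f x}\<close>, so
    that Tonelli can exchange the integrals over \<open>x\<close> and over the level
    \<open>t\<close>.\<close>
  have "(\<integral>\<^sup>+x. ennreal (f x) \<partial>M) = (\<integral>\<^sup>+x. (\<integral>\<^sup>+t. indicator {0<..<f x} t \<partial>lborel) \<partial>M)"
    using assms(3) by (intro nn_integral_cong) simp
  also have "\<dots> = (\<integral>\<^sup>+x. (\<integral>\<^sup>+t. (if 0 < t \<and> t < f x then 1 else 0) \<partial>lborel) \<partial>M)"
    by (intro nn_integral_cong) (auto simp: indicator_def)
  also have "\<dots> = (\<integral>\<^sup>+t. (\<integral>\<^sup>+x. (if 0 < t \<and> t < f x then 1 else 0) \<partial>M) \<partial>lborel)"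
    by (rule Fubini'[symmetric]) measurable
  also have "\<dots> = (\<integral>\<^sup>+t. (\<integral>\<^sup>+x. indicator {0<..} t * indicator {x\<in>space M. t < f x} x \<partial>M) \<partial>lborel)"
    by (intro nn_integral_cong) (auto simp: indicator_def)
  also have "\<dots> = (\<integral>\<^sup>+t. indicator {0<..} t * emeasure M {x\<in>space M. t < f x} \<partial>lborel)"
    by (intro nn_integral_cong) (simp add: nn_integral_cmult)
  finally show ?thesis .
qed

lemma emeasure_lborel_translate:
  fixes A :: "'a::euclidean_space set"
  assumes "A \<in> sets borel"
  shows "emeasure lborel {z. z + c \<in> A} = emeasure lborel A"
proof -
  have "emeasure lborel A = emeasure (distr lborel borel ((+) c)) A"
    by (simp add: lborel_distr_plus)
  also have "\<dots> = emeasure lborel {z. z + c \<in> A}"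
    using assms by (subst emeasure_distr) (auto intro!: arg_cong[where f="emeasure lborel"] simp: add.commute)
  finally show ?thesis ..
qed

lemma emeasure_lborel_dilate:
  fixes A :: "'a::euclidean_space set"
  assumes "A \<in> sets borel" "c > 0"
  shows "emeasure lborel {z. z /\<^sub>R c \<in> A} = ennreal (c ^ DIM('a)) * emeasure lborel A"
proof -
  have [measurable]: "{z. z /\<^sub>R c \<in> A} \<in> sets borel"
    using assms(1) by measurable
  have "emeasure lborel {z. z /\<^sub>R c \<in> A} =
        emeasure (density (distr lborel borel (\<lambda>x. 0 + c *\<^sub>R x)) (\<lambda>_. \<bar>c\<bar>^DIM('a))) {z. z /\<^sub>R c \<in> A}"
    using assms by (subst lborel_affine[of c 0]) auto
  also have "\<dots> = ennreal (c ^ DIM('a)) * emeasure (distr lborel borel (\<lambda>x. 0 + c *\<^sub>R x)) {z. z /\<^sub>R c \<in> A}"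
    using assms by (subst emeasure_density_const) auto
  also have "emeasure (distr lborel borel (\<lambda>x. 0 + c *\<^sub>R x)) {z. z /\<^sub>R c \<in> A} = emeasure lborel A"
    using assms by (subst emeasure_distr) auto
  finally show ?thesis .
qed

text \<open>Brunn-Minkowski on the line. For \<open>x\<close> near \<open>Sup X\<close> and
  \<open>y\<close> near \<open>Inf Y\<close>, the part of \<open>X\<close> up to \<open>x\<close>,
  translated by \<open>y\<close>, and the part of \<open>Y\<close> beyond \<open>y\<close>,
  translated by \<open>x\<close>, lie on different sides of \<open>x + y\<close>. They are thus
  disjoint subsets of \<open>Z\<close>, and cutting off the rest costs at most
  \<open>e\<close>.\<close>

lemma emeasure_real_sumset:
  fixes X Y Z :: "real set"
  assumes [measurable]: "X \<in> sets borel" "Y \<in> sets borel" "Z \<in> sets borel"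
    and ne: "X \<noteq> {}" "Y \<noteq> {}" and bdd: "bounded X" "bounded Y"
    and sub: "\<And>x y. x \<in> X \<Longrightarrow> y \<in> Y \<Longrightarrow> x + y \<in> Z"
  shows "emeasure lborel X + emeasure lborel Y \<le> emeasure lborel Z"
proof (rule ennreal_le_epsilon)
  fix e :: real assume "e > 0"
  have ba: "bdd_above X" and bb: "bdd_below Y"
    using bdd by (auto intro: bounded_imp_bdd_above bounded_imp_bdd_below)
  obtain x where x: "x \<in> X" "Sup X - e/2 < x"
    using less_cSup_iff[OF ne(1) ba, of "Sup X - e/2"] \<open>e > 0\<close> by auto
  obtain y where y: "y \<in> Y" "y < Inf Y + e/2"
    using cInf_less_iff[OF ne(2) bb, of "Inf Y + e/2"] \<open>e > 0\<close> by auto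
  \<comment> \<open>Closed on one side and open on the other, so that the two translates cannot
    share the point \<open>x + y\<close>.\<close>
  let ?X = "X \<inter> {..x}" and ?Y = "Y \<inter> {y<..}"
  have "emeasure lborel X \<le> emeasure lborel ?X + emeasure lborel {x..Sup X}"
    by (rule order.trans[OF emeasure_mono emeasure_subadditive])
       (auto intro: cSup_upper[OF _ ba])
  moreover have "emeasure lborel {x..Sup X} \<le> ennreal (e/2)"
    using x cSup_upper[OF x(1) ba] by (auto intro!: ennreal_leI)
  moreover have "emeasure lborel Y \<le> emeasure lborel ?Y + emeasure lborel {Inf Y..y}"
    by (rule order.trans[OF emeasure_mono emeasure_subadditive])
       (auto intro: cInf_lower[OF _ bb])
  moreover have "emeasure lborel {Inf Y..y} \<le> ennreal (e/2)"
    using y cInf_lower[OF y(1) bb] by (auto intro!: ennreal_leI)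
  ultimately have "emeasure lborel X + emeasure lborel Y
      \<le> (emeasure lborel ?X + ennreal (e/2)) + (emeasure lborel ?Y + ennreal (e/2))"
    by (meson add_mono order.trans order_refl)
  also have "\<dots> = emeasure lborel ?X + emeasure lborel ?Y + ennreal e"
    using \<open>e > 0\<close> by (simp add: ac_simps flip: ennreal_plus)
  also have "emeasure lborel ?X + emeasure lborel ?Y
     = emeasure lborel {z. z + (-y) \<in> ?X} + emeasure lborel {z. z + (-x) \<in> ?Y}"
    by (subst (1 2) emeasure_lborel_translate) auto
  also have "\<dots> = emeasure lborel ({z. z + (-y) \<in> ?X} \<union> {z. z + (-x) \<in> ?Y})"
    by (rule plus_emeasure) auto
  also have "\<dots> \<le> emeasure lborel Z"
    using sub[OF _ y(1)] sub[OF x(1)] by (intro emeasure_mono) force+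
  finally show "emeasure lborel X + emeasure lborel Y \<le> emeasure lborel Z + ennreal e"
    by (auto intro: add_right_mono)
qed

section \<open>The Prekopa-Leindler inequality for functions on the line\<close>

definition bdd_supp :: "(real \<Rightarrow> real) \<Rightarrow> bool" where
  "bdd_supp f \<longleftrightarrow> f \<in> borel_measurable borel \<and>
     (\<exists>B. \<forall>y. 0 \<le> f y \<and> f y \<le> B \<and> (f y \<noteq> 0 \<longrightarrow> \<bar>y\<bar> \<le> B))"

lemma bdd_supp_integrable:
  assumes "bdd_supp f"
  shows "integrable lborel f"
proof -
  obtain B where B: "\<And>y. 0 \<le> f y \<and> f y \<le> B \<and> (f y \<noteq> 0 \<longrightarrow> \<bar>y\<bar> \<le> B)" and [measurable]: "f \<in> borel_measurable borel"
    using assms unfolding bdd_supp_def by blast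
  show ?thesis
  proof (rule Bochner_Integration.integrable_bound)
    show "integrable lborel (\<lambda>y. B * indicator {-B..B} y :: real)"
      by (intro integrable_mult_right integrable_real_indicator) (auto simp: emeasure_lborel_Icc_eq)
    show "AE y in lborel. norm (f y) \<le> norm (B * indicator {-B..B} y :: real)"
      proof (rule AE_I2)
      fix y show "norm (f y) \<le> norm (B * indicator {-B..B} y :: real)"
        using B[of y] by (cases "f y = 0") (auto simp: indicator_def abs_le_iff)
    qed
  qed auto
qed

lemma bdd_supp_zero_integral:
  assumes "bdd_supp f" "Sup (range f) \<le> 0"
  shows "integral\<^sup>L lborel f = 0"
proof -
  obtain B where B: "\<And>y. 0 \<le> f y \<and> f y \<le> B"
    using assms unfolding bdd_supp_def by blast
  then have "f y \<le> Sup (range f)" for y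
    by (intro cSup_upper bdd_aboveI[of _ B]) auto
  then have "f = (\<lambda>_. 0)"
    using B assms(2) by (intro ext antisym) (auto intro: order.trans)
  then show ?thesis by simp
qed

text \<open>Dividing \<open>f\<close> and \<open>g\<close> by their suprema makes all superlevel
  sets below level 1 nonempty, as the sumset inequality requires. Integrating that inequality over
  the levels bounds the integral of the normalised \<open>h\<close> from below by a weighted
  arithmetic mean, which dominates the geometric mean; undoing the normalisation restores the
  product form.\<close>

lemma prekopa_leindler_real:
  fixes f g h :: "real \<Rightarrow> real"
  assumes f: "bdd_supp f" and g: "bdd_supp g" and h: "bdd_supp h" and l: "0 < l" "l < 1"
    and le: "\<And>x y. f x powr (1 - l) * g y powr l \<le> h ((1 - l) * x + l * y)"
  shows "(integral\<^sup>L lborel f) powr (1 - l) * (integral\<^sup>L lborel g) powr l \<le> integral\<^sup>L lborel h"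
proof -
  obtain Bf where Bf: "\<And>y. 0 \<le> f y \<and> f y \<le> Bf \<and> (f y \<noteq> 0 \<longrightarrow> \<bar>y\<bar> \<le> Bf)" and [measurable]: "f \<in> borel_measurable borel"
    using f unfolding bdd_supp_def by blast
  obtain Bg where Bg: "\<And>y. 0 \<le> g y \<and> g y \<le> Bg \<and> (g y \<noteq> 0 \<longrightarrow> \<bar>y\<bar> \<le> Bg)" and [measurable]: "g \<in> borel_measurable borel"
    using g unfolding bdd_supp_def by blast
  have h0: "\<And>y. 0 \<le> h y" and [measurable]: "h \<in> borel_measurable borel"
    using h unfolding bdd_supp_def by blast+
  define \<alpha> where "\<alpha> = Sup (range f)"
  define \<beta> where "\<beta> = Sup (range g)"
  have baf: "bdd_above (range f)" and bag: "bdd_above (range g)"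
    using Bf Bg by (auto intro!: bdd_aboveI)
  have fa: "f y \<le> \<alpha>" and gb: "g y \<le> \<beta>" for y
    unfolding \<alpha>_def \<beta>_def by (auto intro!: cSup_upper baf bag)
  show ?thesis
  proof (cases "\<alpha> > 0 \<and> \<beta> > 0")
    case False
    then have "integral\<^sup>L lborel f = 0 \<or> integral\<^sup>L lborel g = 0"
      using bdd_supp_zero_integral[OF f] bdd_supp_zero_integral[OF g] by (auto simp: \<alpha>_def \<beta>_def not_less)
    then show ?thesis using h0 by (auto intro: Bochner_Integration.integral_nonneg)
  next
    case True
    then have pos: "\<alpha> > 0" "\<beta> > 0" by auto
    \<comment> \<open>The divisor of \<open>h\<close> that preserves the hypothesis when
      \<open>f\<close> and \<open>g\<close> are divided by their suprema.\<close>
    define \<theta> where "\<theta> = \<alpha> powr (1 - l) * \<beta> powr l"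
    have "\<theta> > 0" using pos by (simp add: \<theta>_def)
    let ?f = "\<lambda>y. f y / \<alpha>" and ?g = "\<lambda>y. g y / \<beta>" and ?h = "\<lambda>y. h y / \<theta>"
    have lev: "ennreal (1 - l) * emeasure lborel {x. t < ?f x} + ennreal l * emeasure lborel {x. t < ?g x}
               \<le> emeasure lborel {x. t < ?h x}" if "0 < t" for t
    proof (cases "t < 1")
      \<comment> \<open>From level 1 on, both superlevel sets on the left are empty by the
        normalisation.\<close>
      case False
      have "{x. t < ?f x} = {}" "{x. t < ?g x} = {}"
        using False fa gb pos by (auto simp: field_simps not_less) (smt (verit) mult_left_mono mult_cancel_left2)+
      then show ?thesis by simp
    next
      case True
      define X where "X = {x. t < ?f x}"
      define Y where "Y = {x. t < ?g x}"
      have XM[measurable]: "X \<in> sets borel" and YM[measurable]: "Y \<in> sets borel"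
        unfolding X_def Y_def by measurable
      have "\<exists>x. t * \<alpha> < f x"
        using True pos less_cSup_iff[OF _ baf, of "t * \<alpha>"] by (auto simp: \<alpha>_def)
      then have X: "X \<noteq> {}" using pos by (auto simp: X_def field_simps)
      have "\<exists>x. t * \<beta> < g x"
        using True pos less_cSup_iff[OF _ bag, of "t * \<beta>"] by (auto simp: \<beta>_def)
      then have Y: "Y \<noteq> {}" using pos by (auto simp: Y_def field_simps)
      have "X \<subseteq> cball 0 Bf" "Y \<subseteq> cball 0 Bg"
        using Bf Bg that by (force simp: X_def Y_def)+
      then have bX: "bounded X" and bY: "bounded Y"
        using bounded_subset bounded_cball by blast+
      have im: "{z. z /\<^sub>R c \<in> S} = (\<lambda>x. c *\<^sub>R x) ` S" if "c > 0" for c :: real and S :: "real set"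
      proof (intro equalityI subsetI)
        fix z assume "z \<in> {z. z /\<^sub>R c \<in> S}"
        then show "z \<in> (\<lambda>x. c *\<^sub>R x) ` S"
          using that by (intro image_eqI[where x="z /\<^sub>R c"]) auto
      qed (use that in \<open>auto simp flip: mult.assoc\<close>)
      have imX: "{z. z /\<^sub>R (1 - l) \<in> X} = (\<lambda>x. (1 - l) *\<^sub>R x) ` X"
        and imY: "{z. z /\<^sub>R l \<in> Y} = (\<lambda>x. l *\<^sub>R x) ` Y"
        using im[of "1 - l" X] im[of l Y] l by simp_all
      have "ennreal (1 - l) * emeasure lborel X + ennreal l * emeasure lborel Y =
            emeasure lborel {z. z /\<^sub>R (1 - l) \<in> X} + emeasure lborel {z. z /\<^sub>R l \<in> Y}"
        using l by (subst (1 2) emeasure_lborel_dilate) auto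
      also have "\<dots> \<le> emeasure lborel {x. t < ?h x}"
      proof (rule emeasure_real_sumset)
        show "{z. z /\<^sub>R (1 - l) \<in> X} \<in> sets borel" "{z. z /\<^sub>R l \<in> Y} \<in> sets borel" by measurable
        show "{x. t < ?h x} \<in> sets borel" by measurable
        show "{z. z /\<^sub>R (1 - l) \<in> X} \<noteq> {}" "{z. z /\<^sub>R l \<in> Y} \<noteq> {}"
          unfolding imX imY using X Y by auto
        show "bounded {z. z /\<^sub>R (1 - l) \<in> X}" "bounded {z. z /\<^sub>R l \<in> Y}"
          unfolding imX imY by (intro bounded_scaling bX bY)+
        show "x + y \<in> {x. t < ?h x}" if xy': "x \<in> {z. z /\<^sub>R (1 - l) \<in> X}" "y \<in> {z. z /\<^sub>R l \<in> Y}" for x y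
        proof -
          obtain x' y' where xy: "x = (1 - l) * x'" "y = l * y'" "x' \<in> X" "y' \<in> Y"
            using xy' unfolding imX imY by auto
          have "t = t powr (1 - l) * t powr l"
            using \<open>0 < t\<close> by (simp flip: powr_add)
          then have "t * \<theta> = (t * \<alpha>) powr (1 - l) * (t * \<beta>) powr l"
            using pos \<open>0 < t\<close> by (simp add: \<theta>_def powr_mult)
          also have "\<dots> < f x' powr (1 - l) * g y' powr l"
          proof -
            have "t * \<alpha> < f x'" "t * \<beta> < g y'" "0 < t * \<alpha>" "0 < t * \<beta>"
              using xy pos \<open>0 < t\<close> by (auto simp: X_def Y_def field_simps)
            then show ?thesis
              using l by (intro mult_strict_mono powr_less_mono2) auto
          qed
          also have "\<dots> \<le> h (x + y)" using le xy by simp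
          finally show ?thesis using \<open>\<theta> > 0\<close> by (simp add: field_simps)
        qed
      qed
      finally show ?thesis by (simp add: X_def Y_def)
    qed
    let ?i = "\<lambda>f::real \<Rightarrow> real. \<integral>\<^sup>+t. indicator {0<..} t * emeasure lborel {x. t < f x} \<partial>lborel"
    have lc: "ennreal (integral\<^sup>L lborel f / c) = ?i (\<lambda>y. f y / c)" if "bdd_supp f" "c > 0" for f c
    proof -
      have [measurable]: "f \<in> borel_measurable borel" and f0: "\<And>y. 0 \<le> f y"
        using that unfolding bdd_supp_def by blast+
      have "ennreal (integral\<^sup>L lborel f / c) = ennreal (integral\<^sup>L lborel (\<lambda>y. f y / c))" by simp
      also have "\<dots> = (\<integral>\<^sup>+y. ennreal (f y / c) \<partial>lborel)"
        using that f0 by (intro nn_integral_eq_integral[symmetric]) (auto intro: bdd_supp_integrable)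
      also have "\<dots> = ?i (\<lambda>y. f y / c)"
        using nn_integral_layer_cake[OF lborel.sigma_finite_measure_axioms, of "\<lambda>y. f y / c"] that f0 by simp
      finally show ?thesis .
    qed
    have meas: "(\<lambda>t. emeasure lborel {x. t < f x}) \<in> borel_measurable lborel"
      if [measurable]: "f \<in> borel_measurable borel" for f :: "real \<Rightarrow> real"
    proof -
      have "(\<lambda>t. \<integral>\<^sup>+x. (if t < f x then 1 else 0) \<partial>lborel) \<in> borel_measurable lborel"
        by measurable
      moreover have "(\<integral>\<^sup>+x. (if t < f x then 1 else 0) \<partial>lborel) = emeasure lborel {x. t < f x}" for t
      proof -
        have "(\<lambda>x. if t < f x then 1 else 0) = (indicator {x. t < f x} :: real \<Rightarrow> ennreal)"
          by (auto simp: indicator_def)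
        then show ?thesis by (simp add: nn_integral_indicator)
      qed
      ultimately show ?thesis by simp
    qed
    have [measurable]: "(\<lambda>t. emeasure lborel {x. t < f x / \<alpha>}) \<in> borel_measurable lborel"
      "(\<lambda>t. emeasure lborel {x. t < g x / \<beta>}) \<in> borel_measurable lborel"
      by (intro meas; measurable)+
    let ?a = "integral\<^sup>L lborel f / \<alpha>" and ?b = "integral\<^sup>L lborel g / \<beta>" and ?c = "integral\<^sup>L lborel h / \<theta>"
    have nn: "0 \<le> ?a" "0 \<le> ?b" "0 \<le> ?c"
      using Bf Bg h0 pos \<open>\<theta> > 0\<close> by (auto intro!: divide_nonneg_pos Bochner_Integration.integral_nonneg)
    have "ennreal ((1 - l) * ?a + l * ?b) = ennreal (1 - l) * ennreal ?a + ennreal l * ennreal ?b"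
    proof -
      have "ennreal ((1 - l) * a + l * b) = ennreal (1 - l) * ennreal a + ennreal l * ennreal b"
        if "0 \<le> a" "0 \<le> b" for a b
        using that l by (simp add: ennreal_mult ennreal_plus)
      from this[OF nn(1,2)] show ?thesis .
    qed
    also have "\<dots> = (\<integral>\<^sup>+t. indicator {0<..} t * (ennreal (1 - l) * emeasure lborel {x. t < ?f x} + ennreal l * emeasure lborel {x. t < ?g x}) \<partial>lborel)"
      unfolding lc[OF f pos(1)] lc[OF g pos(2)]
      by (simp add: nn_integral_add nn_integral_cmult distrib_left mult.left_commute[of "indicator _ _"])
    also have "\<dots> \<le> ?i ?h"
      using lev by (intro nn_integral_mono) (auto simp: indicator_def)
    also have "\<dots> = ennreal ?c" using lc[OF h \<open>\<theta> > 0\<close>] by simp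
    finally have *: "(1 - l) * ?a + l * ?b \<le> ?c"
      using nn by (subst (asm) ennreal_le_iff) auto
    have am_gm: "a powr (1 - l) * b powr l \<le> (1 - l) * a + l * b" if "0 \<le> a" "0 \<le> b" for a b
      using that l Youngs_inequality_0[of "1 - l" l a b] by (cases "a = 0 \<or> b = 0") auto
    note ** = am_gm[OF nn(1,2)]
    have "(integral\<^sup>L lborel f) powr (1 - l) * (integral\<^sup>L lborel g) powr l = \<theta> * (?a powr (1 - l) * ?b powr l)"
      using pos nn by (simp add: \<theta>_def powr_divide)
    also have "\<dots> \<le> \<theta> * ?c"
      using * ** \<open>\<theta> > 0\<close> by (intro mult_left_mono) auto
    finally show ?thesis using \<open>\<theta> > 0\<close> by simp
  qed
qed

section \<open>The Prekopa-Leindler inequality in several variables and Brunn-Minkowski\<close>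

definition bdd_supp_on :: "'i set \<Rightarrow> (('i \<Rightarrow> real) \<Rightarrow> real) \<Rightarrow> bool" where
  "bdd_supp_on I f \<longleftrightarrow> f \<in> borel_measurable (PiM I (\<lambda>_. lborel)) \<and>
     (\<exists>B. \<forall>x\<in>extensional I. 0 \<le> f x \<and> f x \<le> B \<and> (f x \<noteq> 0 \<longrightarrow> (\<forall>i\<in>I. \<bar>x i\<bar> \<le> B)))"

lemma space_PiM_lborel: "space (PiM I (\<lambda>_. lborel :: real measure)) = extensional I"
  by (auto simp: space_PiM PiE_def)

interpretation lborel_product: product_sigma_finite "\<lambda>_. lborel :: real measure"
  by standard

lemma bdd_supp_on_integrable:
  assumes "bdd_supp_on I f" "finite I"
  shows "integrable (PiM I (\<lambda>_. lborel)) f"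
proof -
  obtain B where B: "\<And>x. x \<in> extensional I \<Longrightarrow> 0 \<le> f x \<and> f x \<le> B \<and> (f x \<noteq> 0 \<longrightarrow> (\<forall>i\<in>I. \<bar>x i\<bar> \<le> B))"
    and [measurable]: "f \<in> borel_measurable (PiM I (\<lambda>_. lborel))"
    using assms unfolding bdd_supp_on_def by blast
  let ?A = "Pi\<^sub>E I (\<lambda>_. {-B..B})"
  show ?thesis
  proof (rule Bochner_Integration.integrable_bound)
    have "emeasure (PiM I (\<lambda>_. lborel)) ?A = (\<Prod>i\<in>I. emeasure lborel {-B..B})"
      using assms by (intro lborel_product.emeasure_PiM) auto
    also have "\<dots> < \<infinity>"
      using emeasure_lborel_Icc_eq[of "-B" B] by (cases "0 \<le> B") (auto simp: ennreal_power power_0_left)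
    finally have fin: "emeasure (PiM I (\<lambda>_. lborel)) ?A < \<infinity>" .
    have "?A \<in> sets (PiM I (\<lambda>_. lborel))"
      using assms(2) by (intro sets_PiM_I_finite) auto
    then show "integrable (PiM I (\<lambda>_. lborel)) (\<lambda>y. B * indicator ?A y :: real)"
      using fin by (intro integrable_mult_right integrable_real_indicator) auto
    show "AE y in PiM I (\<lambda>_. lborel). norm (f y) \<le> norm (B * indicator ?A y :: real)"
    proof (rule AE_I2)
      fix y assume "y \<in> space (PiM I (\<lambda>_. lborel :: real measure))"
      then have y: "y \<in> extensional I" by (simp add: space_PiM_lborel)
      show "norm (f y) \<le> norm (B * indicator ?A y :: real)"
      proof (cases "f y = 0")
        case False
        then have "y \<in> ?A" using B[OF y] y by (auto simp: PiE_def abs_le_iff)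
        then show ?thesis using B[OF y] by auto
      qed auto
    qed
  qed auto
qed

text \<open>The class is closed under integrating out one coordinate, which is what an induction on
  the index set consumes. A slice is bounded by \<open>B\<close> and vanishes outside
  \<open>{-B..B}\<close>, whence the bound \<open>2 * B * B\<close> for its integral;
  \<open>B + 2 * B * B\<close> then bounds both the new values and the coordinates of the new
  support.\<close>

lemma bdd_supp_on_slice:
  assumes "bdd_supp_on (insert i I) f" "finite I" "i \<notin> I"
  shows "x \<in> extensional I \<Longrightarrow> bdd_supp (\<lambda>y. f (x(i := y)))"
    and "bdd_supp_on I (\<lambda>x. \<integral>y. f (x(i := y)) \<partial>lborel)"
proof -
  obtain B where B: "\<And>x. x \<in> extensional (insert i I) \<Longrightarrow> 0 \<le> f x \<and> f x \<le> B \<and> (f x \<noteq> 0 \<longrightarrow> (\<forall>i\<in>insert i I. \<bar>x i\<bar> \<le> B))"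
    and fm[measurable]: "f \<in> borel_measurable (PiM (insert i I) (\<lambda>_. lborel))"
    using assms unfolding bdd_supp_on_def by blast
  have ext: "x(i := y) \<in> extensional (insert i I)" if "x \<in> extensional I" for x :: "'a \<Rightarrow> real" and y
    using that by (auto simp: extensional_def)
  have m2: "(\<lambda>(x, y). f (x(i := y))) \<in> borel_measurable (PiM I (\<lambda>_. lborel) \<Otimes>\<^sub>M lborel)"
    using measurable_compose[OF measurable_add_dim[of i I "\<lambda>_. lborel :: real measure"] fm] by (simp add: split_def)
  show 1: "bdd_supp (\<lambda>y. f (x(i := y)))" if x: "x \<in> extensional I" for x
  proof -
    have "(\<lambda>y. f (x(i := y))) \<in> borel_measurable lborel"
      using measurable_compose[OF measurable_Pair1'[of x "PiM I (\<lambda>_. lborel)" lborel] m2] x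
      by (simp add: space_PiM_lborel)
    then show ?thesis
      unfolding bdd_supp_def using B[OF ext[OF x]] by (auto intro!: exI[of _ B])
  qed
  have Bnn: "B \<ge> 0"
    using B[of "\<lambda>_. undefined"] by (auto simp: extensional_def)
  have bd: "(\<integral>y. f (x(i := y)) \<partial>lborel) \<le> 2 * B * B" if x: "x \<in> extensional I" for x
  proof -
    have "(\<integral>y. f (x(i := y)) \<partial>lborel) \<le> (\<integral>y. B * indicator {-B..B} y \<partial>lborel)"
    proof (rule integral_mono)
      show "f (x(i := y)) \<le> B * indicator {-B..B} y" for y
        using B[OF ext[OF x], of y] by (cases "f (x(i := y)) = 0") (auto simp: indicator_def abs_le_iff Bnn)
    qed (use bdd_supp_integrable[OF 1[OF x]] in \<open>auto intro!: integrable_real_indicator simp: emeasure_lborel_Icc_eq\<close>)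
    also have "\<dots> = 2 * B * B" using Bnn by simp
    finally show ?thesis .
  qed
  have "(\<lambda>x. \<integral>y. f (x(i := y)) \<partial>lborel) \<in> borel_measurable (PiM I (\<lambda>_. lborel))"
    using lborel.borel_measurable_lebesgue_integral[OF m2] by simp
  moreover have "0 \<le> (\<integral>y. f (x(i := y)) \<partial>lborel) \<and> (\<integral>y. f (x(i := y)) \<partial>lborel) \<le> B + 2 * B * B \<and>
     ((\<integral>y. f (x(i := y)) \<partial>lborel) \<noteq> 0 \<longrightarrow> (\<forall>j\<in>I. \<bar>x j\<bar> \<le> B + 2 * B * B))" if x: "x \<in> extensional I" for x
  proof (intro conjI impI ballI)
    show "0 \<le> (\<integral>y. f (x(i := y)) \<partial>lborel)"
      using B[OF ext[OF x]] by (intro Bochner_Integration.integral_nonneg) auto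
    show "(\<integral>y. f (x(i := y)) \<partial>lborel) \<le> B + 2 * B * B"
      using bd[OF x] Bnn by simp
    fix j assume "(\<integral>y. f (x(i := y)) \<partial>lborel) \<noteq> 0" and j: "j \<in> I"
    then obtain y where "f (x(i := y)) \<noteq> 0"
      by (metis Bochner_Integration.integral_cong Bochner_Integration.integral_zero)
    then have "\<bar>(x(i := y)) j\<bar> \<le> B" using B[OF ext[OF x]] j by blast
    then have "\<bar>x j\<bar> \<le> B" using j assms(3) by (auto split: if_splits)
    then show "\<bar>x j\<bar> \<le> B + 2 * B * B" using Bnn by (simp add: add_increasing2)
  qed
  ultimately show "bdd_supp_on I (\<lambda>x. \<integral>y. f (x(i := y)) \<partial>lborel)"
    unfolding bdd_supp_on_def by blast
qed

text \<open>Induction on the coordinates: the one-dimensional inequality, applied to slices at fixed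
  remaining coordinates, is exactly the hypothesis of the inequality for the slice integrals in one
  dimension less. Over the empty index set the integral is the value at the single point.\<close>

lemma prekopa_leindler_PiM:
  assumes "finite I" "bdd_supp_on I f" "bdd_supp_on I g" "bdd_supp_on I h" and l: "0 < l" "l < 1"
    and "\<And>x y. x \<in> extensional I \<Longrightarrow> y \<in> extensional I \<Longrightarrow>
       f x powr (1 - l) * g y powr l \<le> h (restrict (\<lambda>i. (1 - l) * x i + l * y i) I)"
  shows "(integral\<^sup>L (PiM I (\<lambda>_. lborel)) f) powr (1 - l) * (integral\<^sup>L (PiM I (\<lambda>_. lborel)) g) powr l
     \<le> integral\<^sup>L (PiM I (\<lambda>_. lborel)) h"
  using assms(1-4,7)
proof (induction I arbitrary: f g h rule: finite_induct)
  case empty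
  have "restrict x {} = (\<lambda>_. undefined)" for x :: "'a \<Rightarrow> real" by auto
  then show ?case
    using empty.prems(4)[of "\<lambda>_. undefined" "\<lambda>_. undefined"]
    by (simp add: PiM_empty lebesgue_integral_count_space_finite)
next
  case (insert i I)
  let ?S = "\<lambda>f x. \<integral>y. f (x(i := y)) \<partial>lborel"
  note sl = bdd_supp_on_slice[OF _ insert.hyps(1,2)]
  have "(integral\<^sup>L (PiM I (\<lambda>_. lborel)) (?S f)) powr (1 - l) * (integral\<^sup>L (PiM I (\<lambda>_. lborel)) (?S g)) powr l
     \<le> integral\<^sup>L (PiM I (\<lambda>_. lborel)) (?S h)"
  proof (rule insert.IH)
    show "bdd_supp_on I (?S f)" "bdd_supp_on I (?S g)" "bdd_supp_on I (?S h)"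
      by (intro sl(2) insert.prems)+
    fix x y :: "'a \<Rightarrow> real" assume xy: "x \<in> extensional I" "y \<in> extensional I"
    let ?z = "restrict (\<lambda>i. (1 - l) * x i + l * y i) I"
    show "?S f x powr (1 - l) * ?S g y powr l \<le> ?S h ?z"
    proof (rule prekopa_leindler_real[OF _ _ _ l])
      show "bdd_supp (\<lambda>t. f (x(i := t)))" "bdd_supp (\<lambda>t. g (y(i := t)))" "bdd_supp (\<lambda>t. h (?z(i := t)))"
        using xy insert.prems by (auto intro!: sl(1))
      fix s t
      have "restrict (\<lambda>j. (1 - l) * (x(i := s)) j + l * (y(i := t)) j) (insert i I) = ?z(i := (1 - l) * s + l * t)"
        using insert.hyps(2) by (auto simp: restrict_def)
      moreover have "x(i := s) \<in> extensional (insert i I)" "y(i := t) \<in> extensional (insert i I)"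
        using xy by (auto simp: extensional_def)
      ultimately show "f (x(i := s)) powr (1 - l) * g (y(i := t)) powr l \<le> h (?z(i := (1 - l) * s + l * t))"
        using insert.prems(4)[of "x(i := s)" "y(i := t)"] by (simp del: fun_upd_apply)
    qed
  qed
  then show ?case
    using insert.hyps insert.prems(1-3)
    by (simp add: lborel_product.product_integral_insert bdd_supp_on_integrable)
qed

text \<open>For indicator functions the left side of the pointwise hypothesis is 0 or 1, so the
  hypothesis becomes an inclusion of sets. The map \<open>e\<close> carries the product measure over
  \<open>Basis\<close> to \<open>lborel\<close>.\<close>

lemma prekopa_leindler_indicator:
  fixes A B Z :: "'a::euclidean_space set"
  assumes [measurable]: "A \<in> sets borel" "B \<in> sets borel" "Z \<in> sets borel"
    and bdd: "bounded A" "bounded B" "bounded Z" and l: "0 < l" "l < 1"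
    and sub: "\<And>x y. x \<in> A \<Longrightarrow> y \<in> B \<Longrightarrow> (1 - l) *\<^sub>R x + l *\<^sub>R y \<in> Z"
  shows "measure lborel A powr (1 - l) * measure lborel B powr l \<le> measure lborel Z"
proof -
  define e :: "('a \<Rightarrow> real) \<Rightarrow> 'a" where "e x = (\<Sum>b\<in>Basis. x b *\<^sub>R b)" for x
  let ?P = "PiM Basis (\<lambda>_::'a. lborel :: real measure)"
  have [measurable]: "e \<in> measurable ?P borel"
    unfolding e_def by measurable
  have coord: "e x \<bullet> b = x b" if "b \<in> Basis" for x b
    using that by (simp add: e_def inner_sum_left inner_Basis if_distrib sum.delta cong: if_cong)
  have meas: "measure lborel S = (\<integral>x. indicator S (e x) \<partial>?P)" if [measurable]: "S \<in> sets borel" for S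
  proof -
    have "measure lborel S = (\<integral>x. indicator S x \<partial>(lborel :: 'a measure))" by simp
    also have "\<dots> = (\<integral>x. indicator S x \<partial>distr ?P borel e)"
      by (subst lborel_eq) (simp add: e_def[abs_def])
    also have "\<dots> = (\<integral>x. indicator S (e x) \<partial>?P)"
      by (rule integral_distr) measurable
    finally show ?thesis .
  qed
  have bs: "bdd_supp_on Basis (\<lambda>x. indicator S (e x))" if [measurable]: "S \<in> sets borel" and "bounded S" for S :: "'a set"
  proof -
    obtain M where M: "\<And>x. x \<in> S \<Longrightarrow> norm x \<le> M" using \<open>bounded S\<close> bounded_iff by metis
    have "\<bar>x b\<bar> \<le> max 1 M" if "e x \<in> S" "b \<in> Basis" for x b
      using M[OF that(1)] Basis_le_norm[OF that(2), of "e x"] coord[OF that(2), of x] by linarith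
    then have "\<forall>x\<in>extensional Basis. (0::real) \<le> indicator S (e x) \<and> indicator S (e x) \<le> max 1 M \<and>
        (indicator S (e x) \<noteq> (0::real) \<longrightarrow> (\<forall>i\<in>Basis. \<bar>x i\<bar> \<le> max 1 M))"
      by (auto simp: indicator_def)
    moreover have "(\<lambda>x. indicator S (e x) :: real) \<in> borel_measurable ?P" by measurable
    ultimately show ?thesis unfolding bdd_supp_on_def by blast
  qed
  show ?thesis
    unfolding meas[OF assms(1)] meas[OF assms(2)] meas[OF assms(3)]
  proof (rule prekopa_leindler_PiM[OF finite_Basis _ _ _ l])
    fix x y :: "'a \<Rightarrow> real"
    have "e (restrict (\<lambda>i. (1 - l) * x i + l * y i) Basis) = (1 - l) *\<^sub>R e x + l *\<^sub>R e y"
      by (rule euclidean_eqI) (simp add: coord inner_add_left)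
    then show "indicator A (e x) powr (1 - l) * indicator B (e y) powr l
       \<le> (indicator Z (e (restrict (\<lambda>i. (1 - l) * x i + l * y i) Basis)) :: real)"
      using sub l by (auto simp: indicator_def)
  qed (use bdd in \<open>auto intro!: bs\<close>)
qed

text \<open>The dilates of \<open>A\<close> by \<open>1 / a\<close> and of \<open>B\<close> by
  \<open>1 / b\<close> both have measure 1, so the multiplicative inequality is applied where it
  loses nothing. The weight \<open>l = b / (a + b)\<close> places their convex combinations in the
  dilate of \<open>Z\<close> by \<open>1 / (a + b)\<close>.\<close>

theorem brunn_minkowski:
  fixes A B Z :: "'a::euclidean_space set"
  assumes [measurable]: "A \<in> sets borel" "B \<in> sets borel" "Z \<in> sets borel"
    and bdd: "bounded A" "bounded B" "bounded Z"
    and sub: "\<And>x y. x \<in> A \<Longrightarrow> y \<in> B \<Longrightarrow> x + y \<in> Z"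
    and a: "measure lborel A = a ^ DIM('a)" "a > 0" and b: "measure lborel B = b ^ DIM('a)" "b > 0"
  shows "(a + b) ^ DIM('a) \<le> measure lborel Z"
proof -
  define l where "l = b / (a + b)"
  have l: "0 < l" "l < 1" "1 - l = a / (a + b)" using a b by (auto simp: l_def field_simps)
  have dil: "measure lborel {z. c *\<^sub>R z \<in> S} = measure lborel S / c ^ DIM('a)"
    if "S \<in> sets borel" "c > 0" for c and S :: "'a set"
    using emeasure_lborel_dilate[OF that(1), of "1/c"] that(2)
    by (simp add: measure_def enn2real_mult power_divide)
  have bddS: "bounded {z. c *\<^sub>R z \<in> S}" if "bounded S" "c > 0" for c and S :: "'a set"
  proof -
    have "{z. c *\<^sub>R z \<in> S} = (\<lambda>x. (1/c) *\<^sub>R x) ` S"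
      using that(2) by (auto simp: image_iff) (metis inverse_eq_divide scaleR_one scaleR_scaleR left_inverse less_irrefl)
    then show ?thesis using that(1) by (simp add: bounded_scaling)
  qed
  have "measure lborel {z. a *\<^sub>R z \<in> A} powr (1 - l) * measure lborel {z. b *\<^sub>R z \<in> B} powr l
     \<le> measure lborel {z. (a + b) *\<^sub>R z \<in> Z}"
  proof (rule prekopa_leindler_indicator)
    show "(1 - l) *\<^sub>R x + l *\<^sub>R y \<in> {z. (a + b) *\<^sub>R z \<in> Z}" if "x \<in> {z. a *\<^sub>R z \<in> A}" "y \<in> {z. b *\<^sub>R z \<in> B}" for x y
    proof -
      have "(a + b) *\<^sub>R ((1 - l) *\<^sub>R x + l *\<^sub>R y) = a *\<^sub>R x + b *\<^sub>R y"
        unfolding l(3) using a b by (simp add: l_def scaleR_add_right)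
      then show ?thesis using sub that by simp
    qed
  qed (use a b bdd l in \<open>auto intro!: bddS\<close>)
  also have "\<dots> = measure lborel Z / (a + b) ^ DIM('a)"
    using a b by (intro dil) auto
  finally show ?thesis
    using a b by (simp add: dil field_simps)
qed

subsection \<open>Smooth maps\<close>

lemma differentiable_on_openD:
  assumes "f differentiable_on U" "open U" "x \<in> U"
  shows "(f has_derivative frechet_derivative f (at x)) (at x)"
  using assms by (simp add: differentiable_on_eq_differentiable_at frechet_derivative_works)

text \<open>Taking \<open>cong\<close> as a hypothesis breaks a circle: the congruence rule is
  proved by induction with this introduction rule, which itself exchanges \<open>f'\<close> for
  \<open>frechet_derivative f\<close> on \<open>U\<close> and so uses congruence at the lower
  order.\<close>

lemma Ck_on_SucI:
  fixes f :: "'a::real_normed_vector \<Rightarrow> 'b::real_normed_vector"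
  assumes "open U" "\<And>x. x \<in> U \<Longrightarrow> (f has_derivative f' x) (at x)"
    and "\<And>v. Ck_on k (\<lambda>x. f' x v) U"
    and cong: "\<And>f g :: 'a::real_normed_vector \<Rightarrow> 'b::real_normed_vector. \<lbrakk>\<And>x. x \<in> U \<Longrightarrow> f x = g x; Ck_on k f U\<rbrakk> \<Longrightarrow> Ck_on k g U"
  shows "Ck_on (Suc k) f U"
proof -
  have eq: "f' x v = frechet_derivative f (at x) v" if "x \<in> U" for x v
    using frechet_derivative_at[OF assms(2)[OF that]] by simp
  have "Ck_on k (\<lambda>x. frechet_derivative f (at x) v) U" for v
    by (rule cong[OF eq assms(3)])
  moreover have "f differentiable_on U"
    using assms(1,2) by (auto simp: differentiable_on_eq_differentiable_at differentiable_def)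
  ultimately show ?thesis by simp
qed

lemma Ck_on_cong:
  assumes "open U" "\<And>x. x \<in> U \<Longrightarrow> f x = g x" "Ck_on k f U"
  shows "Ck_on k g U"
  using assms(2,3)
proof (induction k arbitrary: f g)
  case 0
  then show ?case using continuous_on_cong[of U U f g] by auto
next
  case (Suc k)
  have der: "(g has_derivative frechet_derivative f (at x)) (at x)" if "x \<in> U" for x
    using Suc.prems that assms(1)
    by (intro has_derivative_transform_within_open[OF differentiable_on_openD[of f U x]]) auto
  show ?case
    using Suc.prems by (intro Ck_on_SucI[OF assms(1) der _ Suc.IH]) auto
qed

lemmas Ck_on_SucI' = Ck_on_SucI[OF _ _ _ Ck_on_cong]

lemma Ck_on_has_derivative:
  assumes "Ck_on (Suc k) f U" "open U" "x \<in> U"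
  shows "(f has_derivative frechet_derivative f (at x)) (at x)"
  using assms differentiable_on_openD by auto

lemma Ck_on_Suc_imp:
  assumes "Ck_on (Suc k) f U"
  shows "Ck_on k f U"
  using assms
proof (induction k arbitrary: f)
  case 0
  then show ?case by (auto intro: differentiable_imp_continuous_on)
qed auto

lemma Ck_on_continuous:
  assumes "Ck_on k f U"
  shows "continuous_on U f"
  using assms by (cases k) (auto intro: differentiable_imp_continuous_on)

lemma Ck_on_const:
  assumes "open U"
  shows "Ck_on k (\<lambda>x. c) U"
proof (induction k arbitrary: c)
  case (Suc k)
  show ?case by (rule Ck_on_SucI'[OF assms has_derivative_const Suc assms])
qed auto

lemma Ck_on_bounded_linear:
  assumes "open U" "Ck_on k f U" "bounded_linear L"
  shows "Ck_on k (\<lambda>x. L (f x)) U"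
  using assms(2)
proof (induction k arbitrary: f)
  case 0
  then show ?case by (auto intro: bounded_linear.continuous_on[OF assms(3)])
next
  case (Suc k)
  show ?case
  proof (rule Ck_on_SucI'[OF assms(1) _ _ assms(1)])
    show "((\<lambda>x. L (f x)) has_derivative (\<lambda>v. L (frechet_derivative f (at x) v))) (at x)" if "x \<in> U" for x
      using Ck_on_has_derivative[OF Suc.prems assms(1) that]
      by (rule bounded_linear.has_derivative[OF assms(3)])
  qed (use Suc in auto)
qed

lemma Ck_on_id:
  assumes "open U"
  shows "Ck_on k (\<lambda>x. x) U"
proof (cases k)
  case (Suc k)
  show ?thesis unfolding Suc
    by (rule Ck_on_SucI'[OF assms has_derivative_ident Ck_on_const[OF assms] assms])
qed auto

lemma Ck_on_linear:
  assumes "open U" "bounded_linear L"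
  shows "Ck_on k L U"
  using Ck_on_bounded_linear[OF assms(1) Ck_on_id[OF assms(1)] assms(2)] by simp

lemma Ck_on_add:
  assumes "open U" "Ck_on k f U" "Ck_on k g U"
  shows "Ck_on k (\<lambda>x. f x + g x) U"
  using assms(2,3)
proof (induction k arbitrary: f g)
  case 0
  then show ?case by (auto intro: continuous_on_add)
next
  case (Suc k)
  show ?case
  proof (rule Ck_on_SucI'[OF assms(1) _ _ assms(1)])
    show "((\<lambda>x. f x + g x) has_derivative (\<lambda>v. frechet_derivative f (at x) v + frechet_derivative g (at x) v)) (at x)"
      if "x \<in> U" for x
      by (intro has_derivative_add Ck_on_has_derivative[OF Suc.prems(1) assms(1) that]
          Ck_on_has_derivative[OF Suc.prems(2) assms(1) that])
  qed (use Suc in auto)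
qed

lemma Ck_on_sum:
  assumes "open U" "\<And>i. i \<in> I \<Longrightarrow> Ck_on k (f i) U"
  shows "Ck_on k (\<lambda>x. \<Sum>i\<in>I. f i x) U"
  using assms(2)
  by (induction I rule: infinite_finite_induct) (auto intro: Ck_on_const[OF assms(1)] Ck_on_add[OF assms(1)])

lemma Ck_on_scaleR:
  assumes "open U" "Ck_on k f U" "Ck_on k g U"
  shows "Ck_on k (\<lambda>x. f x *\<^sub>R g x) U"
  using assms(2,3)
proof (induction k arbitrary: f g)
  case 0
  then show ?case by (auto intro: continuous_on_scaleR)
next
  case (Suc k)
  show ?case
  proof (rule Ck_on_SucI'[OF assms(1) _ _ assms(1)])
    show "((\<lambda>x. f x *\<^sub>R g x) has_derivative
        (\<lambda>v. f x *\<^sub>R frechet_derivative g (at x) v + frechet_derivative f (at x) v *\<^sub>R g x)) (at x)"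
      if "x \<in> U" for x
      by (intro has_derivative_scaleR Ck_on_has_derivative[OF Suc.prems(1) assms(1) that]
          Ck_on_has_derivative[OF Suc.prems(2) assms(1) that])
    show "Ck_on k (\<lambda>x. f x *\<^sub>R frechet_derivative g (at x) v + frechet_derivative f (at x) v *\<^sub>R g x) U" for v
      using Suc.prems Ck_on_Suc_imp[OF Suc.prems(1)] Ck_on_Suc_imp[OF Suc.prems(2)]
      by (intro Ck_on_add[OF assms(1)] Suc.IH) auto
  qed
qed

lemma Ck_on_mult:
  fixes f g :: "'a::real_normed_vector \<Rightarrow> real"
  assumes "open U" "Ck_on k f U" "Ck_on k g U"
  shows "Ck_on k (\<lambda>x. f x * g x) U"
  using Ck_on_scaleR[OF assms] by simp

lemma Ck_on_Pair:
  assumes "open U" "Ck_on k f U" "Ck_on k g U"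
  shows "Ck_on k (\<lambda>x. (f x, g x)) U"
proof -
  have "bounded_linear (\<lambda>x::'b. (x, 0::'c))" "bounded_linear (\<lambda>y::'c. (0::'b, y))"
    by (auto intro!: bounded_linear_Pair bounded_linear_ident bounded_linear_zero)
  then have "Ck_on k (\<lambda>x. (f x, 0) + (0, g x)) U"
    using assms by (intro Ck_on_add) (auto intro: Ck_on_bounded_linear)
  then show ?thesis by simp
qed

text \<open>Expanding the inner derivative in the basis writes the derivative of the composition as
  a sum of products: a component of the derivative of \<open>g\<close> times a derivative of
  \<open>f\<close> along a fixed vector, composed with \<open>g\<close>. The second factor is a
  composition of one order less with another outer function, which is why the induction varies
  \<open>f\<close>.\<close>

lemma Ck_on_compose:
  fixes g :: "'a::real_normed_vector \<Rightarrow> 'b::euclidean_space" and f :: "'b \<Rightarrow> 'c::real_normed_vector"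
  assumes "open U" "open V" "Ck_on k f V" "Ck_on k g U" "g ` U \<subseteq> V"
  shows "Ck_on k (\<lambda>x. f (g x)) U"
  using assms(3,4)
proof (induction k arbitrary: f)
  case 0
  then show ?case using assms(5) by (auto intro: continuous_on_compose2)
next
  case (Suc k)
  let ?D = "\<lambda>x v. \<Sum>b\<in>Basis. (frechet_derivative g (at x) v \<bullet> b) *\<^sub>R frechet_derivative f (at (g x)) b"
  show ?case
  proof (rule Ck_on_SucI'[OF assms(1) _ _ assms(1)])
    show "((\<lambda>x. f (g x)) has_derivative ?D x) (at x)" if "x \<in> U" for x
    proof -
      have g: "(g has_derivative frechet_derivative g (at x)) (at x)"
        by (rule Ck_on_has_derivative[OF Suc.prems(2) assms(1) that])
      have f: "(f has_derivative frechet_derivative f (at (g x))) (at (g x))"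
        using that assms(5) by (intro Ck_on_has_derivative[OF Suc.prems(1) assms(2)]) auto
      interpret bounded_linear "frechet_derivative f (at (g x))"
        by (rule has_derivative_bounded_linear[OF f])
      have "frechet_derivative f (at (g x)) (\<Sum>b\<in>Basis. (y \<bullet> b) *\<^sub>R b) =
          (\<Sum>b\<in>Basis. (y \<bullet> b) *\<^sub>R frechet_derivative f (at (g x)) b)" for y
        by (simp only: sum scaleR)
      then have "frechet_derivative f (at (g x)) y = (\<Sum>b\<in>Basis. (y \<bullet> b) *\<^sub>R frechet_derivative f (at (g x)) b)" for y
        unfolding euclidean_representation .
      then show ?thesis
        by (intro has_derivative_eq_rhs[OF has_derivative_compose[OF g f]] ext)
    qed
    show "Ck_on k (\<lambda>x. ?D x v) U" for v
    proof (intro Ck_on_sum Ck_on_scaleR assms(1))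
      fix b :: 'b
      show "Ck_on k (\<lambda>x. frechet_derivative g (at x) v \<bullet> b) U"
        using Suc.prems(2) by (auto intro!: Ck_on_bounded_linear[OF assms(1) _ bounded_linear_inner_left])
      show "Ck_on k (\<lambda>x. frechet_derivative f (at (g x)) b) U"
        using Suc.prems Ck_on_Suc_imp[OF Suc.prems(2)] by (intro Suc.IH) auto
    qed
  qed
qed

lemma Ck_on_inverse:
  fixes f :: "'a::real_normed_vector \<Rightarrow> real"
  assumes "open U" "Ck_on k f U" "\<And>x. x \<in> U \<Longrightarrow> f x \<noteq> 0"
  shows "Ck_on k (\<lambda>x. inverse (f x)) U"
  using assms(2)
proof (induction k)
  case 0
  then show ?case using assms(3) by (auto intro!: continuous_on_inverse)
next
  case (Suc k)
  let ?D = "\<lambda>x v. - 1 * (inverse (f x) * (frechet_derivative f (at x) v * inverse (f x)))"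
  show ?case
  proof (rule Ck_on_SucI'[OF assms(1) _ _ assms(1)])
    show "((\<lambda>x. inverse (f x)) has_derivative ?D x) (at x)" if "x \<in> U" for x
      using Deriv.has_derivative_inverse[OF assms(3)[OF that] Ck_on_has_derivative[OF Suc.prems assms(1) that]]
      by (simp only: mult.assoc mult_minus1)
    show "Ck_on k (\<lambda>x. ?D x v) U" for v
      using Suc.prems Suc.IH[OF Ck_on_Suc_imp[OF Suc.prems]] by (intro Ck_on_mult Ck_on_const assms(1)) auto
  qed
qed

lemma Ck_on_grad:
  fixes f :: "'a::euclidean_space \<Rightarrow> real"
  assumes "open U" "Ck_on (Suc k) f U"
  shows "Ck_on k (\<lambda>x. \<Sum>b\<in>Basis. frechet_derivative f (at x) b *\<^sub>R b) U"
  using assms by (intro Ck_on_sum Ck_on_scaleR Ck_on_const) auto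

subsection \<open>The Euclidean outward normal\<close>

definition grad :: "('a::euclidean_space \<Rightarrow> real) \<Rightarrow> 'a \<Rightarrow> 'a" where
  "grad f x = (\<Sum>b\<in>Basis. frechet_derivative f (at x) b *\<^sub>R b)"

lemma grad_inner:
  assumes "f differentiable (at x)"
  shows "frechet_derivative f (at x) v = grad f x \<bullet> v"
proof -
  interpret bounded_linear "frechet_derivative f (at x)"
    using assms by (intro has_derivative_bounded_linear[of f]) (simp add: frechet_derivative_works)
  have "frechet_derivative f (at x) (\<Sum>b\<in>Basis. (v \<bullet> b) *\<^sub>R b) = (\<Sum>b\<in>Basis. (v \<bullet> b) *\<^sub>R frechet_derivative f (at x) b)"
    by (simp only: sum scaleR)
  also have "\<dots> = grad f x \<bullet> v"
    by (simp add: grad_def inner_sum_left mult.commute inner_commute[of v])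
  finally show ?thesis
    by (simp add: euclidean_representation)
qed

lemma defining_function_mem:
  assumes "defining_function \<Omega> U f" "x \<in> U"
  shows "x \<in> \<Omega> \<longleftrightarrow> f x \<le> 0"
  using assms unfolding defining_function_def by blast

lemma smooth_bounded_domain_frontierE:
  assumes "smooth_bounded_domain \<Omega>" "x \<in> frontier \<Omega>"
  obtains U f where "x \<in> U" "defining_function \<Omega> U f"
  using assms unfolding smooth_bounded_domain_def by blast

lemma defining_function_differentiable:
  assumes "defining_function \<Omega> U f" "x \<in> U"
  shows "f differentiable (at x)"
  using assms Ck_on_has_derivative[of 0 f U x]
  by (auto simp: defining_function_def smooth_on_def differentiable_def)

lemma defining_function_grad:
  assumes "defining_function \<Omega> U f" "x \<in> U"
  shows "frechet_derivative f (at x) v = grad f x \<bullet> v" "grad f x \<noteq> 0"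
  using assms grad_inner[OF defining_function_differentiable[OF assms]]
  by (auto simp: defining_function_def)

lemma defining_function_has_derivative:
  assumes "defining_function \<Omega> U f" "x \<in> U"
  shows "(f has_derivative (\<lambda>v. grad f x \<bullet> v)) (at x)"
proof -
  have "frechet_derivative f (at x) = (\<lambda>v. grad f x \<bullet> v)"
    by (rule ext) (rule defining_function_grad(1)[OF assms])
  then show ?thesis
    using defining_function_differentiable[OF assms] by (simp add: frechet_derivative_works)
qed

lemma defining_function_DERIV:
  assumes "defining_function \<Omega> U f" "x \<in> U"
  shows "((\<lambda>t. f (x + t *\<^sub>R v)) has_real_derivative grad f x \<bullet> v) (at 0)"
proof -
  have "(f has_derivative (\<lambda>v. grad f x \<bullet> v)) (at (x + 0 *\<^sub>R v))"
    using defining_function_has_derivative[OF assms] by simp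
  moreover have "((\<lambda>t. x + t *\<^sub>R v) has_derivative (\<lambda>t. t *\<^sub>R v)) (at 0)"
    by (auto intro!: derivative_eq_intros)
  ultimately have "((\<lambda>t. f (x + t *\<^sub>R v)) has_derivative (\<lambda>t. grad f x \<bullet> (t *\<^sub>R v))) (at 0)"
    using has_derivative_compose by blast
  then show ?thesis
    by (simp add: has_field_derivative_def fun_eq_iff mult.commute[of _ "grad f x \<bullet> v"])
qed

lemma eventually_in_open_ray:
  fixes x v :: "'a::real_normed_vector"
  assumes "open U" "x \<in> U"
  shows "\<forall>\<^sub>F t::real in at_right 0. x + t *\<^sub>R v \<in> U"
proof -
  have "((\<lambda>t. x + t *\<^sub>R v) \<longlongrightarrow> x + 0 *\<^sub>R v) (at_right 0)"
    by (intro tendsto_intros)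
  then show ?thesis using assms by (auto dest: topological_tendstoD)
qed

lemma eventually_sign_ray:
  assumes "defining_function \<Omega> U f" "x \<in> U" "f x = 0"
  shows "grad f x \<bullet> v > 0 \<Longrightarrow> \<forall>\<^sub>F t in at_right 0. f (x + t *\<^sub>R v) > 0"
    and "grad f x \<bullet> v < 0 \<Longrightarrow> \<forall>\<^sub>F t in at_right 0. f (x + t *\<^sub>R v) < 0"
  using DERIV_pos_inc_right[OF defining_function_DERIV[OF assms(1,2)], of v]
    DERIV_neg_dec_right[OF defining_function_DERIV[OF assms(1,2)], of v] assms(3)
  by (auto simp: eventually_at_right_field)

text \<open>The nonvanishing gradient makes zeros of \<open>f\<close> boundary points, since moving
  along it leaves \<open>\<Omega>\<close> at once. Where \<open>f\<close> is nonzero, its sign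
  persists nearby by continuity.\<close>

lemma frontier_defining_function:
  fixes \<Omega> :: "'a::euclidean_space set"
  assumes df: "defining_function \<Omega> U f" and x: "x \<in> U"
  shows "x \<in> frontier \<Omega> \<longleftrightarrow> f x = 0"
proof -
  have "open U" and Om: "\<And>y. y \<in> U \<Longrightarrow> y \<in> \<Omega> \<longleftrightarrow> f y \<le> 0"
    using df by (auto simp: defining_function_def)
  have cont: "continuous_on U f"
    using df by (auto simp: defining_function_def smooth_on_def intro: Ck_on_continuous)
  consider "f x < 0" | "f x > 0" | "f x = 0" by linarith
  then show ?thesis
  proof cases
    case 1
    have "open (U \<inter> f -` {..<0})"
      by (intro continuous_open_preimage cont \<open>open U\<close>) auto
    then have "x \<in> interior \<Omega>"
      using 1 x Om by (intro interiorI[of "U \<inter> f -` {..<0}"]) auto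
    then show ?thesis using 1 by (auto simp: frontier_def)
  next
    case 2
    have "open (U \<inter> f -` {0<..})"
      by (intro continuous_open_preimage cont \<open>open U\<close>) auto
    then have "x \<notin> closure \<Omega>"
      using 2 x Om open_Int_closure_eq_empty[of "U \<inter> f -` {0<..}" \<Omega>] by force
    then show ?thesis using 2 by (auto simp: frontier_def)
  next
    case 3
    have "x \<notin> interior \<Omega>"
    proof
      assume "x \<in> interior \<Omega>"
      then have "\<forall>\<^sub>F t in at_right 0. x + t *\<^sub>R grad f x \<in> interior \<Omega> \<inter> U"
        using x \<open>open U\<close> by (intro eventually_in_open_ray) auto
      moreover have "\<forall>\<^sub>F t in at_right 0. f (x + t *\<^sub>R grad f x) > 0"
        using defining_function_grad(2)[OF df x] by (intro eventually_sign_ray[OF df x 3]) auto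
      ultimately have "\<forall>\<^sub>F t::real in at_right 0. False"
        by eventually_elim (use Om interior_subset in fastforce)
      then show False by simp
    qed
    moreover have "x \<in> \<Omega>" using Om x 3 by simp
    ultimately show ?thesis using 3 closure_subset by (auto simp: frontier_def)
  qed
qed

text \<open>The component \<open>w\<close> of \<open>G2\<close> orthogonal to \<open>G\<close> must
  vanish: the vector \<open>w - e *\<^sub>R G\<close> lies in the open half-space for every
  \<open>e > 0\<close>, and testing with it gives
  \<open>w \<bullet> w \<le> e * (G2 \<bullet> G)\<close>, where the right side can be made
  arbitrarily small.\<close>

lemma positive_multiple_if_halfspace_subset:
  fixes G G2 :: "'a::real_inner"
  assumes "G \<noteq> 0" "G2 \<noteq> 0" and le: "\<And>v. G \<bullet> v < 0 \<Longrightarrow> G2 \<bullet> v \<le> 0"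
  shows "\<exists>k>0. G2 = k *\<^sub>R G"
proof -
  define k where "k = (G2 \<bullet> G) / (G \<bullet> G)"
  define w where "w = G2 - k *\<^sub>R G"
  have GG: "G \<bullet> G > 0" using assms(1) by simp
  have Gw: "G \<bullet> w = 0" using GG by (simp add: w_def k_def inner_diff_right inner_commute)
  have G2w: "G2 \<bullet> w = w \<bullet> w"
  proof -
    have "(w + k *\<^sub>R G) \<bullet> w = w \<bullet> w" by (simp only: inner_add_left inner_scaleR_left Gw mult_zero_right add_0_right)
    then show ?thesis by (simp add: w_def)
  qed
  have *: "w \<bullet> w \<le> e * (G2 \<bullet> G)" if "e > 0" for e
    using le[of "w - e *\<^sub>R G"] that GG by (simp only: inner_diff_right inner_scaleR_right Gw G2w) simp
  have "w = 0"
  proof (rule ccontr)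
    assume "w \<noteq> 0"
    then have ww: "w \<bullet> w > 0" by simp
    then have pos: "G2 \<bullet> G > 0" using *[of 1] by linarith
    have "w \<bullet> w \<le> (w \<bullet> w) / (2 * (G2 \<bullet> G)) * (G2 \<bullet> G)"
      using pos ww by (intro *) auto
    then show False using pos ww by simp
  qed
  then have G2: "G2 = k *\<^sub>R G" by (simp add: w_def)
  have "G2 \<bullet> (- G) \<le> 0" using GG by (intro le) simp
  then have "k * (G \<bullet> G) \<ge> 0" by (simp add: G2)
  then have "k \<ge> 0" using GG by (simp add: zero_le_mult_iff)
  then show ?thesis using G2 assms(2) by (intro exI[of _ k]) (auto simp: less_le)
qed

text \<open>A direction in which \<open>f\<close> decreases enters \<open>\<Omega>\<close>, so
  \<open>f2\<close>, which describes the same set, cannot increase in it to first order. This is the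
  half-space condition.\<close>

lemma defining_functions_grad_parallel:
  assumes "defining_function \<Omega> U f" "x \<in> U" "defining_function \<Omega> U2 f2" "x \<in> U2" "x \<in> frontier \<Omega>"
  shows "\<exists>k>0. grad f2 x = k *\<^sub>R grad f x"
proof (rule positive_multiple_if_halfspace_subset)
  have f0: "f x = 0" "f2 x = 0" using assms frontier_defining_function by blast+
  show "grad f x \<noteq> 0" "grad f2 x \<noteq> 0" using defining_function_grad assms by blast+
  fix v assume v: "grad f x \<bullet> v < 0"
  show "grad f2 x \<bullet> v \<le> 0"
  proof (rule ccontr)
    assume "\<not> grad f2 x \<bullet> v \<le> 0"
    then have "\<forall>\<^sub>F t in at_right 0. f2 (x + t *\<^sub>R v) > 0"
      using eventually_sign_ray(1)[OF assms(3,4) f0(2)] by simp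
    moreover have "\<forall>\<^sub>F t in at_right 0. f (x + t *\<^sub>R v) < 0"
      using eventually_sign_ray(2)[OF assms(1,2) f0(1) v] .
    moreover have "\<forall>\<^sub>F t in at_right 0. x + t *\<^sub>R v \<in> U \<inter> U2"
      using assms by (intro eventually_in_open_ray) (auto simp: defining_function_def)
    ultimately have "\<forall>\<^sub>F t::real in at_right 0. False"
    proof eventually_elim
      case (elim t)
      then show False
        using defining_function_mem[OF assms(1)] defining_function_mem[OF assms(3)] by force
    qed
    then show False by simp
  qed
qed

text \<open>On the frontier the description has a unique solution, because gradients of different
  defining functions at a point are positive multiples of each other.\<close>

definition eucl_normal :: "'a::euclidean_space set \<Rightarrow> 'a \<Rightarrow> 'a" where
  "eucl_normal \<Omega> x = (THE N. \<exists>U f. x \<in> U \<and> defining_function \<Omega> U f \<and> N = grad f x /\<^sub>R norm (grad f x))"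

lemma eucl_normal_eq:
  assumes "defining_function \<Omega> U f" "x \<in> U" "x \<in> frontier \<Omega>"
  shows "eucl_normal \<Omega> x = grad f x /\<^sub>R norm (grad f x)"
  unfolding eucl_normal_def
proof (rule the_equality)
  show "\<exists>U g. x \<in> U \<and> defining_function \<Omega> U g \<and> grad f x /\<^sub>R norm (grad f x) = grad g x /\<^sub>R norm (grad g x)"
    using assms by blast
  fix N assume "\<exists>U g. x \<in> U \<and> defining_function \<Omega> U g \<and> N = grad g x /\<^sub>R norm (grad g x)"
  then obtain V g where g: "x \<in> V" "defining_function \<Omega> V g" "N = grad g x /\<^sub>R norm (grad g x)" by blast
  then obtain k where "k > 0" "grad g x = k *\<^sub>R grad f x"
    using defining_functions_grad_parallel assms by blast
  then show "N = grad f x /\<^sub>R norm (grad f x)" using g(3) by simp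
qed

lemma eucl_normal_unit:
  assumes "smooth_bounded_domain \<Omega>" "x \<in> frontier \<Omega>"
  shows "norm (eucl_normal \<Omega> x) = 1"
proof -
  obtain U f where "x \<in> U" "defining_function \<Omega> U f"
    using assms by (rule smooth_bounded_domain_frontierE)
  then show ?thesis
    using eucl_normal_eq[of \<Omega> U f x] defining_function_grad(2)[of \<Omega> U f x] assms(2) by simp
qed

lemma grad_continuous_on:
  assumes "defining_function \<Omega> U f"
  shows "continuous_on U (grad f)"
proof -
  have "Ck_on 0 (\<lambda>x. \<Sum>b\<in>Basis. frechet_derivative f (at x) b *\<^sub>R b) U"
    using assms by (intro Ck_on_grad) (auto simp: defining_function_def smooth_on_def simp del: Ck_on.simps)
  then show ?thesis by (simp add: grad_def[abs_def])
qed

lemma eucl_normal_continuous_on: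
  assumes "smooth_bounded_domain \<Omega>"
  shows "continuous_on (frontier \<Omega>) (eucl_normal \<Omega>)"
  unfolding continuous_on_eq_continuous_within
proof
  fix x assume x: "x \<in> frontier \<Omega>"
  obtain U f where U: "x \<in> U" and df: "defining_function \<Omega> U f"
    using assms x by (rule smooth_bounded_domain_frontierE)
  have "open U" using df by (simp add: defining_function_def)
  have "continuous_on (frontier \<Omega> \<inter> U) (eucl_normal \<Omega>) \<longleftrightarrow>
        continuous_on (frontier \<Omega> \<inter> U) (\<lambda>x. grad f x /\<^sub>R norm (grad f x))"
    using eucl_normal_eq[OF df] by (intro continuous_on_cong) auto
  moreover have "continuous_on (frontier \<Omega> \<inter> U) (\<lambda>x. grad f x /\<^sub>R norm (grad f x))"
    using continuous_on_subset[OF grad_continuous_on[OF df]] defining_function_grad(2)[OF df]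
    by (intro continuous_intros) auto
  moreover have "at x within frontier \<Omega> = at x within frontier \<Omega> \<inter> U"
    using U \<open>open U\<close> by (intro at_within_nhd[of x U]) auto
  ultimately show "continuous (at x within frontier \<Omega>) (eucl_normal \<Omega>)"
    using x U by (simp add: continuous_on_eq_continuous_within)
qed

subsection \<open>Implicit functions\<close>

text \<open>On a thin enough box \<open>F\<close> is negative at the bottom, positive at the top and
  strictly increasing in \<open>t\<close>, so each vertical segment carries exactly one zero.
  Differentiability of \<open>g\<close> comes from inverting the map
  \<open>H (z, t) = (z, F (z, t))\<close>. The sign of \<open>F\<close> on either side of the graph
  is recorded as well, since it decides which side belongs to the domain.\<close>

lemma implicit_function:
  fixes F :: "'a::euclidean_space \<times> real \<Rightarrow> real"
  assumes "open V" and der: "\<And>p. p \<in> V \<Longrightarrow> (F has_derivative F' p) (at p)"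
    and pos: "\<And>p. p \<in> V \<Longrightarrow> F' p (0, 1) > 0"
    and p0: "(z0, t0) \<in> V" "F (z0, t0) = 0"
  obtains r a b g where "r > 0" "a < t0" "t0 < b" "ball z0 r \<times> {a<..<b} \<subseteq> V"
    "\<And>z. z \<in> ball z0 r \<Longrightarrow> a < g z \<and> g z < b"
    "\<And>z t. z \<in> ball z0 r \<Longrightarrow> a < t \<Longrightarrow> t < b \<Longrightarrow> (F (z, t) \<le> 0 \<longleftrightarrow> t \<le> g z) \<and> (F (z, t) = 0 \<longleftrightarrow> t = g z)"
    "\<And>z. z \<in> ball z0 r \<Longrightarrow> (g has_derivative (\<lambda>v. - F' (z, g z) (v, 0) / F' (z, g z) (0, 1))) (at z)"
proof -
  obtain A B where AB: "open A" "open B" "z0 \<in> A" "t0 \<in> B" "A \<times> B \<subseteq> V"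
    using open_prod_elim[OF \<open>open V\<close> p0(1)] by (metis mem_Sigma_iff)
  obtain e where e: "e > 0" "cball t0 e \<subseteq> B" using AB open_contains_cball by blast
  define a where "a = t0 - e"
  define b where "b = t0 + e"
  have ab: "a < t0" "t0 < b" "a < b" using e by (auto simp: a_def b_def)
  have "{a..b} = cball t0 e" by (auto simp: a_def b_def cball_eq_atLeastAtMost)
  then have inV: "(z, t) \<in> V" if "z \<in> A" "a \<le> t" "t \<le> b" for z t
    using that AB e by force
  have contF: "continuous_on V F"
    using der by (auto intro!: continuous_at_imp_continuous_on has_derivative_continuous)
  have dt: "((\<lambda>t. F (z, t)) has_real_derivative F' (z, t) (0, 1)) (at t)" if "(z, t) \<in> V" for z t
  proof -
    have "((\<lambda>t. (z, t)) has_derivative (\<lambda>s. (0, s))) (at t)"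
      by (auto intro!: derivative_eq_intros)
    then have "((\<lambda>t. F (z, t)) has_derivative (\<lambda>s. F' (z, t) (0, s))) (at t)"
      using has_derivative_compose der[OF that] by blast
    moreover have "(\<lambda>s. F' (z, t) (0, s)) = (*) (F' (z, t) (0, 1))"
    proof
      show "F' (z, t) (0, s) = F' (z, t) (0, 1) * s" for s
        using linear_cmul[OF has_derivative_linear[OF der[OF that]], of s "(0, 1)"] by simp
    qed
    ultimately show ?thesis by (simp only: has_field_derivative_def)
  qed
  have mono: "F (z, s) < F (z, t)" if "z \<in> A" "a \<le> s" "s < t" "t \<le> b" for z s t
  proof (rule DERIV_pos_imp_increasing[OF \<open>s < t\<close>])
    fix x assume "s \<le> x" "x \<le> t"
    then have "(z, x) \<in> V" using that by (intro inV) auto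
    then show "\<exists>y. ((\<lambda>t. F (z, t)) has_real_derivative y) (at x) \<and> y > 0"
      using dt pos by blast
  qed
  let ?O = "{z \<in> A. F (z, a) < 0} \<inter> {z \<in> A. F (z, b) > 0}"
  have "continuous_on A (\<lambda>z. F (z, a))" "continuous_on A (\<lambda>z. F (z, b))"
    using inV ab by (auto intro!: continuous_on_compose2[OF contF] continuous_intros)
  then have "open (A \<inter> (\<lambda>z. F (z, a)) -` {..<0})" "open (A \<inter> (\<lambda>z. F (z, b)) -` {0<..})"
    using AB by (auto intro: continuous_open_preimage)
  then have "open ((A \<inter> (\<lambda>z. F (z, a)) -` {..<0}) \<inter> (A \<inter> (\<lambda>z. F (z, b)) -` {0<..}))" by blast
  moreover have "z0 \<in> (A \<inter> (\<lambda>z. F (z, a)) -` {..<0}) \<inter> (A \<inter> (\<lambda>z. F (z, b)) -` {0<..})"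
    using mono[of z0 a t0] mono[of z0 t0 b] ab AB p0 by auto
  ultimately obtain r where r: "r > 0"
    and rsub: "ball z0 r \<subseteq> (A \<inter> (\<lambda>z. F (z, a)) -` {..<0}) \<inter> (A \<inter> (\<lambda>z. F (z, b)) -` {0<..})"
    by (metis open_contains_ball)
  have rA: "z \<in> A" "F (z, a) < 0" "F (z, b) > 0" if "z \<in> ball z0 r" for z
    using rsub that by auto
  have "\<exists>t. a < t \<and> t < b \<and> F (z, t) = 0" if z: "z \<in> ball z0 r" for z
  proof -
    have "continuous_on {a..b} (\<lambda>t. F (z, t))"
      using inV rA[OF z] by (auto intro!: continuous_on_compose2[OF contF] continuous_intros)
    then obtain t where "a \<le> t" "t \<le> b" "F (z, t) = 0"
      using IVT'[of "\<lambda>t. F (z, t)" a 0 b] rA[OF z] ab by auto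
    moreover from this have "t \<noteq> a" "t \<noteq> b" using rA(2,3)[OF z] by auto
    ultimately show ?thesis by (intro exI[of _ t]) simp
  qed
  then obtain g where g: "\<And>z. z \<in> ball z0 r \<Longrightarrow> a < g z \<and> g z < b \<and> F (z, g z) = 0"
    by metis
  have sign: "(F (z, t) \<le> 0 \<longleftrightarrow> t \<le> g z) \<and> (F (z, t) = 0 \<longleftrightarrow> t = g z)"
    if "z \<in> ball z0 r" "a < t" "t < b" for z t
  proof -
    have "F (z, t) < F (z, g z)" if "t < g z"
      using that \<open>a < t\<close> g[OF \<open>z \<in> ball z0 r\<close>] rA(1)[OF \<open>z \<in> ball z0 r\<close>] by (intro mono) linarith+
    moreover have "F (z, g z) < F (z, t)" if "g z < t"
      using that \<open>t < b\<close> g[OF \<open>z \<in> ball z0 r\<close>] rA(1)[OF \<open>z \<in> ball z0 r\<close>] by (intro mono) linarith+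
    ultimately show ?thesis
      using g[OF \<open>z \<in> ball z0 r\<close>] by (cases t "g z" rule: linorder_cases) simp_all
  qed
  define S where "S = ball z0 r \<times> {a<..<b}"
  define H where "H p = (fst p, F p)" for p
  have SV: "S \<subseteq> V" using inV rA by (force simp: S_def)
  have openS: "open S" by (auto simp: S_def intro: open_Times)
  have injH: "inj_on H S"
  proof (rule inj_onI)
    fix p q assume pq: "p \<in> S" "q \<in> S" "H p = H q"
    obtain z s t where st: "p = (z, s)" "q = (z, t)" "F (z, s) = F (z, t)"
      using pq(3) by (cases p; cases q) (simp add: H_def)
    then have "z \<in> A" "a < s" "s < b" "a < t" "t < b" using pq rA by (auto simp: S_def)
    then show "p = q"
      using st mono[of z s t] mono[of z t s] by (cases s t rule: linorder_cases) simp_all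
  qed
  have contH: "continuous_on S H"
    unfolding H_def using continuous_on_subset[OF contF SV] by (intro continuous_intros) auto
  have derg: "(g has_derivative (\<lambda>v. - F' (z, g z) (v, 0) / F' (z, g z) (0, 1))) (at z)"
    if z: "z \<in> ball z0 r" for z
  proof -
    let ?p = "(z, g z)"
    have pS: "?p \<in> S" using g z by (simp add: S_def)
    let ?K = "inv_into S H"
    let ?L = "F' ?p"
    have lin: "linear ?L" using der pS SV by (auto intro: has_derivative_linear)
    have Lpos: "?L (0, 1) > 0" using pos pS SV by auto
    have L: "?L (v, s) = ?L (v, 0) + s * ?L (0, 1)" for v s
      using linear_add[OF lin, of "(v, 0)" "(0, s)"] linear_cmul[OF lin, of s "(0, 1)"] by simp
    \<comment> \<open>The inverse of the derivative of \<open>H\<close>: the second component of the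
      preimage is solved for, with \<open>?L (0, 1)\<close> as the nonzero coefficient.\<close>
    define G where "G q = (fst q, (snd q - ?L (fst q, 0)) / ?L (0, 1))" for q
    have "(?K has_derivative G) (at (H ?p))"
    proof (rule has_derivative_inverse_strong[OF openS pS contH])
      show "?K (H x) = x" if "x \<in> S" for x using that injH by simp
      show "(H has_derivative (\<lambda>q. (fst q, ?L q))) (at ?p)"
        unfolding H_def using der pS SV
        by (intro has_derivative_Pair has_derivative_fst has_derivative_ident) auto
      show "(\<lambda>q. (fst q, ?L q)) \<circ> G = id"
      proof
        fix q
        have "?L (G q) = ?L (fst q, 0) + (snd q - ?L (fst q, 0)) / ?L (0, 1) * ?L (0, 1)"
          unfolding G_def by (rule L)
        then have "?L (G q) = snd q" using Lpos by simp
        then show "((\<lambda>q. (fst q, ?L q)) \<circ> G) q = id q" by (simp add: G_def prod_eq_iff)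
      qed
    qed
    moreover have "H ?p = (z, 0)" using g z by (simp add: H_def)
    moreover have "((\<lambda>w. (w, 0)) has_derivative (\<lambda>v. (v, 0))) (at z)"
      by (auto intro!: derivative_eq_intros)
    ultimately have "((\<lambda>w. ?K (w, 0)) has_derivative (\<lambda>v. G (v, 0))) (at z)"
      using has_derivative_compose[of "\<lambda>w. (w, 0)" "\<lambda>v. (v, 0)" z UNIV ?K G] by simp
    then have "((\<lambda>w. snd (?K (w, 0))) has_derivative (\<lambda>v. snd (G (v, 0)))) (at z)"
      by (rule has_derivative_snd)
    then have "((\<lambda>w. snd (?K (w, 0))) has_derivative (\<lambda>v. - ?L (v, 0) / ?L (0, 1))) (at z)"
      by (simp add: G_def)
    then show ?thesis
    proof (rule has_derivative_transform_within_open[OF _ open_ball z])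
      fix w assume w: "w \<in> ball z0 r"
      then have "(w, g w) \<in> S" "H (w, g w) = (w, 0)" using g by (auto simp: S_def H_def)
      then have "?K (w, 0) = (w, g w)" using injH by (metis inv_into_f_f)
      then show "snd (?K (w, 0)) = g w" by simp
    qed
  qed
  show ?thesis
    by (rule that[of r a b g]) (use r ab SV g sign derg in \<open>auto simp: S_def\<close>)
qed

text \<open>A bootstrap: the derivative of \<open>g\<close> is a quotient of derivatives of
  \<open>F\<close> evaluated along the graph of \<open>g\<close>, so order \<open>k\<close> for
  \<open>g\<close> yields order \<open>k\<close> for its derivative.\<close>

lemma implicit_function_smooth:
  fixes F :: "'a::euclidean_space \<times> real \<Rightarrow> real"
  assumes "open V" "smooth_on F V" "open W"
    and nz: "\<And>z. z \<in> W \<Longrightarrow> (z, g z) \<in> V \<and> frechet_derivative F (at (z, g z)) (0, 1) \<noteq> 0"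
    and der: "\<And>z. z \<in> W \<Longrightarrow> (g has_derivative
       (\<lambda>v. - frechet_derivative F (at (z, g z)) (v, 0) / frechet_derivative F (at (z, g z)) (0, 1))) (at z)"
  shows "smooth_on g W"
  unfolding smooth_on_def
proof
  fix k show "Ck_on k g W"
  proof (induction k)
    case 0
    have "continuous_on W g"
      by (intro continuous_at_imp_continuous_on ballI has_derivative_continuous[OF der])
    then show ?case by simp
  next
    case (Suc k)
    have comp: "Ck_on k (\<lambda>z. frechet_derivative F (at (z, g z)) w) W" for w
    proof (rule Ck_on_compose[OF assms(3,1)])
      show "Ck_on k (\<lambda>p. frechet_derivative F (at p) w) V"
        using assms(2)[unfolded smooth_on_def, rule_format, of "Suc k"]
        unfolding Ck_on.simps by blast
      show "Ck_on k (\<lambda>z. (z, g z)) W" by (intro Ck_on_Pair Ck_on_id Suc assms(3))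
      show "(\<lambda>z. (z, g z)) ` W \<subseteq> V" using nz by blast
    qed
    show ?case
    proof (rule Ck_on_SucI'[OF assms(3) der _ assms(3)])
      fix v
      have "Ck_on k (\<lambda>z. - 1 * (frechet_derivative F (at (z, g z)) (v, 0) * inverse (frechet_derivative F (at (z, g z)) (0, 1)))) W"
        by (intro Ck_on_mult Ck_on_const Ck_on_inverse comp assms(3)) (use nz in blast)
      then show "Ck_on k (\<lambda>z. - frechet_derivative F (at (z, g z)) (v, 0) / frechet_derivative F (at (z, g z)) (0, 1)) W"
        by (simp add: divide_inverse)
    qed
  qed
qed

subsection \<open>Orthonormal frames\<close>

text \<open>Cartesian coordinates of the ambient space with \<open>T (0, 1)\<close> as the vertical
  direction. Keeping the source a product lets graphs over a hyperplane and iterated integrals be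
  written directly.\<close>

definition frame :: "((real^('n::finite)) \<times> real \<Rightarrow> real^('n option)) \<Rightarrow> bool" where
  "frame T \<longleftrightarrow> linear T \<and> (\<forall>p q. T p \<bullet> T q = p \<bullet> q) \<and> surj T"

lemma frame_inner: "frame T \<Longrightarrow> T p \<bullet> T q = p \<bullet> q"
  unfolding frame_def by blast

lemma frame_linear: "frame T \<Longrightarrow> linear T"
  and frame_surj: "frame T \<Longrightarrow> surj T"
  unfolding frame_def by blast+

lemma frame_norm: "frame T \<Longrightarrow> norm (T p) = norm p"
  by (simp only: norm_eq_sqrt_inner frame_inner)

lemma frame_inj: "frame T \<Longrightarrow> inj T"
  by (simp add: linear_injective_0[OF frame_linear]) (metis frame_norm norm_eq_zero)

lemma frame_inv [simp]: "frame T \<Longrightarrow> T (inv T x) = x" "frame T \<Longrightarrow> inv T (T p) = p"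
  by (simp_all add: frame_surj surj_f_inv_f frame_inj)

lemma frame_bounded_linear: "frame T \<Longrightarrow> bounded_linear T"
  using frame_linear linear_conv_bounded_linear by blast

lemma frame_add: "frame T \<Longrightarrow> T (p + q) = T p + T q"
  by (rule linear_add[OF frame_linear])

lemma frame_scaleR: "frame T \<Longrightarrow> T (c *\<^sub>R p) = c *\<^sub>R T p"
  by (rule linear_cmul[OF frame_linear])

lemma frame_inv_bounded_linear:
  assumes "frame T"
  shows "bounded_linear (inv T)"
proof -
  have "linear (inv T)"
  proof
    show "inv T (x + y) = inv T x + inv T y" for x y
      using assms by (intro injD[OF frame_inj[OF assms]]) (simp add: frame_add)
    show "inv T (c *\<^sub>R x) = c *\<^sub>R inv T x" for c x
      using assms by (intro injD[OF frame_inj[OF assms]]) (simp add: frame_scaleR)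
  qed
  then show ?thesis by (simp add: linear_conv_bounded_linear)
qed

lemma frame_image_eq: "frame T \<Longrightarrow> T ` A = inv T -` A"
  by (metis bij_betw_def bij_vimage_eq_inv_image bij_imp_bij_inv frame_inj frame_surj inv_inv_eq)

lemma frame_open_image: "frame T \<Longrightarrow> open A \<Longrightarrow> open (T ` A)"
  unfolding frame_image_eq
  by (intro open_vimage linear_continuous_on frame_inv_bounded_linear)

lemma sum_option: "(\<Sum>i\<in>(UNIV :: 'n::finite option set). f i) = f None + (\<Sum>j\<in>UNIV. f (Some j))"
  by (simp add: UNIV_option_conv sum.reindex)

definition std_frame :: "(real^('n::finite)) \<times> real \<Rightarrow> real^('n option)" where
  "std_frame p = (\<chi> i. case i of None \<Rightarrow> snd p | Some j \<Rightarrow> fst p $ j)"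

lemma std_frame: "frame std_frame"
  unfolding frame_def
proof (intro conjI allI)
  show "linear std_frame"
    by (rule linearI) (auto simp: std_frame_def vec_eq_iff split: option.split)
  show "std_frame p \<bullet> std_frame q = p \<bullet> q" for p q :: "(real^'n) \<times> real"
    by (simp add: inner_vec_def sum_option std_frame_def inner_prod_def)
  have "x = std_frame (\<chi> j. x $ Some j, x $ None)" for x :: "real^('n::finite option)"
    by (auto simp: std_frame_def vec_eq_iff split: option.split)
  then show "surj (std_frame :: (real^'n) \<times> real \<Rightarrow> _)" by (rule surjI[OF sym])
qed

lemma frame_compose_orthogonal:
  assumes "frame T" "orthogonal_transformation Q"
  shows "frame (Q \<circ> T)"
  unfolding frame_def
proof (intro conjI allI)
  show "linear (Q \<circ> T)"
    using frame_linear[OF assms(1)] orthogonal_transformation_linear[OF assms(2)] by (rule linear_compose)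
  show "(Q \<circ> T) p \<bullet> (Q \<circ> T) q = p \<bullet> q" for p q
    using frame_inner[OF assms(1), of p q] assms(2) by (simp add: orthogonal_transformation_def)
  show "surj (Q \<circ> T)"
    using frame_surj[OF assms(1)] orthogonal_transformation_surj[OF assms(2)] by (rule comp_surj)
qed

lemma frame_exists:
  fixes e :: "real^('n::finite option)"
  assumes "norm e = 1"
  obtains T :: "(real^'n) \<times> real \<Rightarrow> real^('n option)" where "frame T" "T (0, 1) = e"
proof -
  have "norm (std_frame (0, 1) :: real^('n option)) = 1"
    by (simp add: frame_norm[OF std_frame] norm_Pair)
  then show thesis
  proof (rule orthogonal_transformation_exists_1[OF _ assms])
    fix Q :: "real^('n option) \<Rightarrow> real^('n option)"
    assume Q: "orthogonal_transformation Q" "Q (std_frame (0, 1)) = e"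
    show thesis
      by (rule that[OF frame_compose_orthogonal[OF std_frame Q(1)]]) (simp add: Q(2))
  qed
qed

lemma orthogonal_transformation_distr_lborel:
  fixes Q :: "real^'m::{finite,wellorder} \<Rightarrow> real^'m::_"
  assumes "orthogonal_transformation Q"
  shows "distr lborel borel Q = lborel"
proof (rule lborel_eqI[symmetric])
  have "linear Q" using assms by (rule orthogonal_transformation_linear)
  then have [measurable]: "Q \<in> borel_measurable borel"
    by (intro borel_measurable_continuous_onI linear_continuous_on) (simp add: linear_conv_bounded_linear)
  show "sets (distr lborel borel Q) = sets borel" by simp
  fix l u :: "real^'m::_"
  assume le: "\<And>b. b \<in> Basis \<Longrightarrow> l \<bullet> b \<le> u \<bullet> b"
  have inv: "orthogonal_transformation (inv Q)"
    using assms by (rule orthogonal_transformation_inv)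
  have bij: "bij Q" using assms by (rule orthogonal_transformation_bij)
  have "emeasure (distr lborel borel Q) (box l u) = emeasure lborel (Q -` box l u)"
    by (simp add: emeasure_distr)
  also have "Q -` box l u = inv Q ` box l u"
    using bij by (simp add: bij_vimage_eq_inv_image)
  also have "emeasure lborel (inv Q ` box l u) = emeasure lebesgue (inv Q ` box l u)"
  proof -
    have "Q -` box l u \<in> sets lborel"
      using measurable_sets[OF \<open>Q \<in> borel_measurable borel\<close>, of "box l u"] by simp
    then have "inv Q ` box l u \<in> sets lborel"
      using bij by (simp add: bij_vimage_eq_inv_image)
    then show ?thesis by simp
  qed
  also have "\<dots> = ennreal (measure lebesgue (inv Q ` box l u))"
  proof -
    have "inv Q ` box l u \<in> lmeasurable"
      by (intro measurable_linear_image orthogonal_transformation_linear inv) auto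
    then show ?thesis by (simp add: emeasure_eq_measure2)
  qed
  also have "measure lebesgue (inv Q ` box l u) = measure lebesgue (box l u)"
    using orthogonal_transformation_det[OF inv]
    by (subst measure_linear_image[OF orthogonal_transformation_linear[OF inv]]) auto
  also have "ennreal (measure lebesgue (box l u)) = (\<Prod>b\<in>Basis. (u - l) \<bullet> b)"
    using measure_lborel_box[OF le] by simp
  finally show "emeasure (distr lborel borel Q) (box l u) = (\<Prod>b\<in>Basis. (u - l) \<bullet> b)" .
qed

subsection \<open>Change of variables for nonnegative functions\<close>

lemma nn_integral_set_lborel:
  fixes F :: "'a::euclidean_space \<Rightarrow> real"
  assumes nn: "\<And>x. x \<in> A \<Longrightarrow> 0 \<le> F x" and m: "(\<lambda>x. indicator A x * F x) \<in> borel_measurable borel"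
  shows "F absolutely_integrable_on A \<longleftrightarrow> (\<integral>\<^sup>+x. ennreal (F x) * indicator A x \<partial>lborel) < \<infinity>"
    and "F absolutely_integrable_on A \<Longrightarrow> (\<integral>\<^sup>+x. ennreal (F x) * indicator A x \<partial>lborel) = ennreal (integral A F)"
proof -
  let ?F = "\<lambda>x. indicator A x * F x"
  have eq: "ennreal (F x) * indicator A x = ennreal (?F x)" for x
    by (simp add: indicator_def)
  have nn': "0 \<le> ?F x" for x using nn by (simp add: indicator_def)
  have ai: "F absolutely_integrable_on A \<longleftrightarrow> integrable lborel ?F"
    using m by (simp add: set_integrable_def integrable_completion)
  have "integrable lborel ?F \<longleftrightarrow> (\<integral>\<^sup>+x. ennreal (?F x) \<partial>lborel) < \<infinity>"
    using m nn' by (subst integrable_iff_bounded) simp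
  then show "F absolutely_integrable_on A \<longleftrightarrow> (\<integral>\<^sup>+x. ennreal (F x) * indicator A x \<partial>lborel) < \<infinity>"
    unfolding eq ai .
  assume a: "F absolutely_integrable_on A"
  have "(\<integral>\<^sup>+x. ennreal (?F x) \<partial>lborel) = ennreal (integral\<^sup>L lborel ?F)"
    using a nn' unfolding ai by (intro nn_integral_eq_integral) auto
  also have "integral\<^sup>L lborel ?F = integral\<^sup>L lebesgue ?F"
    using m by (simp add: integral_completion)
  also have "\<dots> = integral A F"
    using set_lebesgue_integral_eq_integral(2)[OF a] by (simp add: set_lebesgue_integral_def)
  finally show "(\<integral>\<^sup>+x. ennreal (F x) * indicator A x \<partial>lborel) = ennreal (integral A F)"
    unfolding eq .
qed

text \<open>The change of variables for absolutely integrable maps, used with values in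
  \<open>real^1\<close>, gives equivalence of integrability and equality of the finite integrals. If
  integrability fails, both integrals are infinite because the functions are nonnegative.\<close>

lemma nn_integral_change_of_variables:
  fixes f :: "real^'m::{finite,wellorder} \<Rightarrow> real" and \<tau> :: "real^'m::_ \<Rightarrow> real^'m::_"
  assumes E: "E \<in> sets borel"
    and der: "\<And>x. x \<in> E \<Longrightarrow> (\<tau> has_derivative \<tau>' x) (at x within E)" and inj: "inj_on \<tau> E"
    and nn: "\<And>z. z \<in> \<tau> ` E \<Longrightarrow> 0 \<le> f z"
    and m1: "(\<lambda>z. indicator (\<tau> ` E) z * f z) \<in> borel_measurable borel"
    and m2: "(\<lambda>x. indicator E x * (\<bar>det (matrix (\<tau>' x))\<bar> * f (\<tau> x))) \<in> borel_measurable borel"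
  shows "(\<integral>\<^sup>+z. ennreal (f z) * indicator (\<tau> ` E) z \<partial>lborel) =
         (\<integral>\<^sup>+x. ennreal (\<bar>det (matrix (\<tau>' x))\<bar> * f (\<tau> x)) * indicator E x \<partial>lborel)"
proof -
  let ?f = "\<lambda>z. (vec (f z) :: real^1)"
  let ?h = "\<lambda>x. \<bar>det (matrix (\<tau>' x))\<bar> * f (\<tau> x)"
  have cov: "(\<lambda>x. \<bar>det (matrix (\<tau>' x))\<bar> *\<^sub>R ?f (\<tau> x)) absolutely_integrable_on E \<and>
           integral E (\<lambda>x. \<bar>det (matrix (\<tau>' x))\<bar> *\<^sub>R ?f (\<tau> x)) = b
     \<longleftrightarrow> ?f absolutely_integrable_on (\<tau> ` E) \<and> integral (\<tau> ` E) ?f = b" for b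
    using E by (intro has_absolute_integral_change_of_variables der inj) auto
  have h: "(\<lambda>x. \<bar>det (matrix (\<tau>' x))\<bar> *\<^sub>R ?f (\<tau> x)) = (\<lambda>x. vec (?h x))"
    by (auto simp: fun_eq_iff vec_eq_iff)
  have ai: "?h absolutely_integrable_on E \<longleftrightarrow> f absolutely_integrable_on (\<tau> ` E)"
    using cov unfolding h by (auto simp: absolutely_integrable_on_1_iff)
  have int: "integral E ?h = integral (\<tau> ` E) f" if "f absolutely_integrable_on (\<tau> ` E)"
  proof -
    have "?f absolutely_integrable_on (\<tau> ` E)" using that by (simp add: absolutely_integrable_on_1_iff)
    then have "integral E (\<lambda>x. vec (?h x) :: real^1) = integral (\<tau> ` E) ?f"
      using cov unfolding h by blast
    then show ?thesis by (simp add: integral_on_1_eq vec_eq_iff)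
  qed
  have nn2: "0 \<le> ?h x" if "x \<in> E" for x using nn that by simp
  note L = nn_integral_set_lborel[of "\<tau> ` E" f, OF nn m1]
  note R = nn_integral_set_lborel[of E ?h, OF nn2 m2]
  show ?thesis
  proof (cases "f absolutely_integrable_on (\<tau> ` E)")
    case True
    then show ?thesis using L(2) R(2) ai int by simp
  next
    case False
    then have "\<not> (\<integral>\<^sup>+z. ennreal (f z) * indicator (\<tau> ` E) z \<partial>lborel) < \<infinity>"
      "\<not> (\<integral>\<^sup>+x. ennreal (?h x) * indicator E x \<partial>lborel) < \<infinity>"
      using L(1) R(1) ai by blast+
    then show ?thesis by (simp flip: less_top)
  qed
qed

subsection \<open>Existence and uniqueness of the area measure\<close>

text \<open>Covers the Euclidean inner product and \<open>hyp_metric\<close> alike, so that a single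
  construction yields both area measures. Joint continuity in the point and the vectors makes the
  densities of smooth parametrizations continuous.\<close>

definition metric_form :: "('a::real_normed_vector \<Rightarrow> 'a \<Rightarrow> 'a \<Rightarrow> real) \<Rightarrow> bool" where
  "metric_form g \<longleftrightarrow> (\<forall>x. bilinear (g x)) \<and> continuous_on UNIV (\<lambda>p. g (fst p) (fst (snd p)) (snd (snd p)))"

lemma bilinear_coordinates:
  fixes B :: "real^'n::finite \<Rightarrow> real^'n \<Rightarrow> real"
  assumes "bilinear B"
  shows "B v w = (\<Sum>k\<in>UNIV. \<Sum>l\<in>UNIV. v $ k * (w $ l * B (axis k 1) (axis l 1)))"
proof -
  have "B (\<Sum>k\<in>UNIV. v $ k *\<^sub>R axis k 1) (\<Sum>l\<in>UNIV. w $ l *\<^sub>R axis l 1) =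
        (\<Sum>k\<in>UNIV. \<Sum>l\<in>UNIV. v $ k * (w $ l * B (axis k 1) (axis l 1)))"
    unfolding bilinear_sum[OF assms] sum.cartesian_product
    by (intro sum.cong refl) (auto simp: bilinear_lmul[OF assms] bilinear_rmul[OF assms] mult.left_commute)
  then show ?thesis
    using basis_expansion[of v] basis_expansion[of w] by (simp add: scalar_mult_eq_scaleR)
qed

text \<open>The new Gram matrix is the congruence of the old one by the matrix of \<open>f\<close>,
  whose determinant therefore enters squared.\<close>

lemma det_gram_compose:
  fixes B :: "real^'n::finite \<Rightarrow> real^'n \<Rightarrow> real" and f :: "real^'n \<Rightarrow> real^'n"
  assumes "bilinear B"
  shows "det (\<chi> i j. B (f (axis i 1)) (f (axis j 1))) = (det (matrix f))\<^sup>2 * det (\<chi> i j. B (axis i 1) (axis j 1))"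
proof -
  let ?G = "\<chi> i j. B (axis i 1) (axis j 1)" and ?M = "matrix f"
  have "(\<chi> i j. B (f (axis i 1)) (f (axis j 1))) = transpose ?M ** (?G ** ?M)"
    unfolding vec_eq_iff
  proof (intro allI)
    fix i j
    have "B (f (axis i 1)) (f (axis j 1)) =
       (\<Sum>k\<in>UNIV. \<Sum>l\<in>UNIV. f (axis i 1) $ k * (f (axis j 1) $ l * B (axis k 1) (axis l 1)))"
      by (rule bilinear_coordinates[OF assms])
    also have "\<dots> = (transpose ?M ** (?G ** ?M)) $ i $ j"
      by (simp add: matrix_matrix_mult_def transpose_def matrix_def sum_distrib_left ac_simps)
    finally show "(\<chi> i j. B (f (axis i 1)) (f (axis j 1))) $ i $ j = (transpose ?M ** (?G ** ?M)) $ i $ j"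
      by simp
  qed
  then show ?thesis by (simp add: det_mul det_transpose power2_eq_square)
qed

lemma riem_density_transition:
  assumes "\<And>x. bilinear (g x)" "(\<gamma> has_derivative \<gamma>') (at (\<tau> y))" "(\<tau> has_derivative \<tau>') (at y)"
    and "open V" "y \<in> V" "\<And>x. x \<in> V \<Longrightarrow> \<phi> x = \<gamma> (\<tau> x)"
  shows "riem_density g \<phi> y = \<bar>det (matrix \<tau>')\<bar> * riem_density g \<gamma> (\<tau> y)"
proof -
  have "((\<lambda>x. \<gamma> (\<tau> x)) has_derivative (\<lambda>v. \<gamma>' (\<tau>' v))) (at y)"
    using has_derivative_compose[OF assms(3,2)] .
  then have "(\<phi> has_derivative (\<lambda>v. \<gamma>' (\<tau>' v))) (at y)"
    by (rule has_derivative_transform_within_open[OF _ assms(4,5)]) (simp add: assms(6))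
  then have phi: "frechet_derivative \<phi> (at y) = (\<lambda>v. \<gamma>' (\<tau>' v))"
    by (rule frechet_derivative_at[symmetric])
  have gam: "frechet_derivative \<gamma> (at (\<tau> y)) = \<gamma>'"
    using assms(2) by (rule frechet_derivative_at[symmetric])
  have B: "bilinear (\<lambda>v w. g (\<phi> y) (\<gamma>' v) (\<gamma>' w))"
  proof -
    have lin: "linear \<gamma>'" using assms(2) by (rule has_derivative_linear)
    have "linear (\<lambda>w. g (\<phi> y) v (\<gamma>' w))" "linear (\<lambda>v. g (\<phi> y) (\<gamma>' v) w)" for v w
      using assms(1)[of "\<phi> y"] linear_compose[OF lin] unfolding bilinear_def by (auto simp: o_def)
    then show ?thesis unfolding bilinear_def by blast
  qed
  have "\<phi> y = \<gamma> (\<tau> y)" using assms(5,6) by simp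
  then show ?thesis
    unfolding riem_density_def phi gam det_gram_compose[OF B, of \<tau>'] by (simp add: real_sqrt_mult)
qed

lemma smooth_on_has_derivative:
  assumes "smooth_on f U" "open U" "x \<in> U"
  shows "(f has_derivative frechet_derivative f (at x)) (at x)"
  using assms(1) Ck_on_has_derivative[OF _ assms(2,3), of 0] unfolding smooth_on_def by blast

lemma smooth_on_continuous_on: "smooth_on f U \<Longrightarrow> continuous_on U f"
  unfolding smooth_on_def using Ck_on_continuous by blast

lemma riem_density_continuous_on:
  assumes "metric_form g" "smooth_on \<phi> W"
  shows "continuous_on W (riem_density g \<phi>)"
proof -
  have d: "continuous_on W (\<lambda>y. frechet_derivative \<phi> (at y) v)" for v
    using assms(2)[unfolded smooth_on_def, rule_format, of "Suc 0"] unfolding Ck_on.simps by blast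
  have c: "continuous_on W \<phi>" using assms(2) by (rule smooth_on_continuous_on)
  have "continuous_on W (\<lambda>y. g (\<phi> y) (frechet_derivative \<phi> (at y) v) (frechet_derivative \<phi> (at y) w))" for v w
  proof -
    have "continuous_on W (\<lambda>y. (\<phi> y, frechet_derivative \<phi> (at y) v, frechet_derivative \<phi> (at y) w))"
      by (intro continuous_intros c d)
    moreover have "continuous_on UNIV (\<lambda>p. g (fst p) (fst (snd p)) (snd (snd p)))"
      using assms(1) unfolding metric_form_def by blast
    ultimately show ?thesis
      using continuous_on_compose2[of UNIV "\<lambda>p. g (fst p) (fst (snd p)) (snd (snd p))" W
          "\<lambda>y. (\<phi> y, frechet_derivative \<phi> (at y) v, frechet_derivative \<phi> (at y) w)"] by simp
  qed
  then show ?thesis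
    unfolding riem_density_def[abs_def] det_def
    by (intro continuous_intros) simp
qed

lemma continuous_on_preimage_borel:
  fixes \<phi> :: "'a::t2_space \<Rightarrow> 'b::t2_space"
  assumes "open W" "continuous_on W \<phi>" "A \<in> sets borel"
  shows "{y\<in>W. \<phi> y \<in> A} \<in> sets borel"
proof -
  have "\<phi> \<in> borel_measurable (restrict_space borel W)"
    using assms(2) by (rule borel_measurable_continuous_on_restrict)
  from measurable_sets[OF this assms(3)] have "\<phi> -` A \<inter> W \<in> sets (restrict_space borel W)"
    by (simp add: space_restrict_space)
  then have "\<phi> -` A \<inter> W \<in> sets borel"
    using assms(1) by (subst (asm) sets_restrict_space_iff) auto
  also have "\<phi> -` A \<inter> W = {y\<in>W. \<phi> y \<in> A}" by auto
  finally show ?thesis .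
qed

text \<open>A chart whose inverse extends to a linear map of the ambient space, such as the
  parametrisation of a graph. Transition maps into such a chart are smooth without any appeal
  to the inverse function theorem.\<close>

definition linear_chart where
  "linear_chart S W \<gamma> \<pi> \<longleftrightarrow> local_parametrization S W \<gamma> \<and> bounded_linear \<pi> \<and> (\<forall>z\<in>W. \<pi> (\<gamma> z) = z)"

text \<open>The transition map \<open>\<tau>\<close> is the linear inverse of
  \<open>\<gamma>\<close> composed with \<open>\<phi>\<close>. The two densities differ by the
  absolute value of its Jacobian determinant, which is what the change of variables absorbs.\<close>

lemma area_transition:
  fixes \<gamma> \<phi> :: "real^('n::{finite,wellorder}) \<Rightarrow> real^('n option)"
  assumes g: "metric_form g" and ch: "linear_chart S W \<gamma> \<pi>" and par: "local_parametrization S V \<phi>"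
    and A: "A \<in> sets borel" "A \<subseteq> \<gamma> ` W" "A \<subseteq> \<phi> ` V"
  shows "(\<integral>\<^sup>+z. ennreal (riem_density g \<gamma> z) * indicator {z\<in>W. \<gamma> z \<in> A} z \<partial>lborel) =
         (\<integral>\<^sup>+y. ennreal (riem_density g \<phi> y) * indicator {y\<in>V. \<phi> y \<in> A} y \<partial>lborel)"
proof -
  have ch': "local_parametrization S W \<gamma>" "bounded_linear \<pi>" "\<And>z. z \<in> W \<Longrightarrow> \<pi> (\<gamma> z) = z"
    using ch unfolding linear_chart_def by blast+
  have W: "open W" "smooth_on \<gamma> W" "openin (top_of_set S) (\<gamma> ` W)"
    using ch'(1) unfolding local_parametrization_def by blast+
  have V: "open V" "smooth_on \<phi> V" "openin (top_of_set S) (\<phi> ` V)"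
    using par unfolding local_parametrization_def by blast+
  obtain \<psi> where "homeomorphism V (\<phi> ` V) \<phi> \<psi>"
    using par unfolding local_parametrization_def by blast
  then have inj\<phi>: "inj_on \<phi> V"
    by (intro inj_on_inverseI[of V \<psi>]) (rule homeomorphism_apply1)
  have cont: "continuous_on W \<gamma>" "continuous_on V \<phi>"
    using W V smooth_on_continuous_on by blast+
  define \<tau> where "\<tau> y = \<pi> (\<phi> y)" for y
  define E where "E = {y\<in>V. \<phi> y \<in> A}"
  have E: "E \<in> sets borel" unfolding E_def by (intro continuous_on_preimage_borel V cont A)
  have retr: "\<tau> y \<in> W \<and> \<gamma> (\<tau> y) = \<phi> y" if "\<phi> y \<in> \<gamma> ` W" for y
    using that ch'(3) by (auto simp: \<tau>_def)
  have im: "\<tau> ` E = {z\<in>W. \<gamma> z \<in> A}"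
  proof (intro equalityI subsetI)
    fix z assume "z \<in> \<tau> ` E"
    then show "z \<in> {z\<in>W. \<gamma> z \<in> A}" using retr A(2) by (auto simp: E_def)
  next
    fix z assume z: "z \<in> {z\<in>W. \<gamma> z \<in> A}"
    then obtain y where y: "y \<in> V" "\<gamma> z = \<phi> y" using A(3) by blast
    then have "z = \<tau> y" using z ch'(3)[of z] by (simp add: \<tau>_def)
    then show "z \<in> \<tau> ` E" using z y by (auto simp: E_def)
  qed
  have inj: "inj_on \<tau> E"
  proof (rule inj_onI)
    fix x y assume "x \<in> E" "y \<in> E" "\<tau> x = \<tau> y"
    have "\<gamma> (\<tau> x) = \<phi> x" "\<gamma> (\<tau> y) = \<phi> y"
      using retr \<open>x \<in> E\<close> \<open>y \<in> E\<close> A(2) by (auto simp: E_def)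
    then have "\<phi> x = \<phi> y" using \<open>\<tau> x = \<tau> y\<close> by simp
    then show "x = y" using inj_onD[OF inj\<phi>] \<open>x \<in> E\<close> \<open>y \<in> E\<close> by (auto simp: E_def)
  qed
  let ?\<tau>' = "\<lambda>y v. \<pi> (frechet_derivative \<phi> (at y) v)"
  have der: "(\<tau> has_derivative ?\<tau>' y) (at y)" if "y \<in> V" for y
    unfolding \<tau>_def
    by (intro bounded_linear.has_derivative[OF ch'(2)] smooth_on_has_derivative[OF V(2,1) that])
  have dens: "riem_density g \<phi> y = \<bar>det (matrix (?\<tau>' y))\<bar> * riem_density g \<gamma> (\<tau> y)" if y: "y \<in> E" for y
  proof -
    \<comment> \<open>The chain rule needs \<open>\<phi> x = \<gamma> (\<tau> x)\<close> on a whole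
      neighbourhood of \<open>y\<close>; the relative openness of the image of
      \<open>\<gamma>\<close> in \<open>S\<close> provides one.\<close>
    obtain U where U: "open U" "\<gamma> ` W = S \<inter> U" using W(3) by (auto simp: openin_open)
    have yV: "y \<in> V" "\<phi> y \<in> \<gamma> ` W" using y A(2) by (auto simp: E_def)
    have \<tau>W: "\<tau> y \<in> W" using retr[OF yV(2)] by simp
    show ?thesis
    proof (rule riem_density_transition[OF _ smooth_on_has_derivative[OF W(2,1) \<tau>W] der[OF yV(1)]])
      show "bilinear (g x)" for x using g unfolding metric_form_def by blast
      show "open (V \<inter> \<phi> -` U)" by (intro continuous_open_preimage cont V U)
      show "y \<in> V \<inter> \<phi> -` U" using yV U by auto
      show "\<phi> x = \<gamma> (\<tau> x)" if "x \<in> V \<inter> \<phi> -` U" for x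
      proof -
        have "\<phi> x \<in> S" using that openin_imp_subset[OF V(3)] by blast
        then have "\<phi> x \<in> \<gamma> ` W" using that U by blast
        then show ?thesis using retr by simp
      qed
    qed
  qed
  have m: "(\<lambda>x. indicator B x * riem_density g \<eta> x) \<in> borel_measurable borel"
    if "B \<in> sets borel" "B \<subseteq> U" "smooth_on \<eta> U" for \<eta> B and U :: "(real^('n::{finite,wellorder})) set"
    using borel_measurable_continuous_on_indicator[OF that(1) continuous_on_subset[OF riem_density_continuous_on[OF g that(3)] that(2)]]
    by simp
  \<comment> \<open>\<open>metric_form\<close> contains no positivity, and \<open>sqrt\<close> of a
    negative determinant is negative. \<open>ennreal\<close> truncates such a density at 0, and
    truncation commutes with the nonnegative Jacobian factor, so the change of variables is applied
    to truncated densities.\<close>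
  have max0: "ennreal (max 0 x) = ennreal x" for x
    by (cases "0 \<le> x") (auto simp: max_def ennreal_neg)
  have dens_max: "\<bar>det (matrix (?\<tau>' y))\<bar> * max 0 (riem_density g \<gamma> (\<tau> y)) = max 0 (riem_density g \<phi> y)" if "y \<in> E" for y
    unfolding dens[OF that] by (simp add: max_mult_distrib_left)
  have m': "(\<lambda>x. indicator B x * max 0 (riem_density g \<eta> x)) \<in> borel_measurable borel"
    if "B \<in> sets borel" "B \<subseteq> U" "smooth_on \<eta> U" for \<eta> B and U :: "(real^('n::{finite,wellorder})) set"
  proof -
    have "(\<lambda>x. max 0 (indicator B x * riem_density g \<eta> x)) \<in> borel_measurable borel"
      using m[OF that] by measurable
    also have "(\<lambda>x. max 0 (indicator B x * riem_density g \<eta> x)) = (\<lambda>x. indicator B x * max 0 (riem_density g \<eta> x))"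
      by (auto simp: indicator_def)
    finally show ?thesis .
  qed
  have "(\<integral>\<^sup>+z. ennreal (max 0 (riem_density g \<gamma> z)) * indicator (\<tau> ` E) z \<partial>lborel) =
        (\<integral>\<^sup>+x. ennreal (\<bar>det (matrix (?\<tau>' x))\<bar> * max 0 (riem_density g \<gamma> (\<tau> x))) * indicator E x \<partial>lborel)"
  proof (rule nn_integral_change_of_variables[OF E _ inj])
    show "(\<tau> has_derivative ?\<tau>' x) (at x within E)" if "x \<in> E" for x
      using that by (intro has_derivative_at_withinI[OF der]) (simp add: E_def)
    show "(\<lambda>z. indicator (\<tau> ` E) z * max 0 (riem_density g \<gamma> z)) \<in> borel_measurable borel"
      unfolding im by (intro m'[OF _ _ W(2)] continuous_on_preimage_borel W cont A) auto
    have "(\<lambda>x. indicator E x * (\<bar>det (matrix (?\<tau>' x))\<bar> * max 0 (riem_density g \<gamma> (\<tau> x)))) =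
          (\<lambda>x. indicator E x * max 0 (riem_density g \<phi> x))"
      using dens_max by (auto simp: indicator_def fun_eq_iff)
    then show "(\<lambda>x. indicator E x * (\<bar>det (matrix (?\<tau>' x))\<bar> * max 0 (riem_density g \<gamma> (\<tau> x)))) \<in> borel_measurable borel"
      using m'[OF E _ V(2)] by (simp add: E_def)
  qed auto
  also have "\<dots> = (\<integral>\<^sup>+y. ennreal (max 0 (riem_density g \<phi> y)) * indicator E y \<partial>lborel)"
    using dens_max by (intro nn_integral_cong) (simp add: indicator_def)
  finally have "(\<integral>\<^sup>+z. ennreal (riem_density g \<gamma> z) * indicator (\<tau> ` E) z \<partial>lborel) =
      (\<integral>\<^sup>+y. ennreal (riem_density g \<phi> y) * indicator E y \<partial>lborel)"
    unfolding max0 .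
  then show ?thesis unfolding im by (simp add: E_def)
qed

lemma is_riem_areaD:
  assumes "is_riem_area g S \<mu>" "local_parametrization S W \<phi>" "A \<in> sets borel" "A \<subseteq> \<phi> ` W"
  shows "emeasure \<mu> A = (\<integral>\<^sup>+y. ennreal (riem_density g \<phi> y) * indicator {y\<in>W. \<phi> y \<in> A} y \<partial>lborel)"
  using assms unfolding is_riem_area_def by blast

section \<open>Gluing the area measure from finitely many charts\<close>

lemma measure_sum_exists:
  fixes M :: "nat \<Rightarrow> 'a measure"
  assumes "\<And>j. sets (M j) = sets N"
  obtains \<sigma> where "sets \<sigma> = sets N" "\<And>A. A \<in> sets N \<Longrightarrow> emeasure \<sigma> A = (\<Sum>j<k. emeasure (M j) A)"
proof -
  define \<sigma> where "\<sigma> = measure_of (space N) (sets N) (\<lambda>A. \<Sum>j<k. emeasure (M j) A)"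
  have s: "sets \<sigma> = sets N" by (simp add: \<sigma>_def)
  moreover have "emeasure \<sigma> A = (\<Sum>j<k. emeasure (M j) A)" if "A \<in> sets N" for A
  proof (rule emeasure_measure_of[OF \<sigma>_def])
    show "sets N \<subseteq> Pow (space N)" by (rule sets.space_closed)
    show "A \<in> sets \<sigma>" using s that by simp
    show "positive (sets \<sigma>) (\<lambda>A. \<Sum>j<k. emeasure (M j) A)" by (simp add: positive_def)
    show "countably_additive (sets \<sigma>) (\<lambda>A. \<Sum>j<k. emeasure (M j) A)"
    proof (rule countably_additiveI)
      fix B :: "nat \<Rightarrow> 'a set" assume B: "range B \<subseteq> sets \<sigma>" "disjoint_family B"
      have "(\<Sum>i. \<Sum>j<k. emeasure (M j) (B i)) = (\<Sum>j<k. \<Sum>i. emeasure (M j) (B i))"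
        by (rule suminf_sum) simp
      also have "\<dots> = (\<Sum>j<k. emeasure (M j) (\<Union>i. B i))"
        using B s assms by (intro sum.cong refl suminf_emeasure) auto
      finally show "(\<Sum>i. \<Sum>j<k. emeasure (M j) (B i)) = (\<Sum>j<k. emeasure (M j) (\<Union>i. B i))" .
    qed
  qed
  ultimately show ?thesis by (rule that)
qed

locale chart_cover =
  fixes S :: "(real^('n::{finite,wellorder} option)) set" and k :: nat
    and W :: "nat \<Rightarrow> (real^('n::{finite,wellorder})) set"
    and \<gamma> :: "nat \<Rightarrow> real^('n::{finite,wellorder}) \<Rightarrow> real^('n::{finite,wellorder} option)"
    and \<pi> :: "nat \<Rightarrow> real^('n::{finite,wellorder} option) \<Rightarrow> real^('n::{finite,wellorder})"
  assumes S_borel: "S \<in> sets borel"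
    and charts: "\<And>j. j < k \<Longrightarrow> linear_chart S (W j) (\<gamma> j) (\<pi> j)"
    and cover: "S = (\<Union>j<k. \<gamma> j ` W j)"
begin

text \<open>Every point of \<open>S\<close> is assigned to the first chart that reaches it. The
  contributions of the charts then add up without overlap.\<close>

definition piece where "piece j = \<gamma> j ` W j - (\<Union>i<j. \<gamma> i ` W i)"

lemma parametrization: "j < k \<Longrightarrow> local_parametrization S (W j) (\<gamma> j)"
  using charts by (simp add: linear_chart_def)

lemma image_borel: "j < k \<Longrightarrow> \<gamma> j ` W j \<in> sets borel"
  using parametrization[of j] S_borel unfolding local_parametrization_def openin_open by auto

lemma piece_borel: "j < k \<Longrightarrow> piece j \<in> sets borel"
  unfolding piece_def by (intro sets.Diff sets.finite_UN image_borel) auto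

lemma piece_subset: "piece j \<subseteq> \<gamma> j ` W j"
  by (auto simp: piece_def)

lemma piece_disjoint: "disjoint_family_on piece {..<k}"
  unfolding disjoint_family_on_def
proof (intro ballI impI)
  fix i j assume "i \<in> {..<k}" "j \<in> {..<k}" "i \<noteq> j"
  then show "piece i \<inter> piece j = {}"
    by (cases i j rule: linorder_cases) (auto simp: piece_def)
qed

lemma piece_Union: "(\<Union>j<k. piece j) = S"
proof (intro equalityI subsetI)
  fix x assume "x \<in> S"
  then have ex: "\<exists>j. j < k \<and> x \<in> \<gamma> j ` W j" using cover by auto
  define j where "j = (LEAST j. j < k \<and> x \<in> \<gamma> j ` W j)"
  have j: "j < k \<and> x \<in> \<gamma> j ` W j" unfolding j_def using ex by (rule LeastI_ex)
  have "x \<notin> \<gamma> i ` W i" if "i < j" for i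
    using not_less_Least[of i "\<lambda>j. j < k \<and> x \<in> \<gamma> j ` W j"] that j by (auto simp: j_def)
  then show "x \<in> (\<Union>j<k. piece j)" using j by (auto simp: piece_def)
qed (use cover in \<open>auto simp: piece_def\<close>)

lemma emeasure_pieces:
  assumes "sets \<mu> = sets borel" "emeasure \<mu> (- S) = 0" "A \<in> sets borel"
  shows "emeasure \<mu> A = (\<Sum>j<k. emeasure \<mu> (A \<inter> piece j))"
proof -
  have "emeasure \<mu> A = emeasure \<mu> ((A \<inter> S) \<union> (A \<inter> - S))"
    by (intro arg_cong[where f="emeasure \<mu>"]) auto
  also have "\<dots> = emeasure \<mu> (A \<inter> S) + emeasure \<mu> (A \<inter> - S)"
    using assms S_borel by (intro plus_emeasure[symmetric]) auto
  also have "emeasure \<mu> (A \<inter> - S) = 0"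
  proof -
    have "emeasure \<mu> (A \<inter> - S) \<le> emeasure \<mu> (- S)" using assms S_borel by (intro emeasure_mono) auto
    then show ?thesis using assms by simp
  qed
  also have "A \<inter> S = (\<Union>j<k. A \<inter> piece j)" using piece_Union by auto
  also have "emeasure \<mu> (\<Union>j<k. A \<inter> piece j) = (\<Sum>j<k. emeasure \<mu> (A \<inter> piece j))"
    using assms piece_borel piece_disjoint
    by (intro sum_emeasure[symmetric]) (auto simp: disjoint_family_on_def, blast)
  finally show ?thesis by simp
qed

text \<open>Every Borel set splits into parts lying in single charts, up to a part outside
  \<open>S\<close>. Besides uniqueness of the area, this serves to identify the hyperbolic area with
  a density against the Euclidean one.\<close>

lemma measure_eq_on_charts:
  assumes "sets \<mu> = sets borel" "emeasure \<mu> (- S) = 0" "sets \<mu>' = sets borel" "emeasure \<mu>' (- S) = 0"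
    and eq: "\<And>j A. j < k \<Longrightarrow> A \<in> sets borel \<Longrightarrow> A \<subseteq> \<gamma> j ` W j \<Longrightarrow> emeasure \<mu> A = emeasure \<mu>' A"
  shows "\<mu> = \<mu>'"
proof (rule measure_eqI)
  show "sets \<mu> = sets \<mu>'" using assms by simp
  fix A assume "A \<in> sets \<mu>"
  then have A: "A \<in> sets borel" using assms by simp
  show "emeasure \<mu> A = emeasure \<mu>' A"
    unfolding emeasure_pieces[OF assms(1,2) A] emeasure_pieces[OF assms(3,4) A]
    using A piece_borel piece_subset by (intro sum.cong refl eq) auto
qed

lemma is_riem_area_unique:
  assumes "is_riem_area g S \<mu>" "is_riem_area g S \<mu>'"
  shows "\<mu> = \<mu>'"
proof (rule measure_eq_on_charts)
  show "emeasure \<mu> A = emeasure \<mu>' A" if "j < k" "A \<in> sets borel" "A \<subseteq> \<gamma> j ` W j" for j A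
    using is_riem_areaD[OF assms(1) parametrization[OF that(1)] that(2,3)]
      is_riem_areaD[OF assms(2) parametrization[OF that(1)] that(2,3)] by simp
qed (use assms in \<open>auto simp: is_riem_area_def\<close>)

text \<open>The candidate is the sum of the densities of the pieces, pushed forward by their charts.
  Its formula in an arbitrary parametrization follows piece by piece from
  \<open>area_transition\<close>, and the indicators of the pieces sum to the indicator of the whole
  set.\<close>

lemma is_riem_area_exists:
  assumes g: "metric_form g"
  shows "\<exists>\<mu>. is_riem_area g S \<mu>"
proof -
  define D where "D j A = (\<integral>\<^sup>+z. ennreal (riem_density g (\<gamma> j) z) * indicator {z\<in>W j. \<gamma> j z \<in> A} z \<partial>lborel)" for j A
  \<comment> \<open>Totalised twice: outside \<open>W j\<close> the chart takes the value 0, where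
    the density vanishes, and from index \<open>k\<close> on the null measure continues the
    sequence.\<close>
  define M where "M j = (if j < k then distr (density lborel (\<lambda>z. ennreal (indicator {z\<in>W j. \<gamma> j z \<in> piece j} z * riem_density g (\<gamma> j) z)))
      borel (\<lambda>z. if z \<in> W j then \<gamma> j z else 0) else null_measure borel)" for j
  have M: "emeasure (M j) A = D j (A \<inter> piece j)" if j: "j < k" and A: "A \<in> sets borel" for j A
  proof -
    have W: "open (W j)" "smooth_on (\<gamma> j) (W j)"
      using parametrization[OF j] unfolding local_parametrization_def by blast+
    have c: "continuous_on (W j) (\<gamma> j)" using W(2) by (rule smooth_on_continuous_on)
    have E: "{z\<in>W j. \<gamma> j z \<in> B} \<in> sets borel" if "B \<in> sets borel" for B
      by (intro continuous_on_preimage_borel W c that)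
    have [measurable]: "(\<lambda>z. indicator {z\<in>W j. \<gamma> j z \<in> piece j} z * riem_density g (\<gamma> j) z) \<in> borel_measurable borel"
    proof -
      have "continuous_on {z\<in>W j. \<gamma> j z \<in> piece j} (riem_density g (\<gamma> j))"
        by (rule continuous_on_subset[OF riem_density_continuous_on[OF g W(2)]]) auto
      from borel_measurable_continuous_on_indicator[OF E[OF piece_borel[OF j]] this] show ?thesis by simp
    qed
    have [measurable]: "(\<lambda>z. if z \<in> W j then \<gamma> j z else 0) \<in> borel_measurable borel"
      using W c by (intro borel_measurable_continuous_on_if) auto
    let ?c = "\<lambda>z. if z \<in> W j then \<gamma> j z else 0"
    have pre: "?c -` A \<in> sets borel"
      using measurable_sets[OF \<open>?c \<in> borel_measurable borel\<close> A] by simp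
    have "emeasure (M j) A = emeasure (density lborel (\<lambda>z. ennreal (indicator {z\<in>W j. \<gamma> j z \<in> piece j} z * riem_density g (\<gamma> j) z))) (?c -` A)"
      using j A by (simp add: M_def emeasure_distr)
    also have "\<dots> = (\<integral>\<^sup>+z. ennreal (indicator {z\<in>W j. \<gamma> j z \<in> piece j} z * riem_density g (\<gamma> j) z) * indicator (?c -` A) z \<partial>lborel)"
      using pre by (subst emeasure_density) auto
    also have "\<dots> = D j (A \<inter> piece j)"
      unfolding D_def by (intro nn_integral_cong) (auto simp: indicator_def)
    finally show ?thesis .
  qed
  have Ms: "sets (M j) = sets borel" for j by (simp add: M_def)
  obtain \<sigma> where \<sigma>: "sets \<sigma> = sets borel" "\<And>A. A \<in> sets borel \<Longrightarrow> emeasure \<sigma> A = (\<Sum>j<k. emeasure (M j) A)"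
    by (rule measure_sum_exists[of M borel k, OF Ms]) (rule that)
  have "is_riem_area g S \<sigma>"
    unfolding is_riem_area_def
  proof (intro conjI allI impI ballI)
    show "sets \<sigma> = sets borel" by (rule \<sigma>(1))
    have "emeasure (M j) (- S) = 0" if "j < k" for j
    proof -
      have "- S \<inter> piece j = {}" using piece_Union that by auto
      then show ?thesis using M[OF that, of "- S"] S_borel by (auto simp: D_def)
    qed
    then show "emeasure \<sigma> (- S) = 0" using S_borel by (subst \<sigma>(2)) auto
    fix V \<phi> A assume par: "local_parametrization S V \<phi>" and A: "A \<in> sets borel" "A \<subseteq> \<phi> ` V"
    have V: "open V" "smooth_on \<phi> V" "openin (top_of_set S) (\<phi> ` V)"
      using par unfolding local_parametrization_def by blast+
    have c: "continuous_on V \<phi>" using V(2) by (rule smooth_on_continuous_on)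
    have AS: "A \<subseteq> S" using A openin_imp_subset[OF V(3)] by blast
    let ?I = "\<lambda>B. \<integral>\<^sup>+y. ennreal (riem_density g \<phi> y) * indicator {y\<in>V. \<phi> y \<in> B} y \<partial>lborel"
    have dm: "(\<lambda>y. indicator V y * riem_density g \<phi> y) \<in> borel_measurable borel"
      using borel_measurable_continuous_on_indicator[OF _ riem_density_continuous_on[OF g V(2)]] V(1) by simp
    have meas: "(\<lambda>y. ennreal (riem_density g \<phi> y) * indicator {y\<in>V. \<phi> y \<in> B} y) \<in> borel_measurable lborel"
      if "B \<in> sets borel" for B
    proof -
      have [measurable]: "{y\<in>V. \<phi> y \<in> B} \<in> sets borel" by (intro continuous_on_preimage_borel V c that)
      have "(\<lambda>y. ennreal (indicator V y * riem_density g \<phi> y) * indicator {y\<in>V. \<phi> y \<in> B} y) \<in> borel_measurable lborel"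
        using dm by measurable
      also have "(\<lambda>y. ennreal (indicator V y * riem_density g \<phi> y) * indicator {y\<in>V. \<phi> y \<in> B} y) =
          (\<lambda>y. ennreal (riem_density g \<phi> y) * indicator {y\<in>V. \<phi> y \<in> B} y)"
        by (auto simp: indicator_def)
      finally show ?thesis .
    qed
    have "emeasure \<sigma> A = (\<Sum>j<k. D j (A \<inter> piece j))"
      using A by (simp add: \<sigma>(2) M)
    also have "\<dots> = (\<Sum>j<k. ?I (A \<inter> piece j))"
      unfolding D_def
    proof (intro sum.cong refl area_transition[OF g charts par])
      show "A \<inter> piece j \<in> sets borel" if "j \<in> {..<k}" for j using that A piece_borel by auto
      show "A \<inter> piece j \<subseteq> \<gamma> j ` W j" for j using piece_subset by blast
    qed (use A in auto)
    also have "\<dots> = (\<integral>\<^sup>+y. (\<Sum>j<k. ennreal (riem_density g \<phi> y) * indicator {y\<in>V. \<phi> y \<in> A \<inter> piece j} y) \<partial>lborel)"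
      using A piece_borel by (intro nn_integral_sum[symmetric] meas) auto
    also have "\<dots> = ?I A"
    proof (intro nn_integral_cong)
      fix y
      have "(\<Sum>j<k. indicator {y\<in>V. \<phi> y \<in> A \<inter> piece j} y) = (indicator {y\<in>V. \<phi> y \<in> A} y :: ennreal)"
      proof (cases "y \<in> V \<and> \<phi> y \<in> A")
        case True
        then have "\<phi> y \<in> (\<Union>j<k. piece j)" using AS piece_Union by blast
        then obtain j where j: "j < k" "\<phi> y \<in> piece j" by blast
        have "\<phi> y \<in> piece i \<longleftrightarrow> i = j" if "i < k" for i
          using j that piece_disjoint unfolding disjoint_family_on_def by blast
        then have "(\<Sum>i<k. indicator {y\<in>V. \<phi> y \<in> A \<inter> piece i} y) = (\<Sum>i<k. if i = j then 1 else 0 :: ennreal)"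
          using True by (intro sum.cong refl) (simp add: indicator_def)
        then show ?thesis using j True by (simp add: indicator_def)
      qed (auto simp: indicator_def)
      then show "(\<Sum>j<k. ennreal (riem_density g \<phi> y) * indicator {y\<in>V. \<phi> y \<in> A \<inter> piece j} y) =
         ennreal (riem_density g \<phi> y) * indicator {y\<in>V. \<phi> y \<in> A} y"
        by (simp flip: sum_distrib_left)
    qed
    finally show "emeasure \<sigma> A = ?I A" .
  qed
  then show ?thesis by blast
qed

lemma is_riem_area_riem_area:
  assumes "metric_form g"
  shows "is_riem_area g S (riem_area g S)"
proof -
  obtain \<mu> where \<mu>: "is_riem_area g S \<mu>" using is_riem_area_exists[OF assms] by blast
  then have "riem_area g S = \<mu>"
    unfolding riem_area_def using is_riem_area_unique[OF _ \<mu>] by (rule the_equality)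
  then show ?thesis using \<mu> by simp
qed

end

subsection \<open>Gram determinants of graphs\<close>

text \<open>Linearity in the rows: changing row \<open>k\<close> of the identity adds
  \<open>u $ k\<close> times the determinant with row \<open>k\<close> replaced by \<open>v\<close>.
  In that determinant the rows already changed differ from axis vectors only by multiples of row
  \<open>k\<close>, so it equals \<open>v $ k\<close>.\<close>

lemma det_identity_plus_outer_product:
  fixes u v :: "real^'n::finite"
  shows "det (\<chi> i j. (if i = j then 1 else 0) + u $ i * v $ j) = 1 + u \<bullet> v"
proof -
  define R where "R F i = (if i \<in> F then axis i 1 + u $ i *s v else axis i 1)" for F and i :: 'n
  have Q: "det (\<chi> i. if i = k then v else R F i) = v $ k" if "finite F" "k \<notin> F" for F and k :: 'n
    using that
  proof (induction F rule: finite_induct)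
    case empty
    have rows: "row i (mat 1 :: real^'n^'n) = axis i 1" for i
      by (auto simp: row_def mat_def axis_def vec_eq_iff)
    have "det (\<chi> i. if i = k then (\<Sum>i\<in>UNIV. v $ i *s row i (mat 1)) else row i (mat 1)) = v $ k * det (mat 1 :: real^'n^'n)"
      by (rule cramer_lemma_transpose)
    then show ?case unfolding rows by (simp add: R_def basis_expansion cong: if_cong)
  next
    case (insert j F)
    let ?A = "\<chi> i. if i = k then v else R F i"
    have jk: "j \<noteq> k" using insert.prems by auto
    have "det (\<chi> i. if i = j then row j ?A + u $ j *s row k ?A else row i ?A) = det ?A"
      by (rule det_row_operation[OF jk])
    moreover have "(\<chi> i. if i = j then row j ?A + u $ j *s row k ?A else row i ?A) = (\<chi> i. if i = k then v else R (insert j F) i)"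
      using jk insert.hyps by (auto simp: vec_eq_iff row_def R_def)
    ultimately show ?case using insert by simp
  qed
  have P: "det (\<chi> i. R F i) = 1 + (\<Sum>i\<in>F. u $ i * v $ i)" if "finite F" for F
    using that
  proof (induction F rule: finite_induct)
    case empty
    have "(\<chi> i. R {} i) = mat 1" by (auto simp: R_def vec_eq_iff mat_def axis_def)
    then show ?case by simp
  next
    case (insert k F)
    have "(\<chi> i. R (insert k F) i) = (\<chi> i. if i = k then axis i 1 + u $ i *s v else R F i)"
      by (auto simp: vec_eq_iff R_def)
    then have "det (\<chi> i. R (insert k F) i) =
        det (\<chi> i. if i = k then axis i 1 else R F i) + det (\<chi> i. if i = k then u $ i *s v else R F i)"
      using det_row_add[of k "\<lambda>i. axis i 1" "\<lambda>i. u $ i *s v" "R F"] by simp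
    also have "(\<chi> i. if i = k then axis i 1 else R F i) = (\<chi> i. R F i)"
      using insert.hyps by (auto simp: vec_eq_iff R_def)
    also have "(\<chi> i. if i = k then u $ i *s v else R F i) = (\<chi> i. if i = k then u $ k *s v else R F i)"
      by (auto simp: vec_eq_iff)
    also have "det (\<chi> i. if i = k then u $ k *s v else R F i) = u $ k * v $ k"
      using det_row_mul[of k "u $ k" "\<lambda>_. v" "R F"] Q[OF insert.hyps] by simp
    finally show ?case using insert by (simp add: ac_simps)
  qed
  have "(\<chi> i j. (if i = j then 1 else 0) + u $ i * v $ j) = (\<chi> i. R UNIV i)"
    by (auto simp: vec_eq_iff R_def axis_def)
  then show ?thesis using P[of UNIV] by (simp add: inner_vec_def)
qed

lemma det_identity_plus_minus_outer_product:
  fixes u b :: "real^'n::finite"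
  shows "det (\<chi> i j. (if i = j then 1 else 0) + u $ i * u $ j - b $ i * b $ j) =
         (1 + u \<bullet> u) * (1 - b \<bullet> b) + (u \<bullet> b)\<^sup>2"
proof -
  \<comment> \<open>With this \<open>c\<close> the vector \<open>w\<close> solves
    \<open>(I + u u^T) w = b\<close>, so that the matrix factors as
    \<open>(I + u u^T) (I - w b^T)\<close> and the previous determinant applies twice.\<close>
  define c where "c = (u \<bullet> b) / (1 + u \<bullet> u)"
  define w where "w = b - c *\<^sub>R u"
  have pos: "1 + u \<bullet> u > 0" by (simp add: add_pos_nonneg)
  have cU: "c + c * (u \<bullet> u) = u \<bullet> b"
  proof -
    have "c * (1 + u \<bullet> u) = u \<bullet> b" using pos by (simp add: c_def)
    then show ?thesis by (simp add: distrib_left)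
  qed
  have uw: "u \<bullet> w = c" using cU by (simp add: w_def inner_diff_right)
  have wb: "w \<bullet> b = b \<bullet> b - c * (u \<bullet> b)" by (simp add: w_def inner_diff_left)
  let ?A = "\<chi> i j. (if i = j then 1 else 0) + u $ i * u $ j"
  let ?B = "\<chi> i j. (if i = j then 1 else 0) + w $ i * (- b) $ j"
  have "(\<chi> i j. (if i = j then 1 else 0) + u $ i * u $ j - b $ i * b $ j) = ?A ** ?B"
    unfolding vec_eq_iff
  proof (intro allI)
    fix i j
    have "(?A ** ?B) $ i $ j = (\<Sum>k\<in>UNIV. ((if i = k then 1 else 0) + u $ i * u $ k) * ((if k = j then 1 else 0) - w $ k * b $ j))"
      by (simp add: matrix_matrix_mult_def)
    also have "\<dots> = (\<Sum>k\<in>UNIV. (if i = k then (if k = j then 1 else 0) - w $ k * b $ j else 0) +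
        ((if k = j then u $ i * u $ k else 0) - u $ i * b $ j * (u $ k * w $ k)))"
      by (intro sum.cong refl) (auto simp: algebra_simps)
    also have "\<dots> = (if i = j then 1 else 0) - w $ i * b $ j + (u $ i * u $ j - u $ i * b $ j * (u \<bullet> w))"
      by (simp add: sum.distrib sum_subtractf inner_vec_def flip: sum_distrib_left)
    also have "\<dots> = (if i = j then 1 else 0) + u $ i * u $ j - b $ i * b $ j"
      unfolding uw by (simp add: w_def algebra_simps)
    finally show "(\<chi> i j. (if i = j then 1 else 0) + u $ i * u $ j - b $ i * b $ j) $ i $ j = (?A ** ?B) $ i $ j"
      by simp
  qed
  then have "det (\<chi> i j. (if i = j then 1 else 0) + u $ i * u $ j - b $ i * b $ j) = (1 + u \<bullet> u) * (1 + w \<bullet> (- b))"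
    by (simp only: det_mul det_identity_plus_outer_product)
  also have "\<dots> = (1 + u \<bullet> u) * (1 - b \<bullet> b) + (c + c * (u \<bullet> u)) * (u \<bullet> b)"
    by (simp add: wb algebra_simps)
  finally show ?thesis unfolding cU by (simp add: power2_eq_square)
qed

lemma axis_one_nth: "axis i (1::real) $ j = (if j = i then 1 else 0)"
  by (simp add: axis_def)

lemma metric_form_inner: "metric_form (\<lambda>x. (\<bullet>) :: 'a::real_inner \<Rightarrow> 'a \<Rightarrow> real)"
  unfolding metric_form_def bilinear_def
  by (auto intro!: linearI continuous_intros simp: inner_add_left inner_add_right)

lemma one_plus_inner_pos: "1 + (x :: 'a::real_inner) \<bullet> x > 0"
  by (simp add: add_pos_nonneg)

lemma metric_form_hyp_metric: "metric_form (hyp_metric :: 'a::real_inner \<Rightarrow> 'a \<Rightarrow> 'a \<Rightarrow> real)"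
  unfolding metric_form_def
proof
  show "\<forall>x. bilinear (hyp_metric x :: 'a \<Rightarrow> 'a \<Rightarrow> real)"
    unfolding bilinear_def
    by (auto intro!: linearI simp: hyp_metric_eq inner_add_left inner_add_right algebra_simps add_divide_distrib)
  have "1 + x \<bullet> x \<noteq> 0" for x :: 'a using one_plus_inner_pos[of x] by simp
  then show "continuous_on UNIV (\<lambda>p :: 'a \<times> 'a \<times> 'a. hyp_metric (fst p) (fst (snd p)) (snd (snd p)))"
    unfolding hyp_metric_eq by (intro continuous_intros) auto
qed

context
  fixes T :: "(real^('n::finite)) \<times> real \<Rightarrow> real^('n option)" and g :: "real^'n \<Rightarrow> real" and z G :: "real^'n"
  assumes T: "frame T" and g: "(g has_derivative (\<lambda>v. G \<bullet> v)) (at z)"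
begin

lemma graph_has_derivative: "((\<lambda>z. T (z, g z)) has_derivative (\<lambda>v. T (v, G \<bullet> v))) (at z)"
  by (intro bounded_linear.has_derivative[OF frame_bounded_linear[OF T]] has_derivative_Pair has_derivative_ident g)

lemma graph_frechet_derivative: "frechet_derivative (\<lambda>z. T (z, g z)) (at z) = (\<lambda>v. T (v, G \<bullet> v))"
  using graph_has_derivative by (rule frechet_derivative_at[symmetric])

lemma riem_density_graph_inner:
  "riem_density (\<lambda>x. (\<bullet>)) (\<lambda>z. T (z, g z)) z = sqrt (1 + G \<bullet> G)"
proof -
  have "(\<chi> i j. T (axis i 1, G \<bullet> axis i 1) \<bullet> T (axis j 1, G \<bullet> axis j 1)) =
        (\<chi> i j. (if i = j then 1 else 0) + G $ i * G $ j)"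
    by (auto simp: vec_eq_iff frame_inner[OF T] inner_axis inner_axis_axis axis_one_nth)
  then show ?thesis
    unfolding riem_density_def graph_frechet_derivative by (simp add: det_identity_plus_outer_product)
qed

text \<open>The metric is the Euclidean one minus a rank one term, so the Gram matrix is the
  identity plus \<open>G G^T\<close> minus \<open>b b^T\<close>, where \<open>b\<close> consists of
  the products of \<open>x\<close> with the coordinate vectors, divided by \<open>sqrt X\<close>. In
  its determinant the terms combine into the square of \<open>g z - z \<bullet> G\<close>, which is
  \<open>x \<bullet> N\<close> times \<open>sqrt (1 + G \<bullet> G)\<close>.\<close>

lemma riem_density_graph_hyp_metric:
  defines "x \<equiv> T (z, g z)" and "N \<equiv> T (- G, 1) /\<^sub>R sqrt (1 + G \<bullet> G)"
  shows "riem_density hyp_metric (\<lambda>z. T (z, g z)) z =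
    sqrt (1 + (x \<bullet> N)\<^sup>2) / sqrt (1 + x \<bullet> x) * sqrt (1 + G \<bullet> G)"
proof -
  define X where "X = 1 + x \<bullet> x"
  have X: "X > 0" "sqrt X > 0" unfolding X_def using one_plus_inner_pos[of x] by auto
  define w where "w = z + g z *\<^sub>R G"
  define b where "b = inverse (sqrt X) *\<^sub>R w"
  have xx: "x \<bullet> x = z \<bullet> z + g z * g z" by (simp add: x_def frame_inner[OF T])
  have sX: "sqrt X * sqrt X = X" using X by simp
  have xi: "x \<bullet> T (axis i 1, G \<bullet> axis i 1) = z $ i + g z * G $ i" for i
    by (simp add: x_def frame_inner[OF T] inner_axis)
  have iX: "inverse (sqrt X) * inverse (sqrt X) = inverse X"
    unfolding inverse_mult_distrib[symmetric] sX ..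
  have bij: "b $ i * b $ j = (z $ i + g z * G $ i) * (z $ j + g z * G $ j) / X" for i j
  proof -
    have "b $ i * b $ j = (inverse (sqrt X) * inverse (sqrt X)) * ((z $ i + g z * G $ i) * (z $ j + g z * G $ j))"
      by (simp add: b_def w_def ac_simps)
    then show ?thesis unfolding iX by (simp add: divide_inverse)
  qed
  have "(\<chi> i j. hyp_metric x (T (axis i 1, G \<bullet> axis i 1)) (T (axis j 1, G \<bullet> axis j 1))) =
        (\<chi> i j. (if i = j then 1 else 0) + G $ i * G $ j - b $ i * b $ j)"
    unfolding hyp_metric_eq xi bij X_def[symmetric]
    by (auto simp: vec_eq_iff frame_inner[OF T] inner_axis inner_axis_axis axis_one_nth)
  then have "(riem_density hyp_metric (\<lambda>z. T (z, g z)) z) = sqrt ((1 + G \<bullet> G) * (1 - b \<bullet> b) + (G \<bullet> b)\<^sup>2)"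
    unfolding riem_density_def graph_frechet_derivative x_def[symmetric]
    by (simp add: det_identity_plus_minus_outer_product)
  also have "(1 + G \<bullet> G) * (1 - b \<bullet> b) + (G \<bullet> b)\<^sup>2 = (1 + G \<bullet> G + (g z - z \<bullet> G)\<^sup>2) / X"
  proof -
    have "b \<bullet> b = (inverse (sqrt X) * inverse (sqrt X)) * (w \<bullet> w)" by (simp add: b_def)
    then have bb: "b \<bullet> b = (w \<bullet> w) / X" unfolding iX by (simp add: divide_inverse)
    have "(G \<bullet> b)\<^sup>2 = (inverse (sqrt X) * inverse (sqrt X)) * (G \<bullet> w)\<^sup>2" by (simp add: b_def power2_eq_square)
    then have Gb: "(G \<bullet> b)\<^sup>2 = (G \<bullet> w)\<^sup>2 / X" unfolding iX by (simp add: divide_inverse)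
    have ww: "w \<bullet> w = z \<bullet> z + 2 * g z * (z \<bullet> G) + (g z)\<^sup>2 * (G \<bullet> G)"
      by (simp add: w_def inner_add_left inner_add_right inner_commute[of G z] power2_eq_square algebra_simps)
    have Gw: "G \<bullet> w = z \<bullet> G + g z * (G \<bullet> G)"
      by (simp add: w_def inner_add_right inner_commute[of G z])
    have "X * ((1 + G \<bullet> G) * (1 - b \<bullet> b) + (G \<bullet> b)\<^sup>2) = (1 + G \<bullet> G) * (X - w \<bullet> w) + (G \<bullet> w)\<^sup>2"
      unfolding bb Gb using X by (simp add: field_simps)
    also have "\<dots> = (1 + G \<bullet> G) * (X - (z \<bullet> z + 2 * g z * (z \<bullet> G) + (g z)\<^sup>2 * (G \<bullet> G))) + (z \<bullet> G + g z * (G \<bullet> G))\<^sup>2"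
      unfolding ww Gw ..
    also have "\<dots> = 1 + G \<bullet> G + (g z - z \<bullet> G)\<^sup>2"
      unfolding X_def xx by (simp add: algebra_simps power2_eq_square)
    finally show ?thesis using X by (simp add: field_simps)
  qed
  also have "1 + G \<bullet> G + (g z - z \<bullet> G)\<^sup>2 = (1 + (x \<bullet> N)\<^sup>2) * (1 + G \<bullet> G)"
  proof -
    have pos: "1 + G \<bullet> G > 0" by (rule one_plus_inner_pos)
    have "x \<bullet> N = (g z - z \<bullet> G) / sqrt (1 + G \<bullet> G)"
      by (simp add: x_def N_def frame_inner[OF T] divide_inverse mult.commute)
    then have "(x \<bullet> N)\<^sup>2 = (g z - z \<bullet> G)\<^sup>2 / (1 + G \<bullet> G)"
      using pos by (simp add: power_divide)
    then show ?thesis using pos by (simp add: field_simps)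
  qed
  finally show ?thesis
    by (simp add: real_sqrt_divide real_sqrt_mult X_def)
qed

end

subsection \<open>Graph charts of the boundary of a smooth domain\<close>

text \<open>Within the box over \<open>W\<close> the set \<open>\<Omega>\<close> is the region below
  the graph. The bounds on \<open>W\<close> and on the slope give each chart finite area; the
  formula for the normal translates surface integrals into integrals over \<open>W\<close>.\<close>

definition graph_chart ::
  "(real^('n::finite option)) set \<Rightarrow> ((real^'n) \<times> real \<Rightarrow> real^('n option)) \<Rightarrow> (real^'n) set \<Rightarrow> real \<Rightarrow> real \<Rightarrow> (real^'n \<Rightarrow> real) \<Rightarrow> bool" where
  "graph_chart \<Omega> T W a b g \<longleftrightarrow> frame T \<and> open W \<and> bounded W \<and> smooth_on g W \<and>
     (\<forall>z\<in>W. a < g z \<and> g z < b) \<and>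
     (\<forall>z\<in>W. \<forall>t. a < t \<longrightarrow> t < b \<longrightarrow> (T (z, t) \<in> \<Omega> \<longleftrightarrow> t \<le> g z) \<and> (T (z, t) \<in> frontier \<Omega> \<longleftrightarrow> t = g z)) \<and>
     (\<forall>z\<in>W. eucl_normal \<Omega> (T (z, g z)) = T (- grad g z, 1) /\<^sub>R sqrt (1 + grad g z \<bullet> grad g z)) \<and>
     (\<exists>C. \<forall>z\<in>W. sqrt (1 + grad g z \<bullet> grad g z) \<le> C)"

lemma graph_chart_has_derivative:
  assumes "graph_chart \<Omega> T W a b g" "z \<in> W"
  shows "(g has_derivative (\<lambda>v. grad g z \<bullet> v)) (at z)"
proof -
  have *: "(g has_derivative frechet_derivative g (at z)) (at z)"
    using assms by (intro smooth_on_has_derivative[of g W]) (simp_all add: graph_chart_def)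
  then have "frechet_derivative g (at z) = (\<lambda>v. grad g z \<bullet> v)"
    by (intro ext grad_inner) (auto simp: differentiable_def)
  then show ?thesis using * by simp
qed

lemma graph_chart_image_eq:
  assumes "graph_chart \<Omega> T W a b g"
  shows "frontier \<Omega> \<inter> T ` (W \<times> {a<..<b}) = (\<lambda>z. T (z, g z)) ` W"
proof -
  have gb: "\<And>z. z \<in> W \<Longrightarrow> a < g z \<and> g z < b"
    and fr: "\<And>z t. z \<in> W \<Longrightarrow> a < t \<Longrightarrow> t < b \<Longrightarrow> T (z, t) \<in> frontier \<Omega> \<longleftrightarrow> t = g z"
    using assms unfolding graph_chart_def by blast+
  show ?thesis
  proof (intro equalityI subsetI)
    fix x assume "x \<in> frontier \<Omega> \<inter> T ` (W \<times> {a<..<b})"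
    then obtain z t where "z \<in> W" "a < t" "t < b" "x = T (z, t)" "T (z, t) \<in> frontier \<Omega>" by auto
    moreover from this have "t = g z" using fr by blast
    ultimately show "x \<in> (\<lambda>z. T (z, g z)) ` W" by blast
  next
    fix x assume "x \<in> (\<lambda>z. T (z, g z)) ` W"
    then obtain z where "z \<in> W" "x = T (z, g z)" by blast
    then show "x \<in> frontier \<Omega> \<inter> T ` (W \<times> {a<..<b})" using gb[of z] fr[of z "g z"] by auto
  qed
qed

lemma graph_chart_linear_chart:
  assumes "graph_chart \<Omega> T W a b g"
  shows "linear_chart (frontier \<Omega>) W (\<lambda>z. T (z, g z)) (\<lambda>x. fst (inv T x))"
proof -
  let ?\<gamma> = "\<lambda>z. T (z, g z)"
  have T: "frame T" and W: "open W" and sm: "smooth_on g W" and gb: "\<And>z. z \<in> W \<Longrightarrow> a < g z \<and> g z < b"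
    and fr: "\<And>z t. z \<in> W \<Longrightarrow> a < t \<Longrightarrow> t < b \<Longrightarrow> T (z, t) \<in> frontier \<Omega> \<longleftrightarrow> t = g z"
    using assms unfolding graph_chart_def by blast+
  have proj: "bounded_linear (\<lambda>x. fst (inv T x))"
    by (intro bounded_linear_fst_comp frame_inv_bounded_linear T)
  have smg: "smooth_on ?\<gamma> W"
    using sm unfolding smooth_on_def
    by (intro allI Ck_on_bounded_linear[OF W _ frame_bounded_linear[OF T]] Ck_on_Pair Ck_on_id W) blast
  note im = graph_chart_image_eq[OF assms, symmetric]
  have "local_parametrization (frontier \<Omega>) W ?\<gamma>"
    unfolding local_parametrization_def
  proof (intro conjI ballI)
    show "inj (frechet_derivative ?\<gamma> (at y))" if "y \<in> W" for y
      unfolding graph_frechet_derivative[OF T graph_chart_has_derivative[OF assms that]]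
      using injD[OF frame_inj[OF T]] by (intro injI) blast
    show "openin (top_of_set (frontier \<Omega>)) (?\<gamma> ` W)"
      unfolding im using frame_open_image[OF T open_Times[OF W]] by (auto intro!: openin_open_Int)
    have "homeomorphism W (?\<gamma> ` W) ?\<gamma> (\<lambda>x. fst (inv T x))"
      using T smooth_on_continuous_on[OF smg] linear_continuous_on[OF proj]
      by (intro homeomorphismI) auto
    then show "\<exists>\<psi>. homeomorphism W (?\<gamma> ` W) ?\<gamma> \<psi>" by blast
  qed (use W smg in auto)
  then show ?thesis using proj T unfolding linear_chart_def by simp
qed

text \<open>Every direction that has a positive product with the normal can be made vertical, not
  just the normal itself. The divergence theorem relies on this freedom, because a chart yields it
  only in its vertical direction.\<close>

lemma graph_chart_exists:
  fixes \<Omega> :: "(real^('n::finite option)) set"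
  assumes dom: "smooth_bounded_domain \<Omega>" and x0: "x0 \<in> frontier \<Omega>"
    and T: "frame T" and e: "eucl_normal \<Omega> x0 \<bullet> T (0, 1) > 0"
  obtains W a b g where "graph_chart \<Omega> T W a b g" "x0 \<in> T ` (W \<times> {a<..<b})"
proof -
  obtain U f where xU: "x0 \<in> U" and df: "defining_function \<Omega> U f"
    using dom x0 by (rule smooth_bounded_domain_frontierE)
  have openU: "open U" and smf: "smooth_on f U" using df unfolding defining_function_def by blast+
  \<comment> \<open>Half the product at \<open>x0\<close>, so that the vertical derivative of
    \<open>f\<close> stays above \<open>c\<close> times the norm of its gradient on a neighbourhood;
    this becomes the slope bound \<open>1 / c\<close>.\<close>
  define c where "c = (eucl_normal \<Omega> x0 \<bullet> T (0, 1)) / 2"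
  have c: "c > 0" using e by (simp add: c_def)
  define V0 where "V0 = U \<inter> (\<lambda>x. grad f x \<bullet> T (0, 1) - c * norm (grad f x)) -` {0<..}"
  have "open V0"
    unfolding V0_def using grad_continuous_on[OF df]
    by (intro continuous_open_preimage continuous_intros openU) auto
  define V where "V = T -` V0"
  have openV: "open V"
    unfolding V_def using \<open>open V0\<close> linear_continuous_on[OF frame_bounded_linear[OF T]] by (intro open_vimage)
  have VU: "T p \<in> U" if "p \<in> V" for p using that by (simp add: V_def V0_def)
  have Vc: "grad f (T p) \<bullet> T (0, 1) > c * norm (grad f (T p))" if "p \<in> V" for p
    using that by (simp add: V_def V0_def)
  have x0V0: "x0 \<in> V0"
  proof -
    have n: "norm (grad f x0) > 0" using defining_function_grad(2)[OF df xU] by simp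
    have "eucl_normal \<Omega> x0 \<bullet> T (0, 1) = (grad f x0 \<bullet> T (0, 1)) / norm (grad f x0)"
      unfolding eucl_normal_eq[OF df xU x0] by (simp add: divide_inverse mult.commute)
    then have "grad f x0 \<bullet> T (0, 1) = 2 * c * norm (grad f x0)" using n by (simp add: c_def)
    then show ?thesis using n c xU by (simp add: V0_def)
  qed
  define F where "F p = f (T p)" for p
  define F' where "F' p v = grad f (T p) \<bullet> T v" for p v
  have derF: "(F has_derivative F' p) (at p)" if "p \<in> V" for p
    unfolding F_def F'_def[abs_def]
    using has_derivative_compose[OF bounded_linear_imp_has_derivative[OF frame_bounded_linear[OF T]]
        defining_function_has_derivative[OF df VU[OF that]]] .
  have posF: "F' p (0, 1) > 0" if "p \<in> V" for p
  proof -
    have "0 \<le> c * norm (grad f (T p))" using c by simp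
    then show ?thesis using Vc[OF that] unfolding F'_def by linarith
  qed
  obtain z0 t0 where zt: "inv T x0 = (z0, t0)" by (cases "inv T x0")
  then have Tzt: "T (z0, t0) = x0" using frame_inv(1)[OF T, of x0] by simp
  have p0: "(z0, t0) \<in> V" "F (z0, t0) = 0"
    using x0V0 Tzt frontier_defining_function[OF df xU] x0 by (simp_all add: V_def F_def)
  obtain r a b g where r: "r > 0" "a < t0" "t0 < b" and sub: "ball z0 r \<times> {a<..<b} \<subseteq> V"
    and gb: "\<And>z. z \<in> ball z0 r \<Longrightarrow> a < g z \<and> g z < b"
    and sign: "\<And>z t. z \<in> ball z0 r \<Longrightarrow> a < t \<Longrightarrow> t < b \<Longrightarrow> (F (z, t) \<le> 0 \<longleftrightarrow> t \<le> g z) \<and> (F (z, t) = 0 \<longleftrightarrow> t = g z)"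
    and derg: "\<And>z. z \<in> ball z0 r \<Longrightarrow> (g has_derivative (\<lambda>v. - F' (z, g z) (v, 0) / F' (z, g z) (0, 1))) (at z)"
    by (rule implicit_function[OF openV derF posF p0], assumption, assumption, rule that)
  have inV: "(z, t) \<in> V" if "z \<in> ball z0 r" "a < t" "t < b" for z t
    using sub that by auto
  have frF: "frechet_derivative F (at p) = F' p" if "p \<in> V" for p
    using derF[OF that] by (rule frechet_derivative_at[symmetric])
  have "smooth_on F V"
    unfolding smooth_on_def F_def
  proof
    fix k show "Ck_on k (\<lambda>p. f (T p)) V"
    proof (rule Ck_on_compose[OF openV openU])
      show "Ck_on k f U" using smf unfolding smooth_on_def by blast
      show "Ck_on k T V" by (rule Ck_on_linear[OF openV frame_bounded_linear[OF T]])
      show "T ` V \<subseteq> U" using VU by blast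
    qed
  qed
  then have smg: "smooth_on g (ball z0 r)"
  proof (rule implicit_function_smooth[OF openV _ open_ball])
    fix z assume z: "z \<in> ball z0 r"
    have p: "(z, g z) \<in> V" using z gb by (intro inV) auto
    show "(z, g z) \<in> V \<and> frechet_derivative F (at (z, g z)) (0, 1) \<noteq> 0"
      using p posF[OF p] frF[OF p] by simp
    show "(g has_derivative (\<lambda>v. - frechet_derivative F (at (z, g z)) (v, 0) / frechet_derivative F (at (z, g z)) (0, 1))) (at z)"
      unfolding frF[OF p] using derg[OF z] .
  qed
  have normal: "eucl_normal \<Omega> (T (z, g z)) = T (- grad g z, 1) /\<^sub>R sqrt (1 + grad g z \<bullet> grad g z)"
    and bound: "sqrt (1 + grad g z \<bullet> grad g z) \<le> 1 / c" if z: "z \<in> ball z0 r" for z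
  proof -
    have p: "(z, g z) \<in> V" using z gb by (intro inV) auto
    define G where "G = grad f (T (z, g z))"
    obtain P q where Pq: "inv T G = (P, q)" by (cases "inv T G")
    then have G: "G = T (P, q)" using frame_inv(1)[OF T, of G] by simp
    have F'v: "F' (z, g z) (v, 0) = P \<bullet> v" and F'1: "F' (z, g z) (0, 1) = q" for v
      by (simp_all add: F'_def G_def[symmetric] G frame_inner[OF T])
    have q: "q > 0" using posF[OF p] F'1 by simp
    have "frechet_derivative g (at z) = (\<lambda>v. - (P \<bullet> v) / q)"
      using derg[OF z] unfolding F'v F'1 by (rule frechet_derivative_at[symmetric])
    moreover have "g differentiable (at z)" using derg[OF z] by (auto simp: differentiable_def)
    ultimately have gv: "grad g z \<bullet> v = - (P \<bullet> v) / q" for v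
      using grad_inner[of g z v] by simp
    have "P = (- q) *\<^sub>R grad g z"
    proof (rule vector_eq_rdot[THEN iffD1], rule allI)
      fix v show "P \<bullet> v = ((- q) *\<^sub>R grad g z) \<bullet> v"
        using q by (simp add: gv)
    qed
    then have G': "G = q *\<^sub>R T (- grad g z, 1)"
      unfolding G by (simp flip: frame_scaleR[OF T])
    have nT: "norm (T (- grad g z, 1)) = sqrt (1 + grad g z \<bullet> grad g z)"
      unfolding frame_norm[OF T] by (simp add: norm_Pair power2_norm_eq_inner add.commute)
    have fr: "T (z, g z) \<in> frontier \<Omega>"
      using frontier_defining_function[OF df VU[OF p]] sign[OF z, of "g z"] gb[OF z] by (simp add: F_def)
    have "eucl_normal \<Omega> (T (z, g z)) = G /\<^sub>R norm G"
      using eucl_normal_eq[OF df VU[OF p] fr] by (simp add: G_def)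
    then show "eucl_normal \<Omega> (T (z, g z)) = T (- grad g z, 1) /\<^sub>R sqrt (1 + grad g z \<bullet> grad g z)"
      using q by (simp add: G' nT)
    have "c * norm G < G \<bullet> T (0, 1)" using Vc[OF p] by (simp add: G_def)
    then have "c * (q * sqrt (1 + grad g z \<bullet> grad g z)) < q"
      using q by (simp add: G' nT frame_inner[OF T])
    then have "c * sqrt (1 + grad g z \<bullet> grad g z) \<le> 1"
      using q by (simp add: mult.left_commute[of c q])
    then show "sqrt (1 + grad g z \<bullet> grad g z) \<le> 1 / c"
      using c by (simp add: field_simps)
  qed
  have "graph_chart \<Omega> T (ball z0 r) a b g"
    unfolding graph_chart_def
  proof (intro conjI ballI allI impI)
    fix z t assume z: "z \<in> ball z0 r" "a < t" "t < b"
    have "T (z, t) \<in> U" using inV[OF z] VU by blast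
    then show "T (z, t) \<in> \<Omega> \<longleftrightarrow> t \<le> g z" "T (z, t) \<in> frontier \<Omega> \<longleftrightarrow> t = g z"
      using sign[OF z] defining_function_mem[OF df] frontier_defining_function[OF df] by (simp_all add: F_def)
  next
    show "\<exists>C. \<forall>z\<in>ball z0 r. sqrt (1 + grad g z \<bullet> grad g z) \<le> C" using bound by blast
  qed (use T smg gb normal in auto)
  moreover have "x0 \<in> T ` (ball z0 r \<times> {a<..<b})"
    using Tzt r by (intro image_eqI[of _ _ "(z0, t0)"]) auto
  ultimately show ?thesis by (rule that)
qed

lemma graph_charts_cover:
  fixes \<Omega> :: "(real^('n::finite option)) set"
  assumes dom: "smooth_bounded_domain \<Omega>"
  obtains k :: nat and T W a b g where "\<And>j. j < k \<Longrightarrow> graph_chart \<Omega> (T j) (W j) (a j) (b j) (g j)"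
    "frontier \<Omega> = (\<Union>j<k. (\<lambda>z. T j (z, g j z)) ` W j)"
proof -
  let ?Q = "\<lambda>(T, W, a, b, g). graph_chart \<Omega> T W a b g"
  let ?O = "\<lambda>(T, W, a, b, g). T ` (W \<times> {a<..<b})"
  have "\<exists>q. ?Q q \<and> x \<in> ?O q" if x: "x \<in> frontier \<Omega>" for x
  proof -
    have n: "norm (eucl_normal \<Omega> x) = 1" by (rule eucl_normal_unit[OF dom x])
    obtain T :: "(real^'n) \<times> real \<Rightarrow> real^('n option)" where T: "frame T" "T (0, 1) = eucl_normal \<Omega> x"
      using frame_exists[OF n] by metis
    have "eucl_normal \<Omega> x \<bullet> T (0, 1) > 0" using n by (simp add: T(2) dot_square_norm)
    then obtain W a b g where "graph_chart \<Omega> T W a b g" "x \<in> T ` (W \<times> {a<..<b})"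
      by (rule graph_chart_exists[OF dom x T(1)])
    then show ?thesis by (intro exI[of _ "(T, W, a, b, g)"]) simp
  qed
  then have "\<forall>x\<in>frontier \<Omega>. \<exists>q. ?Q q \<and> x \<in> ?O q" by blast
  from bchoice[OF this] obtain q where "\<forall>x\<in>frontier \<Omega>. ?Q (q x) \<and> x \<in> ?O (q x)" ..
  then have q: "?Q (q x) \<and> x \<in> ?O (q x)" if "x \<in> frontier \<Omega>" for x using that by (rule bspec)
  have comp: "compact (frontier \<Omega>)"
    using dom by (simp add: smooth_bounded_domain_def compact_frontier)
  have opn: "open (?O (q x))" if "x \<in> frontier \<Omega>" for x
    using q[OF that] by (auto simp: graph_chart_def intro!: frame_open_image open_Times split: prod.splits)
  have sub: "frontier \<Omega> \<subseteq> (\<Union>x\<in>frontier \<Omega>. ?O (q x))"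
  proof
    fix x assume "x \<in> frontier \<Omega>"
    then show "x \<in> (\<Union>x\<in>frontier \<Omega>. ?O (q x))" by (rule UN_I) (rule conjunct2[OF q], fact)
  qed
  obtain D where D: "D \<subseteq> frontier \<Omega>" "finite D" "frontier \<Omega> \<subseteq> (\<Union>x\<in>D. ?O (q x))"
    by (rule compactE_image[OF comp opn sub], assumption, rule that)
  obtain xs where xs: "set xs = D" using \<open>finite D\<close> finite_list by blast
  define c where "c j = q (xs ! j)" for j
  have ch: "?Q (c j)" if "j < length xs" for j
    unfolding c_def using that D(1) xs by (intro conjunct1[OF q]) auto
  have img: "frontier \<Omega> \<inter> ?O (c j) = (\<lambda>z. fst (c j) (z, snd (snd (snd (snd (c j)))) z)) ` fst (snd (c j))" if "j < length xs" for j
  proof -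
    obtain T W a b g where c: "c j = (T, W, a, b, g)" by (rule prod_cases5)
    then have "graph_chart \<Omega> T W a b g" using ch[OF that] by simp
    from graph_chart_image_eq[OF this] show ?thesis by (simp add: c)
  qed
  have "frontier \<Omega> = (\<Union>j<length xs. frontier \<Omega> \<inter> ?O (c j))"
  proof (intro equalityI subsetI)
    fix x assume x: "x \<in> frontier \<Omega>"
    from x D(3) have "x \<in> (\<Union>y\<in>set xs. ?O (q y))" unfolding xs by (rule set_rev_mp)
    then obtain y where y: "y \<in> set xs" "x \<in> ?O (q y)" by (rule UN_E)
    obtain j where j: "j < length xs" "xs ! j = y" using y(1) unfolding in_set_conv_nth by blast
    show "x \<in> (\<Union>j<length xs. frontier \<Omega> \<inter> ?O (c j))"
      by (rule UN_I[of j]) (use j y x in \<open>simp_all add: c_def\<close>)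
  next
    fix x assume "x \<in> (\<Union>j<length xs. frontier \<Omega> \<inter> ?O (c j))"
    then show "x \<in> frontier \<Omega>" by (rule UN_E) (rule IntD1)
  qed
  also have "\<dots> = (\<Union>j<length xs. (\<lambda>z. fst (c j) (z, snd (snd (snd (snd (c j)))) z)) ` fst (snd (c j)))"
    by (rule SUP_cong[OF refl]) (rule img, simp)
  finally show ?thesis
    using ch by (intro that[of "length xs" "\<lambda>j. fst (c j)" "\<lambda>j. fst (snd (c j))" "\<lambda>j. fst (snd (snd (c j)))"
          "\<lambda>j. fst (snd (snd (snd (c j))))" "\<lambda>j. snd (snd (snd (snd (c j))))"]) (auto simp: split_def)
qed

subsection \<open>Integration over the boundary of a smooth domain\<close>

lemma graph_chart_measurable:
  fixes \<Omega> :: "(real^('n::finite option)) set"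
  assumes "graph_chart \<Omega> T W a b g"
  shows "W \<in> sets borel" "continuous_on W (\<lambda>z. T (z, g z))"
    "(\<lambda>z. if z \<in> W then T (z, g z) else 0) \<in> borel_measurable borel"
    "(\<lambda>z. indicator W z * sqrt (1 + grad g z \<bullet> grad g z)) \<in> borel_measurable borel"
proof -
  have W: "open W" and sm: "smooth_on g W" and T: "frame T" using assms unfolding graph_chart_def by blast+
  show "W \<in> sets borel" using W by simp
  show c: "continuous_on W (\<lambda>z. T (z, g z))"
    by (intro continuous_on_compose2[OF linear_continuous_on[OF frame_bounded_linear[OF T], of UNIV]]
        continuous_intros smooth_on_continuous_on[OF sm]) auto
  show "(\<lambda>z. if z \<in> W then T (z, g z) else 0) \<in> borel_measurable borel"
    using W c by (intro borel_measurable_continuous_on_if) auto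
  have "Ck_on 0 (\<lambda>x. \<Sum>b\<in>Basis. frechet_derivative g (at x) b *\<^sub>R b) W"
    using sm W by (intro Ck_on_grad) (auto simp: smooth_on_def simp del: Ck_on.simps)
  then have "continuous_on W (grad g)" by (simp add: grad_def[abs_def])
  then have "continuous_on W (\<lambda>z. sqrt (1 + grad g z \<bullet> grad g z))"
    by (intro continuous_intros)
  from borel_measurable_continuous_on_indicator[OF _ this] W
  show "(\<lambda>z. indicator W z * sqrt (1 + grad g z \<bullet> grad g z)) \<in> borel_measurable borel" by simp
qed

locale smooth_domain =
  fixes \<Omega> :: "(real^('n::{finite,wellorder} option)) set"
  assumes dom: "smooth_bounded_domain \<Omega>"
begin

abbreviation "\<sigma> \<equiv> riem_area (\<lambda>x. (\<bullet>)) (frontier \<Omega>)"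
abbreviation "N \<equiv> eucl_normal \<Omega>"

lemma compact_domain: "compact \<Omega>"
  using dom by (simp add: smooth_bounded_domain_def)

lemma compact_frontier_domain: "compact (frontier \<Omega>)"
  using compact_domain by (rule compact_frontier)

lemma frontier_subset: "frontier \<Omega> \<subseteq> \<Omega>"
  using compact_domain by (simp add: compact_imp_closed frontier_subset_closed)

lemma frontier_borel [measurable]: "frontier \<Omega> \<in> sets borel"
  and domain_borel [measurable]: "\<Omega> \<in> sets borel"
  using compact_domain by (auto intro: borel_closed compact_imp_closed)

definition graph_cover where
  "graph_cover (k::nat) T W a b g \<longleftrightarrow> (\<forall>j<k. graph_chart \<Omega> (T j) (W j) (a j) (b j) (g j)) \<and>
     frontier \<Omega> = (\<Union>j<k. (\<lambda>z. T j (z, g j z)) ` W j)"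

lemma graph_cover_exists:
  obtains k T W a b g where "graph_cover k T W a b g"
proof -
  obtain k :: nat and T W a b g where c: "\<And>j. j < k \<Longrightarrow> graph_chart \<Omega> (T j) (W j) (a j) (b j) (g j)"
    "frontier \<Omega> = (\<Union>j<k. (\<lambda>z. T j (z, g j z)) ` W j)"
    by (rule graph_charts_cover[OF dom], rule that)
  then have "graph_cover k T W a b g" unfolding graph_cover_def by blast
  then show ?thesis by (rule that)
qed

lemma graph_coverD:
  assumes "graph_cover k T W a b g"
  shows "j < k \<Longrightarrow> graph_chart \<Omega> (T j) (W j) (a j) (b j) (g j)"
    "frontier \<Omega> = (\<Union>j<k. (\<lambda>z. T j (z, g j z)) ` W j)"
    "chart_cover (frontier \<Omega>) k W (\<lambda>j z. T j (z, g j z)) (\<lambda>j x. fst (inv (T j) x))"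
proof -
  show c: "graph_chart \<Omega> (T j) (W j) (a j) (b j) (g j)" if "j < k" for j
    using assms that unfolding graph_cover_def by blast
  show c2: "frontier \<Omega> = (\<Union>j<k. (\<lambda>z. T j (z, g j z)) ` W j)"
    using assms unfolding graph_cover_def by (rule conjunct2)
  show "chart_cover (frontier \<Omega>) k W (\<lambda>j z. T j (z, g j z)) (\<lambda>j x. fst (inv (T j) x))"
  proof
    show "frontier \<Omega> \<in> sets borel" by (rule frontier_borel)
    show "linear_chart (frontier \<Omega>) (W j) (\<lambda>z. T j (z, g j z)) (\<lambda>x. fst (inv (T j) x))" if "j < k" for j
      by (rule graph_chart_linear_chart[OF c[OF that]])
  qed (rule c2)
qed

lemma is_riem_area:
  assumes "metric_form g"
  shows "is_riem_area g (frontier \<Omega>) (riem_area g (frontier \<Omega>))"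
proof -
  obtain k T W a b g' where "graph_cover k T W a b g'" by (rule graph_cover_exists)
  then interpret chart_cover "frontier \<Omega>" k W "\<lambda>j z. T j (z, g' j z)" "\<lambda>j x. fst (inv (T j) x)"
    by (rule graph_coverD(3))
  show ?thesis using assms by (rule is_riem_area_riem_area)
qed

lemma sets_area [simp, measurable_cong]: "sets \<sigma> = sets borel"
  and area_outside: "emeasure \<sigma> (- frontier \<Omega>) = 0"
  using is_riem_area[OF metric_form_inner] unfolding is_riem_area_def by blast+

lemma space_area [simp]: "space \<sigma> = UNIV"
  using sets_eq_imp_space_eq[OF sets_area] by simp

lemma graph_chart_image_borel:
  assumes "graph_chart \<Omega> T W a b g"
  shows "(\<lambda>z. T (z, g z)) ` W \<in> sets borel"
proof -
  have "open (T ` (W \<times> {a<..<b}))"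
    using assms by (intro frame_open_image open_Times) (auto simp: graph_chart_def)
  then show ?thesis
    unfolding graph_chart_image_eq[OF assms, symmetric] by (intro sets.Int frontier_borel) auto
qed

lemma emeasure_area_chart:
  assumes m: "metric_form h" and ch: "graph_chart \<Omega> T W a b g" and A: "A \<in> sets borel" "A \<subseteq> (\<lambda>z. T (z, g z)) ` W"
  shows "emeasure (riem_area h (frontier \<Omega>)) A =
    (\<integral>\<^sup>+z. ennreal (riem_density h (\<lambda>z. T (z, g z)) z) * indicator {z\<in>W. T (z, g z) \<in> A} z \<partial>lborel)"
  using graph_chart_linear_chart[OF ch] unfolding linear_chart_def
  by (intro is_riem_areaD[OF is_riem_area[OF m]] A) blast

text \<open>An equality of measures rather than of integrals: the chart formulas for Bochner
  integrals and for nonnegative integrals are both derived from it.\<close>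

lemma area_chart_density:
  assumes ch: "graph_chart \<Omega> T W a b g"
  shows "density \<sigma> (\<lambda>x. ennreal (indicator ((\<lambda>z. T (z, g z)) ` W) x)) =
    distr (density lborel (\<lambda>z. ennreal (indicator W z * sqrt (1 + grad g z \<bullet> grad g z)))) borel
      (\<lambda>z. if z \<in> W then T (z, g z) else 0)" (is "?L = ?R")
proof (rule measure_eqI)
  show "sets ?L = sets ?R" by simp
  fix A assume "A \<in> sets ?L"
  then have A[measurable]: "A \<in> sets borel" by simp
  note [measurable] = graph_chart_measurable[OF ch]
  let ?I = "(\<lambda>z. T (z, g z)) ` W"
  let ?c = "\<lambda>z. if z \<in> W then T (z, g z) else 0"
  have I[measurable]: "?I \<in> sets borel" by (rule graph_chart_image_borel[OF ch])
  have T: "frame T" using ch by (simp add: graph_chart_def)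
  have "emeasure ?L A = (\<integral>\<^sup>+x. ennreal (indicator ?I x) * indicator A x \<partial>\<sigma>)"
    by (subst emeasure_density) auto
  also have "\<dots> = (\<integral>\<^sup>+x. indicator (?I \<inter> A) x \<partial>\<sigma>)"
    by (intro nn_integral_cong) (auto simp: indicator_def)
  also have "\<dots> = emeasure \<sigma> (?I \<inter> A)" by (intro nn_integral_indicator) auto
  also have "\<dots> = (\<integral>\<^sup>+z. ennreal (riem_density (\<lambda>x. (\<bullet>)) (\<lambda>z. T (z, g z)) z) * indicator {z\<in>W. T (z, g z) \<in> ?I \<inter> A} z \<partial>lborel)"
    by (rule emeasure_area_chart[OF metric_form_inner ch]) auto
  also have "\<dots> = (\<integral>\<^sup>+z. ennreal (indicator W z * sqrt (1 + grad g z \<bullet> grad g z)) * indicator (?c -` A) z \<partial>lborel)"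
    using riem_density_graph_inner[OF T graph_chart_has_derivative[OF ch]]
    by (intro nn_integral_cong) (auto simp: indicator_def)
  also have "\<dots> = emeasure (density lborel (\<lambda>z. ennreal (indicator W z * sqrt (1 + grad g z \<bullet> grad g z)))) (?c -` A)"
    using measurable_sets[OF graph_chart_measurable(3)[OF ch] A] by (subst emeasure_density) auto
  also have "\<dots> = emeasure ?R A" by (subst emeasure_distr) auto
  finally show "emeasure ?L A = emeasure ?R A" .
qed

lemma area_integral_chart:
  fixes F :: "real^('n option) \<Rightarrow> real"
  assumes ch: "graph_chart \<Omega> T W a b g" and [measurable]: "F \<in> borel_measurable borel"
  shows "(\<integral>x. indicator ((\<lambda>z. T (z, g z)) ` W) x * F x \<partial>\<sigma>) =
         (\<integral>z. indicator W z * (sqrt (1 + grad g z \<bullet> grad g z) * F (T (z, g z))) \<partial>lborel)"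
proof -
  note [measurable] = graph_chart_measurable[OF ch] graph_chart_image_borel[OF ch]
  let ?c = "\<lambda>z. if z \<in> W then T (z, g z) else 0"
  have "(\<integral>x. indicator ((\<lambda>z. T (z, g z)) ` W) x * F x \<partial>\<sigma>) =
      integral\<^sup>L (density \<sigma> (\<lambda>x. ennreal (indicator ((\<lambda>z. T (z, g z)) ` W) x))) F"
    by (subst integral_density) auto
  also have "\<dots> = (\<integral>z. F (?c z) \<partial>density lborel (\<lambda>z. ennreal (indicator W z * sqrt (1 + grad g z \<bullet> grad g z))))"
    unfolding area_chart_density[OF ch] by (rule integral_distr) auto
  also have "\<dots> = (\<integral>z. (indicator W z * sqrt (1 + grad g z \<bullet> grad g z)) *\<^sub>R F (?c z) \<partial>lborel)"
  proof (rule integral_density)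
    have "?c \<in> borel_measurable borel" by (rule graph_chart_measurable(3)[OF ch])
    then show "(\<lambda>z. F (?c z)) \<in> borel_measurable lborel" by (intro measurable_compose[OF _ assms(2)]) simp
  qed auto
  also have "\<dots> = (\<integral>z. indicator W z * (sqrt (1 + grad g z \<bullet> grad g z) * F (T (z, g z))) \<partial>lborel)"
    by (intro Bochner_Integration.integral_cong) (auto simp: indicator_def)
  finally show ?thesis .
qed

lemma area_nn_integral_chart:
  fixes F :: "real^('n option) \<Rightarrow> ennreal"
  assumes ch: "graph_chart \<Omega> T W a b g" and [measurable]: "F \<in> borel_measurable borel"
  shows "(\<integral>\<^sup>+x. indicator ((\<lambda>z. T (z, g z)) ` W) x * F x \<partial>\<sigma>) =
         (\<integral>\<^sup>+z. indicator W z * (ennreal (sqrt (1 + grad g z \<bullet> grad g z)) * F (T (z, g z))) \<partial>lborel)"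
proof -
  note [measurable] = graph_chart_measurable[OF ch] graph_chart_image_borel[OF ch]
  let ?c = "\<lambda>z. if z \<in> W then T (z, g z) else 0"
  have cm: "?c \<in> borel_measurable borel" by (rule graph_chart_measurable(3)[OF ch])
  have "(\<integral>\<^sup>+x. indicator ((\<lambda>z. T (z, g z)) ` W) x * F x \<partial>\<sigma>) =
      (\<integral>\<^sup>+x. ennreal (indicator ((\<lambda>z. T (z, g z)) ` W) x) * F x \<partial>\<sigma>)"
    by (intro nn_integral_cong) (auto simp: indicator_def)
  also have "\<dots> = integral\<^sup>N (density \<sigma> (\<lambda>x. ennreal (indicator ((\<lambda>z. T (z, g z)) ` W) x))) F"
    by (subst nn_integral_density) auto
  also have "\<dots> = (\<integral>\<^sup>+z. F (?c z) \<partial>density lborel (\<lambda>z. ennreal (indicator W z * sqrt (1 + grad g z \<bullet> grad g z))))"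
    unfolding area_chart_density[OF ch] by (rule nn_integral_distr) auto
  also have "\<dots> = (\<integral>\<^sup>+z. ennreal (indicator W z * sqrt (1 + grad g z \<bullet> grad g z)) * F (?c z) \<partial>lborel)"
    using cm by (intro nn_integral_density) (auto intro: measurable_compose[OF _ assms(2)])
  also have "\<dots> = (\<integral>\<^sup>+z. indicator W z * (ennreal (sqrt (1 + grad g z \<bullet> grad g z)) * F (T (z, g z))) \<partial>lborel)"
    by (intro nn_integral_cong) (auto simp: indicator_def)
  finally show ?thesis .
qed

section \<open>Finiteness and full support of the area\<close>

lemma finite_area: "finite_measure \<sigma>"
proof
  obtain k T W a b g where gc: "graph_cover k T W a b g" by (rule graph_cover_exists)
  note c = graph_coverD[OF gc]
  let ?I = "\<lambda>j. (\<lambda>z. T j (z, g j z)) ` W j"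
  have I: "?I j \<in> sets borel" if "j < k" for j using graph_chart_image_borel[OF c(1)[OF that]] .
  have fin: "emeasure \<sigma> (?I j) < \<infinity>" if j: "j < k" for j
  proof -
    obtain C where C: "\<And>z. z \<in> W j \<Longrightarrow> sqrt (1 + grad (g j) z \<bullet> grad (g j) z) \<le> C"
      using c(1)[OF j] unfolding graph_chart_def by blast
    have W: "bounded (W j)" "W j \<in> sets borel" using c(1)[OF j] graph_chart_measurable(1)[OF c(1)[OF j]]
      unfolding graph_chart_def by blast+
    have "emeasure \<sigma> (?I j) = (\<integral>\<^sup>+x. indicator (?I j) x * 1 \<partial>\<sigma>)" using I[OF j] by simp
    also have "\<dots> = (\<integral>\<^sup>+z. indicator (W j) z * (ennreal (sqrt (1 + grad (g j) z \<bullet> grad (g j) z)) * 1) \<partial>lborel)"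
      by (rule area_nn_integral_chart[OF c(1)[OF j]]) simp
    also have "\<dots> \<le> (\<integral>\<^sup>+z. ennreal C * indicator (W j) z \<partial>lborel)"
      using C by (intro nn_integral_mono) (auto simp: indicator_def intro!: ennreal_leI)
    also have "\<dots> = ennreal C * emeasure lborel (W j)" using W by (simp add: nn_integral_cmult)
    also have "\<dots> < \<infinity>" using emeasure_bounded_finite[OF W(1)] by (simp add: ennreal_mult_less_top)
    finally show ?thesis .
  qed
  have "emeasure \<sigma> UNIV = emeasure \<sigma> (frontier \<Omega> \<union> - frontier \<Omega>)" by simp
  also have "\<dots> \<le> emeasure \<sigma> (frontier \<Omega>) + emeasure \<sigma> (- frontier \<Omega>)"
    by (rule emeasure_subadditive) auto
  also have "\<dots> = emeasure \<sigma> (\<Union>j\<in>{..<k}. ?I j)" using area_outside c(2) by simp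
  also have "\<dots> \<le> (\<Sum>j<k. emeasure \<sigma> (?I j))"
    using I by (intro emeasure_subadditive_finite) auto
  also have "\<dots> < \<infinity>" using fin by simp
  finally show "emeasure \<sigma> (space \<sigma>) \<noteq> \<infinity>" by simp
qed

sublocale area: finite_measure \<sigma> by (rule finite_area)

lemma continuous_normal: "continuous_on (frontier \<Omega>) N"
  by (rule eucl_normal_continuous_on[OF dom])

lemma norm_normal: "x \<in> frontier \<Omega> \<Longrightarrow> norm (N x) = 1"
  by (rule eucl_normal_unit[OF dom])

lemma borel_measurable_on_frontier:
  fixes F :: "real^('n option) \<Rightarrow> 'b::{real_normed_vector, second_countable_topology}"
  assumes "continuous_on (frontier \<Omega>) F"
  shows "(\<lambda>x. indicator (frontier \<Omega>) x *\<^sub>R F x) \<in> borel_measurable borel"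
  using borel_measurable_continuous_on_indicator[OF frontier_borel assms] .

lemma integrable_on_frontier:
  fixes F :: "real^('n option) \<Rightarrow> 'b::{banach, second_countable_topology}"
  assumes "continuous_on (frontier \<Omega>) F"
  shows "set_integrable \<sigma> (frontier \<Omega>) F"
proof -
  have "compact (F ` frontier \<Omega>)" using assms compact_frontier_domain by (rule compact_continuous_image)
  then obtain B where B: "\<And>x. x \<in> frontier \<Omega> \<Longrightarrow> norm (F x) \<le> B"
    using compact_imp_bounded bounded_iff by (metis imageI)
  show ?thesis unfolding set_integrable_def
  proof (rule area.integrable_const_bound[of _ "max 0 B"])
    show "AE x in \<sigma>. norm (indicator (frontier \<Omega>) x *\<^sub>R F x) \<le> max 0 B"
      using B by (intro AE_I2) (auto simp: indicator_def max.coboundedI2)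
    show "(\<lambda>x. indicator (frontier \<Omega>) x *\<^sub>R F x) \<in> borel_measurable \<sigma>"
      using borel_measurable_on_frontier[OF assms] by simp
  qed
qed

text \<open>The area density of a graph is at least 1, so the boundary patch over a ball has at
  least the measure of that ball. This serves the equality case, where equality almost everywhere
  must become equality at every boundary point.\<close>

lemma area_pos_open:
  assumes U: "open U" and x: "x \<in> frontier \<Omega>" "x \<in> U"
  shows "emeasure \<sigma> (frontier \<Omega> \<inter> U) > 0"
proof -
  obtain k T W a b g where gc: "graph_cover k T W a b g" by (rule graph_cover_exists)
  note c = graph_coverD[OF gc]
  obtain j z where j: "j < k" and z: "z \<in> W j" "x = T j (z, g j z)" using x(1) unfolding c(2) by blast
  note ch = c(1)[OF j]
  let ?c = "\<lambda>z. T j (z, g j z)"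
  have W: "open (W j)" using ch by (simp add: graph_chart_def)
  have "open (W j \<inter> ?c -` U)" by (intro continuous_open_preimage graph_chart_measurable(2)[OF ch] W U)
  moreover have "z \<in> W j \<inter> ?c -` U" using z x by auto
  ultimately obtain e where e: "e > 0" "ball z e \<subseteq> W j \<inter> ?c -` U" by (metis open_contains_ball)
  have "0 < emeasure lborel (ball z e)"
  proof -
    have "measure lborel (ball z e) > 0" using e(1) by (rule content_ball_pos)
    then show ?thesis unfolding measure_def by (simp add: enn2real_positive_iff)
  qed
  also have "\<dots> \<le> (\<integral>\<^sup>+z. indicator (W j) z * (ennreal (sqrt (1 + grad (g j) z \<bullet> grad (g j) z)) * indicator U (?c z)) \<partial>lborel)"
  proof (subst nn_integral_indicator[symmetric])
    show "(\<integral>\<^sup>+y. indicator (ball z e) y \<partial>lborel) \<le> (\<integral>\<^sup>+z. indicator (W j) z * (ennreal (sqrt (1 + grad (g j) z \<bullet> grad (g j) z)) * indicator U (?c z)) \<partial>lborel)"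
    proof (rule nn_integral_mono)
      fix y :: "real^('n::{finite,wellorder})"
      have "1 \<le> ennreal (sqrt (1 + grad (g j) y \<bullet> grad (g j) y))"
        by (subst ennreal_1[symmetric], rule ennreal_leI) simp
      then show "indicator (ball z e) y \<le> indicator (W j) y * (ennreal (sqrt (1 + grad (g j) y \<bullet> grad (g j) y)) * indicator U (?c y))"
        using e(2) by (auto simp: indicator_def)
    qed
  qed simp
  also have "\<dots> = (\<integral>\<^sup>+x. indicator (?c ` W j) x * indicator U x \<partial>\<sigma>)"
    by (rule area_nn_integral_chart[OF ch, symmetric]) (use U in simp)
  also have "\<dots> = emeasure \<sigma> (?c ` W j \<inter> U)"
  proof -
    have "?c ` W j \<inter> U \<in> sets \<sigma>" using graph_chart_image_borel[OF ch] U by simp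
    moreover have "indicator (?c ` W j) x * indicator U x = (indicator (?c ` W j \<inter> U) x :: ennreal)" for x
      by (auto simp: indicator_def)
    ultimately show ?thesis by simp
  qed
  also have "\<dots> \<le> emeasure \<sigma> (frontier \<Omega> \<inter> U)"
    by (intro emeasure_mono) (use j U in \<open>auto intro: subsetD[OF equalityD2[OF c(2)]] borel_open\<close>)
  finally show ?thesis .
qed

text \<open>The ratio of the hyperbolic to the Euclidean area element, as computed for graphs,
  written without reference to a chart.\<close>

definition hyp_weight where
  "hyp_weight x = sqrt (1 + (x \<bullet> N x)\<^sup>2) / sqrt (1 + x \<bullet> x)"

lemma hyp_weight_continuous: "continuous_on (frontier \<Omega>) hyp_weight"
proof -
  have "sqrt (1 + x \<bullet> x) \<noteq> 0" for x :: "real^('n option)" using one_plus_inner_pos[of x] by simp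
  then show ?thesis unfolding hyp_weight_def by (intro continuous_intros continuous_normal) auto
qed

lemma riem_area_hyp_metric:
  "riem_area hyp_metric (frontier \<Omega>) = density \<sigma> (\<lambda>x. ennreal (indicator (frontier \<Omega>) x * hyp_weight x))"
proof -
  obtain k T W a b g where gc: "graph_cover k T W a b g" by (rule graph_cover_exists)
  note c = graph_coverD[OF gc] and cc = graph_coverD(3)[OF gc]
  interpret chart_cover "frontier \<Omega>" k W "\<lambda>j z. T j (z, g j z)" "\<lambda>j x. fst (inv (T j) x)" by (rule cc)
  have [measurable]: "(\<lambda>x. indicator (frontier \<Omega>) x * hyp_weight x) \<in> borel_measurable borel"
    using borel_measurable_on_frontier[OF hyp_weight_continuous] by simp
  let ?h = "riem_area hyp_metric (frontier \<Omega>)"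
  have h: "is_riem_area hyp_metric (frontier \<Omega>) ?h" by (rule is_riem_area[OF metric_form_hyp_metric])
  show ?thesis
  proof (rule measure_eq_on_charts)
    show "sets ?h = sets borel" "emeasure ?h (- frontier \<Omega>) = 0"
      using h unfolding is_riem_area_def by blast+
    show "sets (density \<sigma> (\<lambda>x. ennreal (indicator (frontier \<Omega>) x * hyp_weight x))) = sets borel" by simp
    have "emeasure (density \<sigma> (\<lambda>x. ennreal (indicator (frontier \<Omega>) x * hyp_weight x))) (- frontier \<Omega>) =
       (\<integral>\<^sup>+x. ennreal (indicator (frontier \<Omega>) x * hyp_weight x) * indicator (- frontier \<Omega>) x \<partial>\<sigma>)"
      by (rule emeasure_density) auto
    also have "\<dots> = (\<integral>\<^sup>+x. 0 \<partial>\<sigma>)" by (intro nn_integral_cong) (auto simp: indicator_def)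
    finally show "emeasure (density \<sigma> (\<lambda>x. ennreal (indicator (frontier \<Omega>) x * hyp_weight x))) (- frontier \<Omega>) = 0"
      by simp
    fix j A assume j: "j < k" and A[measurable]: "A \<in> sets borel" and sub: "A \<subseteq> (\<lambda>z. T j (z, g j z)) ` W j"
    note ch = c(1)[OF j]
    let ?c = "\<lambda>z. T j (z, g j z)" and ?w = "\<lambda>x. ennreal (indicator (frontier \<Omega>) x * hyp_weight x) * indicator A x"
    have T: "frame (T j)" and nor: "\<And>z. z \<in> W j \<Longrightarrow> N (?c z) = T j (- grad (g j) z, 1) /\<^sub>R sqrt (1 + grad (g j) z \<bullet> grad (g j) z)"
      using ch unfolding graph_chart_def by blast+
    have cS: "?c z \<in> frontier \<Omega>" if "z \<in> W j" for z using cover j that by auto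
    have "emeasure ?h A = (\<integral>\<^sup>+z. ennreal (riem_density hyp_metric ?c z) * indicator {z\<in>W j. ?c z \<in> A} z \<partial>lborel)"
      by (rule emeasure_area_chart[OF metric_form_hyp_metric ch A sub])
    also have "\<dots> = (\<integral>\<^sup>+z. indicator (W j) z * (ennreal (sqrt (1 + grad (g j) z \<bullet> grad (g j) z)) * ?w (?c z)) \<partial>lborel)"
    proof (intro nn_integral_cong)
      fix z :: "real^('n::{finite,wellorder})"
      show "ennreal (riem_density hyp_metric ?c z) * indicator {z\<in>W j. ?c z \<in> A} z =
        indicator (W j) z * (ennreal (sqrt (1 + grad (g j) z \<bullet> grad (g j) z)) * ?w (?c z))"
      proof (cases "z \<in> W j")
        case True
        have "riem_density hyp_metric ?c z = sqrt (1 + grad (g j) z \<bullet> grad (g j) z) * hyp_weight (?c z)"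
          using riem_density_graph_hyp_metric[OF T graph_chart_has_derivative[OF ch True]]
          unfolding hyp_weight_def nor[OF True] by simp
        then have "ennreal (riem_density hyp_metric ?c z) =
            ennreal (sqrt (1 + grad (g j) z \<bullet> grad (g j) z)) * ennreal (hyp_weight (?c z))"
          by (simp only: ennreal_mult' real_sqrt_ge_zero one_plus_inner_pos less_imp_le)
        then show ?thesis using True cS[OF True] by (simp add: indicator_def)
      qed auto
    qed
    also have "\<dots> = (\<integral>\<^sup>+x. indicator (?c ` W j) x * ?w x \<partial>\<sigma>)"
      by (rule area_nn_integral_chart[OF ch, symmetric]) measurable
    also have "\<dots> = (\<integral>\<^sup>+x. ?w x \<partial>\<sigma>)"
      using sub by (intro nn_integral_cong) (auto simp: indicator_def)
    also have "\<dots> = emeasure (density \<sigma> (\<lambda>x. ennreal (indicator (frontier \<Omega>) x * hyp_weight x))) A"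
      by (rule emeasure_density[symmetric]) auto
    finally show "emeasure ?h A = emeasure (density \<sigma> (\<lambda>x. ennreal (indicator (frontier \<Omega>) x * hyp_weight x))) A" .
  qed
qed

lemma frontier_null: "emeasure lborel (frontier \<Omega>) = 0"
proof -
  obtain k T W a b g where gc: "graph_cover k T W a b g" by (rule graph_cover_exists)
  note c = graph_coverD[OF gc]
  have "negligible ((\<lambda>z. T j (z, g j z)) ` W j)" if "j < k" for j
  proof (rule negligible_differentiable_image_lowdim)
    show "DIM(real^('n::{finite,wellorder})) < DIM(real^('n::{finite,wellorder} option))" by simp
    have T: "frame (T j)" using c(1)[OF that] by (simp add: graph_chart_def)
    show "(\<lambda>z. T j (z, g j z)) differentiable_on W j"
      using graph_has_derivative[OF T graph_chart_has_derivative[OF c(1)[OF that]]]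
      by (auto simp: differentiable_on_def differentiable_def intro: has_derivative_at_withinI)
  qed
  then have "negligible (frontier \<Omega>)" unfolding c(2) by (intro negligible_Union) auto
  then show ?thesis
    by (simp add: negligible_iff_null_sets null_sets_def)
qed

end

subsection \<open>Frames preserve Lebesgue measure\<close>

lemma std_frame_Basis: "bij_betw std_frame (Basis :: ((real^('n::finite)) \<times> real) set) Basis"
proof -
  have 1: "std_frame (axis j 1, 0) = axis (Some j) 1" for j :: 'n
    by (auto simp: std_frame_def vec_eq_iff axis_def split: option.split)
  have 2: "std_frame (0, 1) = (axis None 1 :: real^('n option))"
    by (auto simp: std_frame_def vec_eq_iff axis_def split: option.split)
  have B1: "(Basis :: (real^'n) set) = range (\<lambda>j. axis j 1)" by (auto simp: Basis_vec_def)
  have B2: "(Basis :: (real^('n option)) set) = range (\<lambda>j. axis j 1)" by (auto simp: Basis_vec_def)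
  have "std_frame ` (Basis :: ((real^'n) \<times> real) set) = std_frame ` ((\<lambda>j. (axis j 1, 0)) ` UNIV) \<union> {std_frame (0, 1)}"
    unfolding Basis_prod_def B1 by auto
  also have "\<dots> = range (\<lambda>j. axis (Some j) 1) \<union> {axis None 1}"
    unfolding image_image 1 2 ..
  also have "\<dots> = (\<lambda>i. axis i 1) ` (insert None (range Some))" by auto
  also have "\<dots> = Basis" unfolding B2 UNIV_option_conv ..
  finally show ?thesis
    unfolding bij_betw_def using inj_on_subset[OF frame_inj[OF std_frame]] by blast
qed

lemma frame_measurable: "frame T \<Longrightarrow> T \<in> borel_measurable borel"
  by (intro borel_measurable_continuous_onI linear_continuous_on frame_bounded_linear)

lemma std_frame_distr: "distr lborel borel (std_frame :: (real^('n::finite)) \<times> real \<Rightarrow> _) = lborel"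
proof (rule lborel_eqI[symmetric])
  let ?T = "std_frame :: (real^'n) \<times> real \<Rightarrow> _"
  show "sets (distr lborel borel ?T) = sets borel" by simp
  fix l u :: "real^('n option)"
  assume le: "\<And>b. b \<in> Basis \<Longrightarrow> l \<bullet> b \<le> u \<bullet> b"
  have inv: "inv ?T x \<bullet> b = x \<bullet> ?T b" for x b
    using frame_inner[OF std_frame, of "inv ?T x" b] by (simp add: std_frame)
  have TB: "?T b \<in> Basis" if "b \<in> Basis" for b using std_frame_Basis that by (rule bij_betw_apply)
  have "?T -` box l u = box (inv ?T l) (inv ?T u)"
  proof (rule set_eqI)
    fix p
    have "p \<in> ?T -` box l u \<longleftrightarrow> (\<forall>i\<in>?T ` Basis. l \<bullet> i < ?T p \<bullet> i \<and> ?T p \<bullet> i < u \<bullet> i)"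
      unfolding bij_betw_imp_surj_on[OF std_frame_Basis] by (simp add: mem_box)
    also have "\<dots> \<longleftrightarrow> (\<forall>b\<in>Basis. l \<bullet> ?T b < ?T p \<bullet> ?T b \<and> ?T p \<bullet> ?T b < u \<bullet> ?T b)"
      unfolding ball_simps ..
    also have "\<dots> \<longleftrightarrow> p \<in> box (inv ?T l) (inv ?T u)"
      unfolding mem_box inv frame_inner[OF std_frame] ..
    finally show "p \<in> ?T -` box l u \<longleftrightarrow> p \<in> box (inv ?T l) (inv ?T u)" .
  qed
  then have "emeasure (distr lborel borel ?T) (box l u) = emeasure lborel (box (inv ?T l) (inv ?T u))"
    using frame_measurable[OF std_frame] by (subst emeasure_distr) simp_all
  also have "\<dots> = (\<Prod>b\<in>Basis. (inv ?T u - inv ?T l) \<bullet> b)"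
    by (rule emeasure_lborel_box) (simp add: inv TB le)
  also have "(\<Prod>b\<in>Basis. (inv ?T u - inv ?T l) \<bullet> b) = (\<Prod>b\<in>Basis. (u - l) \<bullet> ?T b)"
    by (simp add: inner_diff_left inv)
  also have "\<dots> = (\<Prod>b\<in>Basis. (u - l) \<bullet> b)"
    by (rule prod.reindex_bij_betw[OF std_frame_Basis])
  finally show "emeasure (distr lborel borel ?T) (box l u) = (\<Prod>b\<in>Basis. (u - l) \<bullet> b)" .
qed

text \<open>\<open>T\<close> is the standard frame, which maps basis vectors to basis vectors,
  followed by an orthogonal map.\<close>

lemma frame_distr:
  fixes T :: "(real^('n::{finite,wellorder})) \<times> real \<Rightarrow> real^('n option)"
  assumes T: "frame T"
  shows "distr (lborel \<Otimes>\<^sub>M lborel) borel T = lborel"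
proof -
  let ?S = "std_frame :: (real^('n::{finite,wellorder})) \<times> real \<Rightarrow> _"
  define Q where "Q = T \<circ> inv ?S"
  have QS: "T = Q \<circ> ?S" by (auto simp: Q_def std_frame)
  have "orthogonal_transformation Q"
    unfolding orthogonal_transformation_def
  proof (intro conjI allI)
    show "linear Q" unfolding Q_def
      using frame_inv_bounded_linear[OF std_frame] frame_linear[OF T] by (intro linear_compose) (auto simp: linear_conv_bounded_linear)
    show "Q v \<bullet> Q w = v \<bullet> w" for v w
      using frame_inner[OF std_frame, of "inv ?S v" "inv ?S w"] by (simp add: Q_def frame_inner[OF T] std_frame)
  qed
  note Q = this
  have Qm: "Q \<in> borel_measurable borel"
    using orthogonal_transformation_linear[OF Q]
    by (intro borel_measurable_continuous_onI linear_continuous_on) (simp add: linear_conv_bounded_linear)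
  have "distr (lborel \<Otimes>\<^sub>M lborel) borel T = distr lborel borel (Q \<circ> ?S)"
    unfolding lborel_prod QS ..
  also have "\<dots> = distr (distr lborel borel ?S) borel Q"
    using Qm frame_measurable[OF std_frame] by (intro distr_distr[symmetric]) auto
  finally show ?thesis
    unfolding std_frame_distr orthogonal_transformation_distr_lborel[OF Q] .
qed

subsection \<open>Continuously differentiable functions\<close>

text \<open>Functions on the whole space, so that cut-offs can be multiplied freely. One continuous
  derivative is the order at which piecewise quadratic cut-offs and kernels are available.\<close>

definition C1 :: "('a::euclidean_space \<Rightarrow> real) \<Rightarrow> bool" where
  "C1 \<psi> \<longleftrightarrow> Ck_on (Suc 0) \<psi> UNIV"

lemma C1_has_derivative:
  assumes "C1 \<psi>"
  shows "(\<psi> has_derivative (\<lambda>v. grad \<psi> x \<bullet> v)) (at x)"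
proof -
  have *: "(\<psi> has_derivative frechet_derivative \<psi> (at x)) (at x)"
    using assms unfolding C1_def by (intro Ck_on_has_derivative[of 0 \<psi> UNIV]) auto
  then have "frechet_derivative \<psi> (at x) = (\<lambda>v. grad \<psi> x \<bullet> v)"
    by (intro ext grad_inner) (auto simp: differentiable_def)
  then show ?thesis using * by simp
qed

lemma grad_eqI:
  assumes "(f has_derivative (\<lambda>v. G \<bullet> v)) (at x)"
  shows "grad f x = G"
proof -
  have "frechet_derivative f (at x) = (\<lambda>v. G \<bullet> v)"
    using assms by (rule frechet_derivative_at[symmetric])
  then show ?thesis by (simp add: grad_def euclidean_representation)
qed

lemma C1I:
  assumes "\<And>x. (\<psi> has_derivative (\<lambda>v. G x \<bullet> v)) (at x)" "continuous_on UNIV G"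
  shows "C1 \<psi>"
  unfolding C1_def
proof (rule Ck_on_SucI'[OF open_UNIV assms(1) _ open_UNIV])
  show "Ck_on 0 (\<lambda>x. G x \<bullet> v) UNIV" for v
    using assms(2) by (auto intro!: continuous_intros)
qed

lemma C1_continuous:
  assumes "C1 \<psi>"
  shows "continuous_on A \<psi>" "continuous_on A (grad \<psi>)"
proof -
  have "continuous_on UNIV \<psi>"
    by (intro continuous_at_imp_continuous_on ballI has_derivative_continuous[OF C1_has_derivative[OF assms]])
  then show "continuous_on A \<psi>" by (rule continuous_on_subset) simp
  have "Ck_on 0 (\<lambda>x. \<Sum>b\<in>Basis. frechet_derivative \<psi> (at x) b *\<^sub>R b) UNIV"
    using assms unfolding C1_def by (intro Ck_on_grad) auto
  then have "continuous_on UNIV (grad \<psi>)" by (simp add: grad_def[abs_def])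
  then show "continuous_on A (grad \<psi>)" by (rule continuous_on_subset) simp
qed

lemma C1_mult:
  assumes "C1 f" "C1 g"
  shows "C1 (\<lambda>x. f x * g x)"
  using Ck_on_mult[OF open_UNIV] assms unfolding C1_def by blast

lemma grad_zero:
  assumes "\<forall>\<^sub>F y in nhds x. \<psi> y = 0"
  shows "grad \<psi> x = 0"
proof -
  obtain U where U: "open U" "x \<in> U" "\<And>y. y \<in> U \<Longrightarrow> \<psi> y = 0"
    using assms unfolding eventually_nhds by blast
  have "((\<lambda>_. 0) has_derivative (\<lambda>v. 0 \<bullet> v)) (at x)" by simp
  then have "(\<psi> has_derivative (\<lambda>v. 0 \<bullet> v)) (at x)"
    by (rule has_derivative_transform_within_open[OF _ U(1,2)]) (simp add: U(3))
  then show ?thesis by (rule grad_eqI)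
qed

text \<open>A cut-off whose derivative \<open>2 * max 0 t\<close> is continuous and explicit; the
  bump functions and the mollifying kernel are both built from it.\<close>

definition pos_square :: "real \<Rightarrow> real" where
  "pos_square t = (max 0 t)\<^sup>2"

lemma pos_square_DERIV: "(pos_square has_real_derivative 2 * max 0 t) (at t)"
proof -
  consider "t > 0" | "t < 0" | "t = 0" by linarith
  then show ?thesis
  proof cases
    case 1
    have "((\<lambda>t. t\<^sup>2) has_real_derivative 2 * max 0 t) (at t)"
      using 1 by (auto intro!: derivative_eq_intros)
    then show ?thesis
      by (rule has_field_derivative_transform_within_open[of _ _ _ "{0<..}"]) (use 1 in \<open>auto simp: pos_square_def\<close>)
  next
    case 2
    have "((\<lambda>t. 0) has_real_derivative 2 * max 0 t) (at t)"
      using 2 by auto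
    then show ?thesis
      by (rule has_field_derivative_transform_within_open[of _ _ _ "{..<0}"]) (use 2 in \<open>auto simp: pos_square_def\<close>)
  next
    case 3
    have "((\<lambda>h. (pos_square (0 + h) - pos_square 0) / h) \<longlongrightarrow> 0) (at 0)"
    proof (rule Lim_null_comparison)
      show "\<forall>\<^sub>F h in at 0. norm ((pos_square (0 + h) - pos_square 0) / h) \<le> \<bar>h\<bar>"
        by (intro always_eventually allI) (auto simp: pos_square_def max_def power2_eq_square)
      show "((\<lambda>h::real. \<bar>h\<bar>) \<longlongrightarrow> 0) (at 0)" by (rule tendsto_rabs_zero) (rule tendsto_ident_at)
    qed
    then show ?thesis using 3 by (simp add: DERIV_def)
  qed
qed

lemma C1_pos_square_compose:
  fixes f :: "'a::euclidean_space \<Rightarrow> real"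
  assumes "C1 f"
  shows "C1 (\<lambda>x. pos_square (f x))" "grad (\<lambda>x. pos_square (f x)) x = (2 * max 0 (f x)) *\<^sub>R grad f x"
proof -
  have d: "((\<lambda>x. pos_square (f x)) has_derivative (\<lambda>v. ((2 * max 0 (f x)) *\<^sub>R grad f x) \<bullet> v)) (at x)" for x
    using has_derivative_compose[OF C1_has_derivative[OF assms] pos_square_DERIV[unfolded has_field_derivative_def]]
    by (simp add: mult.assoc)
  show "grad (\<lambda>x. pos_square (f x)) x = (2 * max 0 (f x)) *\<^sub>R grad f x" using d by (rule grad_eqI)
  show "C1 (\<lambda>x. pos_square (f x))"
    by (rule C1I[OF d]) (intro continuous_intros C1_continuous assms)
qed

lemma C1_quadratic:
  fixes c :: "'a::euclidean_space"
  shows "C1 (\<lambda>x. A + B * ((x - c) \<bullet> (x - c)))" "grad (\<lambda>x. A + B * ((x - c) \<bullet> (x - c))) x = (2 * B) *\<^sub>R (x - c)"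
proof -
  have d: "((\<lambda>x. A + B * ((x - c) \<bullet> (x - c))) has_derivative (\<lambda>v. ((2 * B) *\<^sub>R (x - c)) \<bullet> v)) (at x)" for x
    by (rule derivative_eq_intros refl)+ (auto simp: fun_eq_iff inner_commute algebra_simps)
  show "grad (\<lambda>x. A + B * ((x - c) \<bullet> (x - c))) x = (2 * B) *\<^sub>R (x - c)" using d by (rule grad_eqI)
  show "C1 (\<lambda>x. A + B * ((x - c) \<bullet> (x - c)))"
    by (rule C1I[OF d]) (intro continuous_intros)
qed

lemma bump_exists:
  fixes c :: "'a::euclidean_space"
  assumes "r > 0"
  obtains \<eta> where "C1 \<eta>" "\<And>x. x \<in> ball c r \<Longrightarrow> \<eta> x = 1" "\<And>x. x \<notin> cball c (2 * r) \<Longrightarrow> \<eta> x = 0"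
proof -
  \<comment> \<open>Equal to \<open>((dist c x / r)\<^sup>2 - 1) / 3\<close>: nonpositive up to
    distance \<open>r\<close> and at least 1 from distance \<open>2 * r\<close> on.\<close>
  define f where "f x = - 1/3 + (1 / (3 * r\<^sup>2)) * ((x - c) \<bullet> (x - c))" for x
  define \<eta> where "\<eta> x = pos_square (1 + (- 1) * pos_square (f x))" for x
  have sq: "(x - c) \<bullet> (x - c) = (dist c x)\<^sup>2" for x
    by (simp add: dist_norm norm_minus_commute[of c x] power2_norm_eq_inner)
  have "C1 f" unfolding f_def by (rule C1_quadratic)
  then have C: "C1 (\<lambda>x. pos_square (f x))" by (rule C1_pos_square_compose)
  have "C1 (\<lambda>x. 1 + (- 1) * pos_square (f x))"
    using C unfolding C1_def by (intro Ck_on_add Ck_on_mult Ck_on_const open_UNIV)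
  then have "C1 \<eta>" unfolding \<eta>_def by (rule C1_pos_square_compose)
  moreover have "\<eta> x = 1" if "x \<in> ball c r" for x
  proof -
    have "(dist c x)\<^sup>2 \<le> r\<^sup>2" using that by (intro power_mono) auto
    then have "f x \<le> 0" using assms by (simp add: f_def sq field_simps)
    then show ?thesis by (simp add: \<eta>_def pos_square_def)
  qed
  moreover have "\<eta> x = 0" if "x \<notin> cball c (2 * r)" for x
  proof -
    have "(2 * r)\<^sup>2 \<le> (dist c x)\<^sup>2" using that assms by (intro power_mono) auto
    then have "f x \<ge> 1" using assms by (simp add: f_def sq field_simps)
    then have "pos_square (f x) \<ge> 1" by (simp add: pos_square_def)
    then show ?thesis by (simp add: \<eta>_def pos_square_def)
  qed
  ultimately show ?thesis by (rule that)
qed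

subsection \<open>The divergence theorem\<close>

lemma frame_ray_derivative:
  assumes "frame T" "C1 \<psi>"
  shows "((\<lambda>t. \<psi> (T (z, t))) has_real_derivative grad \<psi> (T (z, t)) \<bullet> T (0, 1)) (at t)"
proof -
  have "((\<lambda>t. (z, t)) has_derivative (\<lambda>s. (0, s))) (at t)"
    by (auto intro!: derivative_eq_intros)
  then have "((\<lambda>t. T (z, t)) has_derivative (\<lambda>s. T (0, s))) (at t)"
    by (rule bounded_linear.has_derivative[OF frame_bounded_linear[OF assms(1)]])
  from has_derivative_compose[OF this C1_has_derivative[OF assms(2)]]
  have *: "((\<lambda>t. \<psi> (T (z, t))) has_derivative (\<lambda>s. grad \<psi> (T (z, t)) \<bullet> T (0, s))) (at t)" .
  have "(\<lambda>s. grad \<psi> (T (z, t)) \<bullet> T (0, s)) = (*) (grad \<psi> (T (z, t)) \<bullet> T (0, 1))"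
  proof
    fix s
    have "T (0, s) = s *\<^sub>R T (0, 1)" using frame_scaleR[OF assms(1), of s "(0, 1)"] by simp
    then show "grad \<psi> (T (z, t)) \<bullet> T (0, s) = (grad \<psi> (T (z, t)) \<bullet> T (0, 1)) * s"
      by (simp only: inner_scaleR_right mult.commute)
  qed
  then show ?thesis using * by (simp add: has_field_derivative_def)
qed

lemma integral_frame_iterated:
  fixes T :: "(real^('n::{finite,wellorder})) \<times> real \<Rightarrow> real^('n option)" and F :: "real^('n::{finite,wellorder} option) \<Rightarrow> real"
  assumes T: "frame T" and F: "integrable lborel F"
  shows "(\<integral>x. F x \<partial>lborel) = (\<integral>z. (\<integral>t. F (T (z, t)) \<partial>lborel) \<partial>lborel)"
proof -
  have Tm: "T \<in> measurable (lborel \<Otimes>\<^sub>M lborel) borel"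
    using frame_measurable[OF T] unfolding lborel_prod by simp
  have Fm: "F \<in> borel_measurable borel" using F by (simp add: borel_measurable_integrable)
  have "(\<integral>x. F x \<partial>lborel) = (\<integral>x. F x \<partial>distr (lborel \<Otimes>\<^sub>M lborel) borel T)"
    by (simp only: frame_distr[OF T])
  also have "\<dots> = (\<integral>p. F (T p) \<partial>(lborel \<Otimes>\<^sub>M lborel))" by (rule integral_distr[OF Tm Fm])
  also have "\<dots> = (\<integral>z. (\<integral>t. F (T (z, t)) \<partial>lborel) \<partial>lborel)"
  proof (rule lborel_pair.integral_fst'[symmetric])
    have "integrable (distr (lborel \<Otimes>\<^sub>M lborel) borel T) F" using F by (simp only: frame_distr[OF T])
    then show "integrable (lborel \<Otimes>\<^sub>M lborel) (\<lambda>p. F (T p))"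
      using integrable_distr_eq[OF Tm Fm] by simp
  qed
  finally show ?thesis .
qed

lemma integral_DERIV_vanishing:
  fixes h :: "real \<Rightarrow> real"
  assumes h: "\<And>t. (h has_real_derivative h' t) (at t)" "continuous_on UNIV h'"
    and van: "\<And>t. t \<notin> {a<..<b} \<Longrightarrow> h t = 0 \<and> h' t = 0" and c: "a \<le> c" "c \<le> b"
  shows "(\<integral>t. indicator {..c} t * h' t \<partial>lborel) = h c"
proof -
  have "(\<integral>t. indicator {..c} t * h' t \<partial>lborel) = (\<integral>t. h' t * indicator {a..c} t \<partial>lborel)"
    using van by (intro Bochner_Integration.integral_cong) (auto simp: indicator_def)
  also have "\<dots> = h c - h a"
    using h c by (intro integral_FTC_Icc_real) (auto intro: continuous_on_subset continuous_at_imp_continuous_on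
        simp: continuous_on_eq_continuous_at)
  finally show ?thesis using van[of a] by simp
qed

context smooth_domain
begin

lemma integrable_on_domain:
  fixes F :: "real^('n option) \<Rightarrow> 'b::{banach, second_countable_topology}"
  assumes "continuous_on \<Omega> F"
  shows "integrable lborel (\<lambda>x. indicator \<Omega> x *\<^sub>R F x)"
  using borel_integrable_compact[OF compact_domain assms] .

text \<open>The vector form: its component along \<open>e\<close> is the divergence theorem for the
  field \<open>\<psi> x *\<^sub>R e\<close>. Both sides are linear in \<open>\<psi>\<close>, which
  is what makes the statement local.\<close>

definition divergence_thm where
  "divergence_thm \<psi> \<longleftrightarrow>
     (\<integral>x. indicator \<Omega> x *\<^sub>R grad \<psi> x \<partial>lborel) = (\<integral>x. indicator (frontier \<Omega>) x *\<^sub>R (\<psi> x *\<^sub>R N x) \<partial>\<sigma>)"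

lemma C1_integrable:
  assumes "C1 \<psi>"
  shows "integrable lborel (\<lambda>x. indicator \<Omega> x *\<^sub>R grad \<psi> x)"
    "integrable \<sigma> (\<lambda>x. indicator (frontier \<Omega>) x *\<^sub>R (\<psi> x *\<^sub>R N x))"
    "integrable lborel (\<lambda>x. indicator \<Omega> x * (grad \<psi> x \<bullet> e))"
proof -
  show 1: "integrable lborel (\<lambda>x. indicator \<Omega> x *\<^sub>R grad \<psi> x)"
    by (intro integrable_on_domain C1_continuous assms)
  show "integrable \<sigma> (\<lambda>x. indicator (frontier \<Omega>) x *\<^sub>R (\<psi> x *\<^sub>R N x))"
  proof -
    have "continuous_on (frontier \<Omega>) (\<lambda>x. \<psi> x *\<^sub>R N x)"
      by (intro continuous_intros continuous_normal C1_continuous assms)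
    from integrable_on_frontier[OF this] show ?thesis unfolding set_integrable_def .
  qed
  show "integrable lborel (\<lambda>x. indicator \<Omega> x * (grad \<psi> x \<bullet> e))"
    using 1 integrable_inner_left[of e lborel "\<lambda>x. indicator \<Omega> x *\<^sub>R grad \<psi> x"] by simp
qed

lemma divergence_components:
  assumes "C1 \<psi>"
  shows "(\<integral>x. indicator \<Omega> x *\<^sub>R grad \<psi> x \<partial>lborel) \<bullet> e = (\<integral>x. indicator \<Omega> x * (grad \<psi> x \<bullet> e) \<partial>lborel)"
    "(\<integral>x. indicator (frontier \<Omega>) x *\<^sub>R (\<psi> x *\<^sub>R N x) \<partial>\<sigma>) \<bullet> e = (\<integral>x. indicator (frontier \<Omega>) x * (\<psi> x * (N x \<bullet> e)) \<partial>\<sigma>)"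
  using integral_inner_left[OF C1_integrable(1)[OF assms], of e]
    integral_inner_left[OF C1_integrable(2)[OF assms], of e] by (simp_all add: mult.assoc)

text \<open>On a vertical line the fundamental theorem of calculus leaves the value of
  \<open>\<psi>\<close> at the graph, since \<open>\<psi>\<close> vanishes at the lower end of the
  box. This is a boundary integral because \<open>sqrt (1 + grad g z \<bullet> grad g z)\<close>
  times the vertical component of the normal is 1.\<close>

lemma divergence_chart:
  assumes ch: "graph_chart \<Omega> T W a b g" and \<psi>: "C1 \<psi>" and K: "closed K" "K \<subseteq> T ` (W \<times> {a<..<b})"
    and supp: "\<And>x. x \<notin> K \<Longrightarrow> \<psi> x = 0"
  shows "(\<integral>x. indicator \<Omega> x * (grad \<psi> x \<bullet> T (0, 1)) \<partial>lborel) =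
         (\<integral>x. indicator (frontier \<Omega>) x * (\<psi> x * (N x \<bullet> T (0, 1))) \<partial>\<sigma>)"
proof -
  have T: "frame T" and gb: "\<And>z. z \<in> W \<Longrightarrow> a < g z \<and> g z < b"
    and mem: "\<And>z t. z \<in> W \<Longrightarrow> a < t \<Longrightarrow> t < b \<Longrightarrow> T (z, t) \<in> \<Omega> \<longleftrightarrow> t \<le> g z"
    and nor: "\<And>z. z \<in> W \<Longrightarrow> N (T (z, g z)) = T (- grad g z, 1) /\<^sub>R sqrt (1 + grad g z \<bullet> grad g z)"
    using ch unfolding graph_chart_def by blast+
  have van: "\<psi> x = 0 \<and> grad \<psi> x = 0" if "x \<notin> K" for x
  proof -
    have "\<forall>\<^sub>F y in nhds x. \<psi> y = 0"
      using K(1) that supp by (intro eventually_nhds_in_open[of "- K" x, THEN eventually_mono]) auto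
    then show ?thesis using grad_zero supp[OF that] by blast
  qed
  have notK: "T (z, t) \<notin> K" if "z \<notin> W \<or> t \<notin> {a<..<b}" for z t
  proof
    assume "T (z, t) \<in> K"
    then obtain p where p: "p \<in> W \<times> {a<..<b}" "T (z, t) = T p" using K(2) by blast
    then have "(z, t) = p" using injD[OF frame_inj[OF T]] by blast
    then show False using p that by blast
  qed
  have inner: "(\<integral>t. indicator \<Omega> (T (z, t)) * (grad \<psi> (T (z, t)) \<bullet> T (0, 1)) \<partial>lborel) = indicator W z * \<psi> (T (z, g z))" for z
  proof (cases "z \<in> W")
    case False
    then have "(\<lambda>t. indicator \<Omega> (T (z, t)) * (grad \<psi> (T (z, t)) \<bullet> T (0, 1))) = (\<lambda>t. 0)"
      using van notK by auto
    then show ?thesis using False by simp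
  next
    case True
    let ?h = "\<lambda>t. \<psi> (T (z, t))" and ?h' = "\<lambda>t. grad \<psi> (T (z, t)) \<bullet> T (0, 1)"
    have v: "?h t = 0 \<and> ?h' t = 0" if "t \<notin> {a<..<b}" for t
      using van[OF notK[of z t]] that by simp
    have "indicator \<Omega> (T (z, t)) * ?h' t = indicator {..g z} t * ?h' t" for t
      using mem[OF True, of t] v[of t] by (cases "t \<in> {a<..<b}") (auto simp: indicator_def)
    then have "(\<integral>t. indicator \<Omega> (T (z, t)) * ?h' t \<partial>lborel) = (\<integral>t. indicator {..g z} t * ?h' t \<partial>lborel)"
      by (simp only:)
    also have "\<dots> = ?h (g z)"
    proof (rule integral_DERIV_vanishing[OF frame_ray_derivative[OF T \<psi>] _ v])
      show "continuous_on UNIV ?h'"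
        by (intro continuous_intros continuous_on_compose2[OF C1_continuous(2)[OF \<psi>, of UNIV]]
            continuous_on_compose2[OF linear_continuous_on[OF frame_bounded_linear[OF T], of UNIV]]) auto
    qed (use gb[OF True] in auto)
    finally show ?thesis using True by simp
  qed
  have "(\<integral>x. indicator \<Omega> x * (grad \<psi> x \<bullet> T (0, 1)) \<partial>lborel) = (\<integral>z. indicator W z * \<psi> (T (z, g z)) \<partial>lborel)"
    using integral_frame_iterated[OF T C1_integrable(3)[OF \<psi>, of "T (0, 1)"]] unfolding inner .
  also have "\<dots> = (\<integral>z. indicator W z * (sqrt (1 + grad g z \<bullet> grad g z) *
      (indicator (frontier \<Omega>) (T (z, g z)) * (\<psi> (T (z, g z)) * (N (T (z, g z)) \<bullet> T (0, 1))))) \<partial>lborel)"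
  proof (intro Bochner_Integration.integral_cong refl)
    fix z
    show "indicator W z * \<psi> (T (z, g z)) = indicator W z * (sqrt (1 + grad g z \<bullet> grad g z) *
      (indicator (frontier \<Omega>) (T (z, g z)) * (\<psi> (T (z, g z)) * (N (T (z, g z)) \<bullet> T (0, 1)))))"
    proof (cases "z \<in> W")
      case True
      have "T (z, g z) \<in> frontier \<Omega>" using graph_chart_image_eq[OF ch] True by blast
      moreover have "sqrt (1 + grad g z \<bullet> grad g z) * (N (T (z, g z)) \<bullet> T (0, 1)) = 1"
        using one_plus_inner_pos[of "grad g z"] by (simp add: nor[OF True] frame_inner[OF T])
      ultimately show ?thesis by (simp add: mult.left_commute)
    qed simp
  qed
  also have "\<dots> = (\<integral>x. indicator ((\<lambda>z. T (z, g z)) ` W) x * (indicator (frontier \<Omega>) x * (\<psi> x * (N x \<bullet> T (0, 1)))) \<partial>\<sigma>)"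
  proof (rule area_integral_chart[OF ch, symmetric])
    have "continuous_on (frontier \<Omega>) (\<lambda>x. \<psi> x * (N x \<bullet> T (0, 1)))"
      by (intro continuous_intros C1_continuous \<psi> continuous_normal)
    from borel_measurable_on_frontier[OF this]
    show "(\<lambda>x. indicator (frontier \<Omega>) x * (\<psi> x * (N x \<bullet> T (0, 1)))) \<in> borel_measurable borel" by simp
  qed
  also have "\<dots> = (\<integral>x. indicator (frontier \<Omega>) x * (\<psi> x * (N x \<bullet> T (0, 1))) \<partial>\<sigma>)"
  proof (intro Bochner_Integration.integral_cong refl)
    fix x
    have "x \<in> (\<lambda>z. T (z, g z)) ` W \<or> x \<notin> frontier \<Omega> \<or> \<psi> x = 0"
      using graph_chart_image_eq[OF ch] supp K(2) by blast
    then show "indicator ((\<lambda>z. T (z, g z)) ` W) x * (indicator (frontier \<Omega>) x * (\<psi> x * (N x \<bullet> T (0, 1)))) =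
        indicator (frontier \<Omega>) x * (\<psi> x * (N x \<bullet> T (0, 1)))"
      by (auto simp: indicator_def)
  qed
  finally show ?thesis .
qed

text \<open>With the support in the interior both sides are 0: a directional derivative integrates
  to 0 along every line in its direction.\<close>

lemma divergence_vanishing:
  assumes \<psi>: "C1 \<psi>" and K: "compact K" "\<And>x. x \<notin> K \<Longrightarrow> \<psi> x = 0" and sub: "K \<subseteq> interior \<Omega>"
  shows "divergence_thm \<psi>"
proof -
  have van: "\<psi> x = 0 \<and> grad \<psi> x = 0" if "x \<notin> K" for x
  proof -
    have "\<forall>\<^sub>F y in nhds x. \<psi> y = 0"
      using compact_imp_closed[OF K(1)] that K(2) by (intro eventually_nhds_in_open[of "- K" x, THEN eventually_mono]) auto
    then show ?thesis using grad_zero K(2)[OF that] by blast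
  qed
  have "(\<integral>x. indicator \<Omega> x *\<^sub>R grad \<psi> x \<partial>lborel) = 0"
  proof (rule euclidean_eqI)
    fix e :: "real^('n::{finite,wellorder} option)" assume "e \<in> Basis"
    then have "norm e = 1" by simp
    then obtain T :: "(real^('n::{finite,wellorder})) \<times> real \<Rightarrow> real^('n::{finite,wellorder} option)"
      where T: "frame T" "T (0, 1) = e" by (rule frame_exists)
    obtain M where M: "\<And>x. x \<in> K \<Longrightarrow> norm x < M" "M > 0"
      using compact_imp_bounded[OF K(1)] unfolding bounded_pos_less by blast
    have "(\<integral>t. indicator \<Omega> (T (z, t)) * (grad \<psi> (T (z, t)) \<bullet> e) \<partial>lborel) = 0" for z
    proof -
      let ?h = "\<lambda>t. \<psi> (T (z, t))" and ?h' = "\<lambda>t. grad \<psi> (T (z, t)) \<bullet> T (0, 1)"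
      have v: "?h t = 0 \<and> ?h' t = 0" if "t \<notin> {-M<..<M}" for t
      proof -
        have "norm (T (z, t)) \<ge> \<bar>t\<bar>"
          unfolding frame_norm[OF T(1)] using norm_snd_le[of t z] by simp
        then have "T (z, t) \<notin> K" using M(1)[of "T (z, t)"] that by auto
        then show ?thesis using van by simp
      qed
      have "indicator \<Omega> (T (z, t)) * ?h' t = indicator {..M} t * ?h' t" for t
      proof (cases "T (z, t) \<in> K")
        case True
        then have "T (z, t) \<in> \<Omega>" using sub interior_subset by blast
        then show ?thesis using v[of t] by (cases "t \<in> {-M<..<M}") (auto simp: indicator_def)
      qed (use van in auto)
      then have "(\<integral>t. indicator \<Omega> (T (z, t)) * ?h' t \<partial>lborel) = (\<integral>t. indicator {..M} t * ?h' t \<partial>lborel)"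
        by (simp only:)
      also have "\<dots> = ?h M"
      proof (rule integral_DERIV_vanishing[OF frame_ray_derivative[OF T(1) \<psi>] _ v])
        show "continuous_on UNIV ?h'"
          by (intro continuous_intros continuous_on_compose2[OF C1_continuous(2)[OF \<psi>, of UNIV]]
              continuous_on_compose2[OF linear_continuous_on[OF frame_bounded_linear[OF T(1)], of UNIV]]) auto
      qed (use M(2) in auto)
      also have "\<dots> = 0" using v[of M] by simp
      finally show ?thesis unfolding T(2) .
    qed
    then have "(\<integral>x. indicator \<Omega> x * (grad \<psi> x \<bullet> e) \<partial>lborel) = 0"
      using integral_frame_iterated[OF T(1) C1_integrable(3)[OF \<psi>, of e]] by simp
    then show "(\<integral>x. indicator \<Omega> x *\<^sub>R grad \<psi> x \<partial>lborel) \<bullet> e = 0 \<bullet> e"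
      unfolding divergence_components(1)[OF \<psi>] by simp
  qed
  moreover have "indicator (frontier \<Omega>) x *\<^sub>R (\<psi> x *\<^sub>R N x) = 0" for x
  proof -
    have "x \<notin> frontier \<Omega> \<or> x \<notin> K" using sub by (auto simp: frontier_def)
    then show ?thesis using van by auto
  qed
  ultimately show ?thesis
    unfolding divergence_thm_def by (simp only: Bochner_Integration.integral_zero)
qed

text \<open>A chart gives the identity only in its vertical direction, so the boxes of several
  charts around \<open>x\<close> are intersected. The directions \<open>N x\<close> and
  \<open>N x + (1/2) *\<^sub>R b\<close>, for \<open>b\<close> in the basis, all have a product of
  at least 1/2 with \<open>N x\<close>, and subtracting the first identity from the others yields
  every component.\<close>

lemma divergence_near_frontier:
  assumes x: "x \<in> frontier \<Omega>"
  obtains V where "open V" "x \<in> V"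
    "\<And>\<psi> K. C1 \<psi> \<Longrightarrow> closed K \<Longrightarrow> K \<subseteq> V \<Longrightarrow> (\<And>y. y \<notin> K \<Longrightarrow> \<psi> y = 0) \<Longrightarrow> divergence_thm \<psi>"
proof -
  define P where "P e V \<longleftrightarrow> open V \<and> x \<in> V \<and> (\<forall>\<psi> K. C1 \<psi> \<longrightarrow> closed K \<longrightarrow> K \<subseteq> V \<longrightarrow> (\<forall>y. y \<notin> K \<longrightarrow> \<psi> y = 0) \<longrightarrow>
     (\<integral>x. indicator \<Omega> x *\<^sub>R grad \<psi> x \<partial>lborel) \<bullet> e = (\<integral>x. indicator (frontier \<Omega>) x *\<^sub>R (\<psi> x *\<^sub>R N x) \<partial>\<sigma>) \<bullet> e)" for e V
  have n1: "norm (N x) = 1" by (rule norm_normal[OF x])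
  have ex: "\<exists>V. P e V" if e: "N x \<bullet> e > 0" for e
  proof -
    have e0: "norm e > 0" using e by auto
    have "norm (e /\<^sub>R norm e) = 1" using e0 by simp
    then obtain T :: "(real^('n::{finite,wellorder})) \<times> real \<Rightarrow> real^('n::{finite,wellorder} option)"
      where T: "frame T" "T (0, 1) = e /\<^sub>R norm e" by (rule frame_exists)
    have "N x \<bullet> T (0, 1) > 0" using e e0 by (simp add: T(2))
    then obtain W a b g where ch: "graph_chart \<Omega> T W a b g" "x \<in> T ` (W \<times> {a<..<b})"
      by (rule graph_chart_exists[OF dom x T(1)])
    have "P e (T ` (W \<times> {a<..<b}))"
      unfolding P_def
    proof (intro conjI allI impI)
      show "open (T ` (W \<times> {a<..<b}))"
        using ch(1) T(1) by (intro frame_open_image open_Times) (auto simp: graph_chart_def)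
      fix \<psi> K assume \<psi>: "C1 \<psi>" and K: "closed K" "K \<subseteq> T ` (W \<times> {a<..<b})" and s: "\<forall>y. y \<notin> K \<longrightarrow> \<psi> y = 0"
      have "(\<integral>x. indicator \<Omega> x *\<^sub>R grad \<psi> x \<partial>lborel) \<bullet> T (0, 1) = (\<integral>x. indicator (frontier \<Omega>) x *\<^sub>R (\<psi> x *\<^sub>R N x) \<partial>\<sigma>) \<bullet> T (0, 1)"
        unfolding divergence_components[OF \<psi>] by (rule divergence_chart[OF ch(1) \<psi> K]) (use s in blast)
      then show "(\<integral>x. indicator \<Omega> x *\<^sub>R grad \<psi> x \<partial>lborel) \<bullet> e = (\<integral>x. indicator (frontier \<Omega>) x *\<^sub>R (\<psi> x *\<^sub>R N x) \<partial>\<sigma>) \<bullet> e"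
        unfolding T(2) using e0 by simp
    qed (rule ch(2))
    then show ?thesis by blast
  qed
  have nn: "N x \<bullet> N x = 1" using n1 by (simp add: dot_square_norm)
  obtain V0 where V0: "P (N x) V0" using ex[of "N x"] nn by auto
  have "\<exists>V. P (N x + (1/2) *\<^sub>R b) V" if b: "b \<in> Basis" for b
  proof (rule ex)
    have "\<bar>N x \<bullet> b\<bar> \<le> norm (N x) * norm b" by (rule Cauchy_Schwarz_ineq2)
    then have "\<bar>N x \<bullet> b\<bar> \<le> 1" using b n1 by simp
    then show "N x \<bullet> (N x + (1/2) *\<^sub>R b) > 0" using nn by (simp add: inner_add_right)
  qed
  then have "\<forall>b\<in>Basis. \<exists>V. P (N x + (1/2) *\<^sub>R b) V" by blast
  from bchoice[OF this] obtain Vb where Vb: "\<forall>b\<in>Basis. P (N x + (1/2) *\<^sub>R b) (Vb b)" ..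
  show ?thesis
  proof (rule that[of "V0 \<inter> (\<Inter>b\<in>Basis. Vb b)"])
    show "open (V0 \<inter> (\<Inter>b\<in>Basis. Vb b))"
      using V0 Vb by (intro open_Int open_INT) (auto simp: P_def)
    show "x \<in> V0 \<inter> (\<Inter>b\<in>Basis. Vb b)" using V0 Vb by (auto simp: P_def)
    fix \<psi> K assume \<psi>: "C1 \<psi>" and K: "closed K" "K \<subseteq> V0 \<inter> (\<Inter>b\<in>Basis. Vb b)" and s: "\<And>y. y \<notin> K \<Longrightarrow> \<psi> y = 0"
    let ?v = "\<integral>x. indicator \<Omega> x *\<^sub>R grad \<psi> x \<partial>lborel" and ?w = "\<integral>x. indicator (frontier \<Omega>) x *\<^sub>R (\<psi> x *\<^sub>R N x) \<partial>\<sigma>"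
    have 0: "?v \<bullet> N x = ?w \<bullet> N x"
      using V0 \<psi> K s unfolding P_def by blast
    show "divergence_thm \<psi>" unfolding divergence_thm_def
    proof (rule euclidean_eqI)
      fix b :: "real^('n::{finite,wellorder} option)" assume b: "b \<in> Basis"
      have "P (N x + (1/2) *\<^sub>R b) (Vb b)" using Vb b by blast
      moreover have "K \<subseteq> Vb b" using K(2) b by blast
      ultimately have "?v \<bullet> (N x + (1/2) *\<^sub>R b) = ?w \<bullet> (N x + (1/2) *\<^sub>R b)"
        using \<psi> K(1) s unfolding P_def by blast
      then show "?v \<bullet> b = ?w \<bullet> b" using 0 by (simp add: inner_add_right)
    qed
  qed
qed

text \<open>The radius \<open>2 * r\<close> anticipates \<open>bump_exists\<close>, whose functions
  are 1 on the ball of radius \<open>r\<close> and 0 outside the doubled one.\<close>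

lemma divergence_near:
  obtains r where "r > 0"
    "\<And>\<psi>. C1 \<psi> \<Longrightarrow> (\<And>y. y \<notin> cball x (2 * r) \<Longrightarrow> \<psi> y = 0) \<Longrightarrow> divergence_thm \<psi>"
proof -
  have "\<exists>V. open V \<and> x \<in> V \<and> (\<forall>\<psi> K. C1 \<psi> \<longrightarrow> compact K \<longrightarrow> K \<subseteq> V \<longrightarrow> (\<forall>y. y \<notin> K \<longrightarrow> \<psi> y = 0) \<longrightarrow> divergence_thm \<psi>)"
  proof -
    consider "x \<in> frontier \<Omega>" | "x \<in> interior \<Omega>" | "x \<notin> \<Omega>"
      using closure_subset[of \<Omega>] by (auto simp: frontier_def)
    then show ?thesis
    proof cases
      case 1
      show ?thesis
        by (rule divergence_near_frontier[OF 1]) (blast intro: compact_imp_closed)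
    next
      case 2
      then show ?thesis using divergence_vanishing by (intro exI[of _ "interior \<Omega>"]) blast
    next
      case 3
      have "divergence_thm \<psi>" if "compact K" "K \<subseteq> - \<Omega>" "\<forall>y. y \<notin> K \<longrightarrow> \<psi> y = 0" for \<psi> K
      proof -
        have "grad \<psi> y = 0" if "y \<in> \<Omega>" for y
        proof (rule grad_zero)
          have "y \<in> - K" using that \<open>K \<subseteq> - \<Omega>\<close> by blast
          then show "\<forall>\<^sub>F y in nhds y. \<psi> y = 0"
            using compact_imp_closed[OF \<open>compact K\<close>] \<open>\<forall>y. y \<notin> K \<longrightarrow> \<psi> y = 0\<close>
            by (intro eventually_nhds_in_open[of "- K" y, THEN eventually_mono]) auto
        qed
        moreover have "\<psi> y = 0" if "y \<in> frontier \<Omega>" for y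
          using that frontier_subset \<open>K \<subseteq> - \<Omega>\<close> \<open>\<forall>y. y \<notin> K \<longrightarrow> \<psi> y = 0\<close> by blast
        ultimately have "(\<lambda>x. indicator \<Omega> x *\<^sub>R grad \<psi> x) = (\<lambda>_. 0)" "(\<lambda>x. indicator (frontier \<Omega>) x *\<^sub>R (\<psi> x *\<^sub>R N x)) = (\<lambda>_. 0)"
          by (auto simp: fun_eq_iff indicator_eq_0_iff)
        then show ?thesis unfolding divergence_thm_def by simp
      qed
      then show ?thesis
        using 3 compact_imp_closed[OF compact_domain] by (intro exI[of _ "- \<Omega>"]) blast
    qed
  qed
  then obtain V where V: "open V" "x \<in> V"
    "\<And>\<psi> K. C1 \<psi> \<Longrightarrow> compact K \<Longrightarrow> K \<subseteq> V \<Longrightarrow> \<forall>y. y \<notin> K \<longrightarrow> \<psi> y = 0 \<Longrightarrow> divergence_thm \<psi>" by blast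
  then obtain e where e: "e > 0" "cball x e \<subseteq> V" using open_contains_cball by blast
  show ?thesis
  proof (rule that[of "e / 2"])
    show "e / 2 > 0" using e by simp
    fix \<psi> assume "C1 \<psi>" "\<And>y. y \<notin> cball x (2 * (e / 2)) \<Longrightarrow> \<psi> y = 0"
    then show "divergence_thm \<psi>" using e by (intro V(3)[of \<psi> "cball x e"]) auto
  qed
qed

lemma divergence_add:
  assumes "C1 \<psi>" "C1 \<phi>" "divergence_thm \<psi>" "divergence_thm \<phi>"
  shows "divergence_thm (\<lambda>x. \<psi> x + \<phi> x)"
proof -
  have g: "grad (\<lambda>x. \<psi> x + \<phi> x) x = grad \<psi> x + grad \<phi> x" for x
  proof (rule grad_eqI)
    show "((\<lambda>x. \<psi> x + \<phi> x) has_derivative (\<lambda>v. (grad \<psi> x + grad \<phi> x) \<bullet> v)) (at x)"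
      using has_derivative_add[OF C1_has_derivative[OF assms(1)] C1_has_derivative[OF assms(2)]]
      by (simp add: inner_add_left)
  qed
  show ?thesis
    using assms(3,4) C1_integrable[OF assms(1)] C1_integrable[OF assms(2)]
    unfolding divergence_thm_def g scaleR_add_left scaleR_add_right by simp
qed

theorem divergence:
  assumes "C1 \<psi>"
  shows "divergence_thm \<psi>"
proof -
  have "\<forall>x. \<exists>r>0. \<forall>\<psi>. C1 \<psi> \<longrightarrow> (\<forall>y. y \<notin> cball x (2 * r) \<longrightarrow> \<psi> y = 0) \<longrightarrow> divergence_thm \<psi>"
    using divergence_near by metis
  from choice[OF this] obtain r where "\<forall>x. r x > 0 \<and> (\<forall>\<psi>. C1 \<psi> \<longrightarrow> (\<forall>y. y \<notin> cball x (2 * r x) \<longrightarrow> \<psi> y = 0) \<longrightarrow> divergence_thm \<psi>)" ..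
  then have r: "r x > 0" "\<And>\<psi>. C1 \<psi> \<Longrightarrow> (\<And>y. y \<notin> cball x (2 * r x) \<Longrightarrow> \<psi> y = 0) \<Longrightarrow> divergence_thm \<psi>" for x
    by blast+
  \<comment> \<open>Balls are removed one at a time. The part \<open>\<psi> x * \<eta> x\<close> is
    supported near the centre \<open>c\<close>, while the complementary part vanishes near every
    point of the ball about \<open>c\<close> and so meets the condition with the remaining
    balls.\<close>
  have ind: "divergence_thm \<psi>" if "finite F" "C1 \<psi>"
    "\<And>x. x \<in> \<Omega> \<Longrightarrow> (\<exists>c\<in>F. x \<in> ball c (r c)) \<or> (\<forall>\<^sub>F y in nhds x. \<psi> y = 0)" for F \<psi>
    using that
  proof (induction F arbitrary: \<psi> rule: finite_induct)
    case empty
    then have "grad \<psi> x = 0" "\<psi> x = 0" if "x \<in> \<Omega>" for x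
      using that grad_zero eventually_nhds_x_imp_x by blast+
    then have "(\<lambda>x. indicator \<Omega> x *\<^sub>R grad \<psi> x) = (\<lambda>_. 0)" "(\<lambda>x. indicator (frontier \<Omega>) x *\<^sub>R (\<psi> x *\<^sub>R N x)) = (\<lambda>_. 0)"
      using frontier_subset by (auto simp: fun_eq_iff indicator_eq_0_iff)
    then show ?case unfolding divergence_thm_def by simp
  next
    case (insert c F)
    obtain \<eta> where \<eta>: "C1 \<eta>" "\<And>x. x \<in> ball c (r c) \<Longrightarrow> \<eta> x = 1" "\<And>x. x \<notin> cball c (2 * r c) \<Longrightarrow> \<eta> x = 0"
      by (rule bump_exists[OF r(1)[of c], of c], rule that)
    have C: "C1 (\<lambda>x. 1 + (- 1) * \<eta> x)"
      using \<eta>(1) unfolding C1_def by (intro Ck_on_add Ck_on_mult Ck_on_const open_UNIV)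
    have 1: "divergence_thm (\<lambda>x. \<psi> x * \<eta> x)"
      using \<eta> by (intro r(2)[of _ c] C1_mult insert.prems) auto
    have 2: "divergence_thm (\<lambda>x. \<psi> x * (1 + (- 1) * \<eta> x))"
    proof (rule insert.IH)
      show "C1 (\<lambda>x. \<psi> x * (1 + (- 1) * \<eta> x))" by (intro C1_mult insert.prems C)
      fix x assume x: "x \<in> \<Omega>"
      from insert.prems(2)[OF x] consider "x \<in> ball c (r c)" | "\<exists>c\<in>F. x \<in> ball c (r c)" | "\<forall>\<^sub>F y in nhds x. \<psi> y = 0"
        by blast
      then show "(\<exists>c\<in>F. x \<in> ball c (r c)) \<or> (\<forall>\<^sub>F y in nhds x. \<psi> y * (1 + (- 1) * \<eta> y) = 0)"
      proof cases
        case 1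
        have "\<forall>\<^sub>F y in nhds x. y \<in> ball c (r c)" using 1 by (intro eventually_nhds_in_open open_ball)
        then have "\<forall>\<^sub>F y in nhds x. \<psi> y * (1 + (- 1) * \<eta> y) = 0"
          by eventually_elim (simp add: \<eta>(2))
        then show ?thesis ..
      next
        case 3
        then have "\<forall>\<^sub>F y in nhds x. \<psi> y * (1 + (- 1) * \<eta> y) = 0"
          by eventually_elim simp
        then show ?thesis ..
      qed blast
    qed
    have "divergence_thm (\<lambda>x. \<psi> x * \<eta> x + \<psi> x * (1 + (- 1) * \<eta> x))"
      by (intro divergence_add 1 2 C1_mult insert.prems C \<eta>)
    also have "(\<lambda>x. \<psi> x * \<eta> x + \<psi> x * (1 + (- 1) * \<eta> x)) = \<psi>" by (auto simp: algebra_simps)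
    finally show ?case .
  qed
  have "\<Omega> \<subseteq> (\<Union>x\<in>\<Omega>. ball x (r x))" using r(1) by auto
  then obtain F where "F \<subseteq> \<Omega>" "finite F" "\<Omega> \<subseteq> (\<Union>x\<in>F. ball x (r x))"
    by (rule compactE_image[OF compact_domain, rotated]) auto
  then show ?thesis using assms by (intro ind[of F]) blast+
qed

lemma divergence_component:
  assumes "C1 \<psi>"
  shows "(\<integral>x. indicator \<Omega> x * (grad \<psi> x \<bullet> e) \<partial>lborel) = (\<integral>x. indicator (frontier \<Omega>) x * (\<psi> x * (N x \<bullet> e)) \<partial>\<sigma>)"
  unfolding divergence_components[OF assms, symmetric] divergence[OF assms, unfolded divergence_thm_def] ..

text \<open>The function \<open>x \<bullet> b\<close> has constant gradient \<open>b\<close>. Its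
  component along \<open>b\<close>, summed over the basis, is the divergence theorem for the
  position field.\<close>

theorem integral_support_function:
  "(\<integral>x. indicator (frontier \<Omega>) x * (x \<bullet> N x) \<partial>\<sigma>) = real DIM(real^('n option)) * measure lborel \<Omega>"
proof -
  have C: "C1 (\<lambda>x. x \<bullet> b)" and G: "grad (\<lambda>x. x \<bullet> b) x = b" for b x :: "real^('n::{finite,wellorder} option)"
  proof -
    have d: "((\<lambda>x. x \<bullet> b) has_derivative (\<lambda>v. b \<bullet> v)) (at x)" for x
      by (auto intro!: derivative_eq_intros simp: inner_commute)
    show "C1 (\<lambda>x. x \<bullet> b)" by (rule C1I[OF d]) (intro continuous_intros)
    show "grad (\<lambda>x. x \<bullet> b) x = b" by (rule grad_eqI[OF d])
  qed
  have int: "integrable \<sigma> (\<lambda>x. indicator (frontier \<Omega>) x * ((x \<bullet> b) * (N x \<bullet> b)))" for b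
  proof -
    have "continuous_on (frontier \<Omega>) (\<lambda>x. (x \<bullet> b) * (N x \<bullet> b))"
      by (intro continuous_intros continuous_normal)
    from integrable_on_frontier[OF this] show ?thesis unfolding set_integrable_def by simp
  qed
  have "(\<integral>x. indicator (frontier \<Omega>) x * (x \<bullet> N x) \<partial>\<sigma>) =
      (\<integral>x. (\<Sum>b\<in>Basis. indicator (frontier \<Omega>) x * ((x \<bullet> b) * (N x \<bullet> b))) \<partial>\<sigma>)"
    by (simp add: euclidean_inner[of _ "N _"] sum_distrib_left)
  also have "\<dots> = (\<Sum>b\<in>Basis. (\<integral>x. indicator (frontier \<Omega>) x * ((x \<bullet> b) * (N x \<bullet> b)) \<partial>\<sigma>))"
    by (rule Bochner_Integration.integral_sum) (rule int)
  also have "\<dots> = (\<Sum>b\<in>(Basis :: (real^('n::{finite,wellorder} option)) set). measure lborel \<Omega>)"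
  proof (rule sum.cong[OF refl])
    fix b :: "real^('n::{finite,wellorder} option)" assume "b \<in> Basis"
    then show "(\<integral>x. indicator (frontier \<Omega>) x * ((x \<bullet> b) * (N x \<bullet> b)) \<partial>\<sigma>) = measure lborel \<Omega>"
      using divergence_component[OF C, of b b] by (simp add: G)
  qed
  finally show ?thesis by simp
qed

end

subsection \<open>Radial kernels\<close>

lemma lborel_integral_affine:
  fixes f :: "'a::euclidean_space \<Rightarrow> real"
  assumes [measurable]: "f \<in> borel_measurable borel" and "c > 0"
  shows "(\<integral>x. f x \<partial>lborel) = c ^ DIM('a) * (\<integral>y. f (t + c *\<^sub>R y) \<partial>lborel)"
proof -
  let ?T = "\<lambda>y. t + c *\<^sub>R y :: 'a"
  have c: "\<bar>c\<bar> ^ DIM('a) = c ^ DIM('a)" using assms(2) by simp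
  have eq: "lborel = density (distr lborel borel ?T) (\<lambda>_. ennreal (c ^ DIM('a)))"
    using lborel_affine[of c t] assms(2) c by simp
  have "(\<integral>x. f x \<partial>lborel) = (\<integral>x. f x \<partial>density (distr lborel borel ?T) (\<lambda>_. ennreal (c ^ DIM('a))))"
    using eq by simp
  also have "\<dots> = (\<integral>x. c ^ DIM('a) *\<^sub>R f x \<partial>distr lborel borel ?T)"
    using assms(2) by (intro integral_density) auto
  also have "\<dots> = (\<integral>y. c ^ DIM('a) *\<^sub>R f (?T y) \<partial>lborel)"
    by (rule integral_distr) auto
  finally show ?thesis by simp
qed

text \<open>The kernel vanishes from distance \<open>\<delta>\<close> on and is left unnormalised:
  \<open>integral_kern\<close> computes its mass, whose dimensional constant cancels in the end.
  Symmetry in \<open>c\<close> and \<open>z\<close> makes the gradients in the two variables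
  opposite, so that shifting the centre becomes a derivative in the integration variable.\<close>

definition kern :: "real \<Rightarrow> 'a::euclidean_space \<Rightarrow> 'a \<Rightarrow> real" where
  "kern \<delta> c z = pos_square (\<delta>\<^sup>2 + (- 1) * ((z - c) \<bullet> (z - c)))"

lemma kern_sym: "kern \<delta> c z = kern \<delta> z c"
  by (simp add: kern_def inner_diff_left inner_diff_right inner_commute algebra_simps)

lemma kern_nonneg: "0 \<le> kern \<delta> c z"
  by (simp add: kern_def pos_square_def)

lemma kern_C1: "C1 (kern \<delta> c)"
  unfolding kern_def[abs_def] by (intro C1_pos_square_compose C1_quadratic)

lemma kern_grad: "grad (kern \<delta> c) z = (- 4 * max 0 (\<delta>\<^sup>2 + (- 1) * ((z - c) \<bullet> (z - c)))) *\<^sub>R (z - c)"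
  unfolding kern_def[abs_def] C1_pos_square_compose(2)[OF C1_quadratic(1)] C1_quadratic(2) by simp

lemma kern_grad_antisym: "grad (kern \<delta> c) z = - grad (kern \<delta> z) c"
proof -
  have "(z - c) \<bullet> (z - c) = (c - z) \<bullet> (c - z)"
    by (simp add: inner_diff_left inner_diff_right inner_commute algebra_simps)
  then show ?thesis unfolding kern_grad by (simp add: scaleR_diff_right)
qed

lemma continuous_pos_square: "continuous_on A pos_square"
  unfolding pos_square_def[abs_def] by (intro continuous_intros)

lemma continuous_kern:
  assumes "continuous_on A f" "continuous_on A g"
  shows "continuous_on A (\<lambda>x. kern \<delta> (f x) (g x))"
  unfolding kern_def
  by (intro continuous_on_compose2[OF continuous_pos_square[of UNIV]] continuous_intros assms) auto

lemma kern_measurable [measurable]: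
  "(\<lambda>p. kern \<delta> (fst p) (snd p)) \<in> borel_measurable (borel :: ('a::euclidean_space \<times> 'a) measure)"
  "kern \<delta> c \<in> borel_measurable borel" "(\<lambda>z. kern \<delta> z c) \<in> borel_measurable borel"
  by (intro borel_measurable_continuous_onI continuous_kern continuous_intros;
      simp add: C1_continuous(1)[OF kern_C1])+

lemma kern_eq_0:
  assumes "\<delta> \<ge> 0" "dist c z \<ge> \<delta>"
  shows "kern \<delta> c z = 0"
proof -
  have "(z - c) \<bullet> (z - c) = (dist c z)\<^sup>2"
    by (simp add: dist_norm norm_minus_commute[of c z] power2_norm_eq_inner)
  then have "\<delta>\<^sup>2 \<le> (z - c) \<bullet> (z - c)" using power_mono[OF assms(2,1)] by simp
  then show ?thesis by (simp add: kern_def pos_square_def)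
qed

lemma kern_integrable: "\<delta> \<ge> 0 \<Longrightarrow> integrable lborel (kern \<delta> c)"
proof -
  assume "\<delta> \<ge> 0"
  have "integrable lborel (\<lambda>z. indicator (cball c \<delta>) z *\<^sub>R kern \<delta> c z)"
    by (intro borel_integrable_compact C1_continuous kern_C1) auto
  moreover have "(\<lambda>z. indicator (cball c \<delta>) z *\<^sub>R kern \<delta> c z) = kern \<delta> c"
  proof
    fix z show "indicator (cball c \<delta>) z *\<^sub>R kern \<delta> c z = kern \<delta> c z"
      using kern_eq_0[OF \<open>\<delta> \<ge> 0\<close>, of c z] by (cases "z \<in> cball c \<delta>") auto
  qed
  ultimately show ?thesis by (simp only:)
qed

definition kern_mass :: "'a::euclidean_space itself \<Rightarrow> real" where
  "kern_mass _ = (\<integral>z. kern 1 (0 :: 'a) z \<partial>lborel)"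

lemma kern_mass_pos: "kern_mass TYPE('a::euclidean_space) > 0"
proof -
  let ?B = "ball (0 :: 'a) (1/2)"
  \<comment> \<open>On the ball of radius 1/2 the kernel is at least
    \<open>(1 - 1/4)\<^sup>2\<close>.\<close>
  have "0 < (9/16) * measure lborel ?B" using content_ball_pos[of "1/2" "0 :: 'a"] by simp
  also have "\<dots> = (\<integral>z. (9/16) * indicator ?B z \<partial>lborel)" by simp
  also have "\<dots> \<le> kern_mass TYPE('a)"
    unfolding kern_mass_def
  proof (rule integral_mono)
    show "integrable lborel (\<lambda>z :: 'a. (9/16) * indicator ?B z :: real)"
      using emeasure_lborel_ball_finite by (intro integrable_mult_right integrable_real_indicator) auto
    show "integrable lborel (kern 1 (0 :: 'a))" by (rule kern_integrable) simp
    show "(9/16) * indicator ?B z \<le> kern 1 0 z" for z :: 'a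
    proof (cases "z \<in> ?B")
      case True
      then have "(norm z)\<^sup>2 \<le> (1/2)\<^sup>2" by (intro power_mono) auto
      then have "3/4 \<le> 1 - z \<bullet> z" unfolding power2_norm_eq_inner by (simp add: power2_eq_square)
      then have "(3/4)\<^sup>2 \<le> (max 0 (1 - z \<bullet> z))\<^sup>2" by (intro power_mono) auto
      then show ?thesis using True by (simp add: kern_def pos_square_def power2_eq_square)
    qed (simp add: kern_nonneg)
  qed
  finally show ?thesis .
qed

text \<open>Scaling: \<open>DIM('a)\<close> powers of \<open>\<delta>\<close> come from the volume
  and 4 from the squared quadratic inside the kernel.\<close>

lemma integral_kern:
  assumes "\<delta> > 0"
  shows "(\<integral>z. kern \<delta> (c :: 'a::euclidean_space) z \<partial>lborel) = \<delta> ^ (DIM('a) + 4) * kern_mass TYPE('a)"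
proof -
  have sc: "kern \<delta> c (c + \<delta> *\<^sub>R y) = \<delta> ^ 4 * kern 1 0 y" for y
  proof -
    have "\<delta>\<^sup>2 + (- 1) * ((c + \<delta> *\<^sub>R y - c) \<bullet> (c + \<delta> *\<^sub>R y - c)) = \<delta>\<^sup>2 * (1\<^sup>2 + (- 1) * ((y - 0) \<bullet> (y - 0)))"
      by (simp add: power2_eq_square algebra_simps)
    moreover have "max 0 (\<delta>\<^sup>2 * s) = \<delta>\<^sup>2 * max 0 s" for s by (simp add: max_mult_distrib_left)
    ultimately show ?thesis by (simp add: kern_def pos_square_def power_mult_distrib)
  qed
  have "(\<integral>z. kern \<delta> c z \<partial>lborel) = \<delta> ^ DIM('a) * (\<integral>y. kern \<delta> c (c + \<delta> *\<^sub>R y) \<partial>lborel)"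
    using assms by (intro lborel_integral_affine) auto
  also have "\<dots> = \<delta> ^ DIM('a) * (\<delta> ^ 4 * kern_mass TYPE('a))"
    unfolding sc kern_mass_def by simp
  finally show ?thesis by (simp add: power_add)
qed

text \<open>Where the shifted kernel is positive, \<open>z - x\<close> has norm at most
  \<open>\<delta> + \<epsilon>\<close>, so the shift by \<open>v\<close> lowers its squared norm by
  at most \<open>2 * \<epsilon> * (\<delta> + \<epsilon>)\<close>. Enlarging the squared radius by
  this amount compensates, and \<open>\<eta>\<close> returns to \<open>\<delta>\<close> as
  \<open>\<epsilon>\<close> tends to 0.\<close>

lemma kern_shift_le:
  assumes "\<delta> \<ge> 0" "norm v \<le> \<epsilon>" "\<eta> \<ge> 0" "\<eta>\<^sup>2 = \<delta>\<^sup>2 + 2 * \<epsilon> * (\<delta> + \<epsilon>)"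
  shows "kern \<delta> (x + v) z \<le> kern \<eta> x z"
proof (cases "kern \<delta> (x + v) z = 0")
  case True
  then show ?thesis by (simp add: kern_nonneg)
next
  case False
  define d where "d = z - x"
  have "dist (x + v) z < \<delta>" using kern_eq_0[OF assms(1)] False by force
  then have dv: "norm (d - v) < \<delta>" by (simp add: d_def dist_norm norm_minus_commute algebra_simps)
  have "norm d \<le> norm (d - v) + norm v" using norm_triangle_ineq[of "d - v" v] by simp
  then have nd: "norm d \<le> \<delta> + \<epsilon>" using dv assms(2) by linarith
  have "d \<bullet> v \<le> norm d * norm v" by (rule norm_cauchy_schwarz)
  also have "\<dots> \<le> (\<delta> + \<epsilon>) * \<epsilon>" using nd assms(2) norm_ge_zero[of d] norm_ge_zero[of v] by (intro mult_mono) linarith+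
  finally have "d \<bullet> v \<le> (\<delta> + \<epsilon>) * \<epsilon>" .
  moreover have "(d - v) \<bullet> (d - v) = d \<bullet> d - 2 * (d \<bullet> v) + v \<bullet> v"
    by (simp add: inner_diff_left inner_diff_right inner_commute)
  moreover have "v \<bullet> v \<ge> 0" by simp
  moreover have "2 * \<epsilon> * (\<delta> + \<epsilon>) = 2 * ((\<delta> + \<epsilon>) * \<epsilon>)" by simp
  ultimately have "\<delta>\<^sup>2 - (d - v) \<bullet> (d - v) \<le> \<eta>\<^sup>2 - d \<bullet> d"
    unfolding assms(4) by linarith
  then have "max 0 (\<delta>\<^sup>2 - (d - v) \<bullet> (d - v)) \<le> max 0 (\<eta>\<^sup>2 - d \<bullet> d)" by simp
  then have "(max 0 (\<delta>\<^sup>2 - (d - v) \<bullet> (d - v)))\<^sup>2 \<le> (max 0 (\<eta>\<^sup>2 - d \<bullet> d))\<^sup>2" by (intro power_mono) auto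
  moreover have "z - (x + v) = d - v" "z - x = d" by (simp_all add: d_def)
  ultimately show ?thesis unfolding kern_def pos_square_def by (simp only: mult_minus1 diff_conv_add_uminus)
qed

lemma kern_increment:
  "kern \<delta> (x + y) z - kern \<delta> x z = (\<integral>t. indicator {0..1} t * (grad (kern \<delta> z) (x + t *\<^sub>R y) \<bullet> y) \<partial>lborel)"
proof -
  let ?h = "\<lambda>t. kern \<delta> z (x + t *\<^sub>R y)" and ?h' = "\<lambda>t. grad (kern \<delta> z) (x + t *\<^sub>R y) \<bullet> y"
  have d: "(?h has_real_derivative ?h' t) (at t)" for t
  proof -
    have "((\<lambda>t. x + t *\<^sub>R y) has_derivative (\<lambda>s. s *\<^sub>R y)) (at t)"
      by (auto intro!: derivative_eq_intros)
    from has_derivative_compose[OF this C1_has_derivative[OF kern_C1]]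
    have "(?h has_derivative (\<lambda>s. grad (kern \<delta> z) (x + t *\<^sub>R y) \<bullet> (s *\<^sub>R y))) (at t)" .
    moreover have "(\<lambda>s. grad (kern \<delta> z) (x + t *\<^sub>R y) \<bullet> (s *\<^sub>R y)) = (*) (?h' t)" by (auto simp: fun_eq_iff)
    ultimately show ?thesis by (simp only: has_field_derivative_def)
  qed
  have "continuous_on UNIV ?h'"
    by (intro continuous_intros continuous_on_compose2[OF C1_continuous(2)[OF kern_C1, of UNIV]]) auto
  then have c: "isCont ?h' t" for t by (simp add: continuous_on_eq_continuous_at)
  have "(\<integral>t. ?h' t * indicator {0..1} t \<partial>lborel) = ?h 1 - ?h 0"
    by (rule integral_FTC_Icc_real) (auto intro: d c)
  then show ?thesis by (simp add: mult.commute kern_sym[of \<delta> z])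
qed

lemma Bernoulli_power:
  fixes a b :: real
  assumes "0 \<le> a" "0 \<le> b"
  shows "a ^ m + real m * b * a ^ (m - 1) \<le> (a + b) ^ m"
proof (induction m)
  case (Suc m)
  have "a ^ Suc m + real (Suc m) * b * a ^ m \<le> (a ^ m + real m * b * a ^ (m - 1)) * (a + b)"
  proof (cases m)
    case (Suc k)
    have "0 \<le> real m * (b * b) * a ^ k" using assms by simp
    moreover have "(a ^ m + real m * b * a ^ (m - 1)) * (a + b) =
        a ^ Suc m + real (Suc m) * b * a ^ m + real m * (b * b) * a ^ k"
      unfolding Suc by (simp add: algebra_simps)
    ultimately show ?thesis by linarith
  qed (use assms in simp)
  also have "\<dots> \<le> (a + b) ^ m * (a + b)" using Suc assms by (intro mult_right_mono) auto
  finally show ?case by (simp add: mult.commute)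
qed simp

text \<open>The linear size of the unit ball: the ball of radius \<open>\<epsilon>\<close> has the
  linear size \<open>\<epsilon>\<close> times this number, which is the form in which
  \<open>brunn_minkowski\<close> receives its volumes.\<close>

definition unit_ball_root :: "'a::euclidean_space itself \<Rightarrow> real" where
  "unit_ball_root _ = root DIM('a) (measure lborel (ball (0 :: 'a) 1))"

lemma unit_ball_root_pos: "unit_ball_root TYPE('a::euclidean_space) > 0"
  unfolding unit_ball_root_def
  using content_ball_pos[of 1 "0 :: 'a"] by (intro real_root_gt_zero) auto

lemma measure_small_ball:
  assumes "\<epsilon> > 0"
  shows "measure lborel (ball (0 :: 'a::euclidean_space) \<epsilon>) = (\<epsilon> * unit_ball_root TYPE('a)) ^ DIM('a)"
proof -
  have "ball (0 :: 'a) \<epsilon> = {z. z /\<^sub>R \<epsilon> \<in> ball 0 1}"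
    using assms by (auto simp: field_simps)
  then have "emeasure lborel (ball (0 :: 'a) \<epsilon>) = ennreal (\<epsilon> ^ DIM('a)) * emeasure lborel (ball (0 :: 'a) 1)"
    using emeasure_lborel_dilate[of "ball (0 :: 'a) 1" \<epsilon>] assms by simp
  then have "measure lborel (ball (0 :: 'a) \<epsilon>) = \<epsilon> ^ DIM('a) * measure lborel (ball (0 :: 'a) 1)"
    using assms by (simp add: measure_def enn2real_mult)
  also have "measure lborel (ball (0 :: 'a) 1) = unit_ball_root TYPE('a) ^ DIM('a)"
    unfolding unit_ball_root_def by (intro real_root_pow_pos2[symmetric]) auto
  finally show ?thesis by (simp add: power_mult_distrib)
qed

subsection \<open>The isoperimetric inequality\<close>

context smooth_domain
begin

definition mollified where
  "mollified \<delta> x = (\<integral>z. indicator \<Omega> z * kern \<delta> x z \<partial>lborel)"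

definition boundary_mollified where
  "boundary_mollified \<delta> x = (\<integral>z. indicator (frontier \<Omega>) z * kern \<delta> x z \<partial>\<sigma>)"

lemma mollified_integrable: "integrable lborel (\<lambda>z. indicator \<Omega> z * kern \<delta> x z)"
  using integrable_on_domain[OF C1_continuous(1)[OF kern_C1]] by simp

lemma boundary_mollified_integrable: "integrable \<sigma> (\<lambda>z. indicator (frontier \<Omega>) z * kern \<delta> x z)"
  using integrable_on_frontier[OF C1_continuous(1)[OF kern_C1]] by (simp add: set_integrable_def)

lemma mollified_nonneg: "0 \<le> mollified \<delta> x" "0 \<le> boundary_mollified \<delta> x"
  unfolding mollified_def boundary_mollified_def
  by (auto intro!: Bochner_Integration.integral_nonneg simp: kern_nonneg)

lemma mollified_measurable [measurable]:
  "mollified \<delta> \<in> borel_measurable borel" "boundary_mollified \<delta> \<in> borel_measurable borel"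
proof -
  have k: "(\<lambda>(x, z). kern \<delta> x z) \<in> borel_measurable (borel \<Otimes>\<^sub>M borel :: ((real^('n::{finite,wellorder} option)) \<times> (real^('n::{finite,wellorder} option))) measure)"
    using kern_measurable(1)[of \<delta>] unfolding borel_prod by (simp add: split_def)
  have s: "sets (borel \<Otimes>\<^sub>M \<sigma>) = sets (borel \<Otimes>\<^sub>M borel :: ((real^('n::{finite,wellorder} option)) \<times> (real^('n::{finite,wellorder} option))) measure)"
    by (intro sets_pair_measure_cong) auto
  have s': "sets (borel \<Otimes>\<^sub>M lborel) = sets (borel \<Otimes>\<^sub>M borel :: ((real^('n::{finite,wellorder} option)) \<times> (real^('n::{finite,wellorder} option))) measure)"
    by (intro sets_pair_measure_cong) auto
  have "(\<lambda>(x, z). indicator \<Omega> z * kern \<delta> x z) \<in> borel_measurable (borel \<Otimes>\<^sub>M borel)"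
    using k by measurable
  then have "(\<lambda>(x, z). indicator \<Omega> z * kern \<delta> x z) \<in> borel_measurable (borel \<Otimes>\<^sub>M lborel)"
    by (simp only: measurable_cong_sets[OF s' refl])
  then show "mollified \<delta> \<in> borel_measurable borel"
    unfolding mollified_def by (rule lborel.borel_measurable_lebesgue_integral)
  have "(\<lambda>(x, z). indicator (frontier \<Omega>) z * kern \<delta> x z) \<in> borel_measurable (borel \<Otimes>\<^sub>M borel)"
    using k by measurable
  then have "(\<lambda>(x, z). indicator (frontier \<Omega>) z * kern \<delta> x z) \<in> borel_measurable (borel \<Otimes>\<^sub>M \<sigma>)"
    by (simp only: measurable_cong_sets[OF s refl])
  then show "boundary_mollified \<delta> \<in> borel_measurable borel"
    unfolding boundary_mollified_def by (rule area.borel_measurable_lebesgue_integral)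
qed

text \<open>By the divergence theorem the derivative of the mollified indicator function in direction
  \<open>y\<close> is the boundary integral of the kernel against \<open>- (N \<bullet> y)\<close>.\<close>

lemma mollified_increment:
  assumes "\<delta> \<ge> 0" "norm y \<le> \<epsilon>" "\<eta> \<ge> 0" "\<eta>\<^sup>2 = \<delta>\<^sup>2 + 2 * \<epsilon> * (\<delta> + \<epsilon>)"
  shows "mollified \<delta> (x + y) \<le> mollified \<delta> x + \<epsilon> * boundary_mollified \<eta> x"
proof -
  let ?F = "\<lambda>z t. indicator \<Omega> z * (indicator {0..1} t * (grad (kern \<delta> z) (x + t *\<^sub>R y) \<bullet> y))"
  have "\<epsilon> \<ge> 0" using assms(2) norm_ge_zero order.trans by blast
  have gc: "continuous_on UNIV (\<lambda>p. grad (kern \<delta> (fst p)) (x + snd p *\<^sub>R y) \<bullet> y)"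
    unfolding kern_grad by (intro continuous_intros)
  have int: "integrable (lborel \<Otimes>\<^sub>M lborel) (\<lambda>(z, t). ?F z t)"
  proof -
    have "integrable lborel (\<lambda>p. indicator (\<Omega> \<times> {0..1}) p *\<^sub>R (grad (kern \<delta> (fst p)) (x + snd p *\<^sub>R y) \<bullet> y))"
      by (intro borel_integrable_compact compact_Times compact_domain continuous_on_subset[OF gc]) auto
    also have "(\<lambda>p. indicator (\<Omega> \<times> {0..1}) p *\<^sub>R (grad (kern \<delta> (fst p)) (x + snd p *\<^sub>R y) \<bullet> y)) = (\<lambda>(z, t). ?F z t)"
      by (auto simp: fun_eq_iff indicator_def)
    finally show ?thesis unfolding lborel_prod .
  qed
  \<comment> \<open>One bound serves all points of the segment: \<open>- (N z \<bullet> y)\<close>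
    is at most \<open>\<epsilon>\<close>, and the kernel about the moving centre is dominated by the
    wider kernel about \<open>x\<close>.\<close>
  have slice: "(\<integral>z. ?F z t \<partial>lborel) \<le> indicator {0..1} t * (\<epsilon> * boundary_mollified \<eta> x)" for t
  proof (cases "t \<in> {0..1}")
    case True
    let ?c = "x + t *\<^sub>R y"
    have nty: "norm (t *\<^sub>R y) \<le> \<epsilon>"
    proof -
      have "\<bar>t\<bar> * norm y \<le> 1 * norm y" using True by (intro mult_right_mono) auto
      then show ?thesis using assms(2) by simp
    qed
    have "(\<integral>z. ?F z t \<partial>lborel) = (\<integral>z. - (indicator \<Omega> z * (grad (kern \<delta> ?c) z \<bullet> y)) \<partial>lborel)"
      using True by (intro Bochner_Integration.integral_cong refl) (simp add: kern_grad_antisym[of \<delta> _ ?c])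
    also have "\<dots> = - (\<integral>z. indicator (frontier \<Omega>) z * (kern \<delta> ?c z * (N z \<bullet> y)) \<partial>\<sigma>)"
      using divergence_component[OF kern_C1, of \<delta> ?c y] by simp
    also have "\<dots> = (\<integral>z. - (indicator (frontier \<Omega>) z * (kern \<delta> ?c z * (N z \<bullet> y))) \<partial>\<sigma>)" by simp
    also have "\<dots> \<le> (\<integral>z. \<epsilon> * (indicator (frontier \<Omega>) z * kern \<eta> x z) \<partial>\<sigma>)"
    proof (rule integral_mono)
      have "continuous_on (frontier \<Omega>) (\<lambda>z. kern \<delta> ?c z * (N z \<bullet> y))"
        by (intro continuous_intros C1_continuous kern_C1 continuous_normal)
      from integrable_on_frontier[OF this]
      show "integrable \<sigma> (\<lambda>z. - (indicator (frontier \<Omega>) z * (kern \<delta> ?c z * (N z \<bullet> y))))"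
        by (simp add: set_integrable_def)
      show "integrable \<sigma> (\<lambda>z. \<epsilon> * (indicator (frontier \<Omega>) z * kern \<eta> x z))"
        by (intro integrable_mult_right boundary_mollified_integrable)
      fix z
      show "- (indicator (frontier \<Omega>) z * (kern \<delta> ?c z * (N z \<bullet> y))) \<le> \<epsilon> * (indicator (frontier \<Omega>) z * kern \<eta> x z)"
      proof (cases "z \<in> frontier \<Omega>")
        case True
        have "- (N z \<bullet> y) \<le> norm (N z) * norm y"
          using Cauchy_Schwarz_ineq2[of "N z" y] by linarith
        then have "- (N z \<bullet> y) \<le> \<epsilon>" using norm_normal[OF True] assms(2) by simp
        then have "kern \<delta> ?c z * (- (N z \<bullet> y)) \<le> kern \<delta> ?c z * \<epsilon>"
          by (rule mult_left_mono) (rule kern_nonneg)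
        also have "\<dots> \<le> kern \<eta> x z * \<epsilon>"
          by (rule mult_right_mono[OF kern_shift_le[OF assms(1) nty assms(3,4)] \<open>\<epsilon> \<ge> 0\<close>])
        finally show ?thesis using True by (simp add: mult.commute)
      qed simp
    qed
    also have "\<dots> = \<epsilon> * boundary_mollified \<eta> x" by (simp add: boundary_mollified_def)
    finally show ?thesis using True by simp
  qed simp
  have "mollified \<delta> (x + y) - mollified \<delta> x = (\<integral>z. indicator \<Omega> z * kern \<delta> (x + y) z - indicator \<Omega> z * kern \<delta> x z \<partial>lborel)"
    unfolding mollified_def by (rule Bochner_Integration.integral_diff[OF mollified_integrable mollified_integrable, symmetric])
  also have "\<dots> = (\<integral>z. (\<integral>t. ?F z t \<partial>lborel) \<partial>lborel)"
    unfolding right_diff_distrib[symmetric] kern_increment by simp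
  also have "\<dots> = (\<integral>t. (\<integral>z. ?F z t \<partial>lborel) \<partial>lborel)"
    by (rule lborel_pair.Fubini_integral[OF int, symmetric])
  also have "\<dots> \<le> (\<integral>t. indicator {0..1::real} t * (\<epsilon> * boundary_mollified \<eta> x) \<partial>lborel)"
  proof (rule integral_mono[OF _ _ slice])
    show "integrable lborel (\<lambda>t. \<integral>z. ?F z t \<partial>lborel)" by (rule lborel_pair.integrable_snd[OF int])
    show "integrable lborel (\<lambda>t::real. indicator {0..1} t * (\<epsilon> * boundary_mollified \<eta> x))"
      by (intro integrable_mult_left integrable_real_indicator) auto
  qed
  also have "\<dots> = \<epsilon> * boundary_mollified \<eta> x" by simp
  finally show ?thesis by simp
qed

lemma domain_bound:
  obtains M where "M \<ge> 0" "\<And>z. z \<in> \<Omega> \<Longrightarrow> norm z \<le> M"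
  using compact_imp_bounded[OF compact_domain] unfolding bounded_pos by (meson less_imp_le)

lemma mollified_support:
  assumes "\<delta> \<ge> 0" "\<And>z. z \<in> \<Omega> \<Longrightarrow> norm z \<le> M" "norm x > M + \<delta>"
  shows "mollified \<delta> x = 0" "boundary_mollified \<delta> x = 0"
proof -
  have "kern \<delta> x z = 0" if "z \<in> \<Omega>" for z
  proof (rule kern_eq_0[OF assms(1)])
    have "norm x \<le> norm z + dist x z" using norm_triangle_ineq[of z "x - z"] by (simp add: dist_norm)
    then show "\<delta> \<le> dist x z" using assms(2)[OF that] assms(3) by linarith
  qed
  then have "(\<lambda>z. indicator \<Omega> z * kern \<delta> x z) = (\<lambda>_. 0)" "(\<lambda>z. indicator (frontier \<Omega>) z * kern \<delta> x z) = (\<lambda>_. 0)"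
    using frontier_subset by (auto simp: fun_eq_iff indicator_eq_0_iff)
  then show "mollified \<delta> x = 0" "boundary_mollified \<delta> x = 0"
    unfolding mollified_def boundary_mollified_def by simp_all
qed

lemma mollified_le:
  assumes "\<delta> > 0"
  shows "mollified \<delta> x \<le> \<delta> ^ (DIM(real^('n::{finite,wellorder} option)) + 4) * kern_mass TYPE(real^('n::{finite,wellorder} option))"
  unfolding integral_kern[OF assms, of x, symmetric] mollified_def
  using assms by (intro integral_mono mollified_integrable kern_integrable) (auto simp: indicator_def kern_nonneg)

lemma nn_integral_mollified_finite:
  assumes "\<delta> > 0"
  shows "(\<integral>\<^sup>+x. ennreal (mollified \<delta> x) \<partial>lborel) < \<infinity>"
proof -
  obtain M where M: "M \<ge> 0" "\<And>z. z \<in> \<Omega> \<Longrightarrow> norm z \<le> M" by (rule domain_bound, rule that)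
  let ?C = "\<delta> ^ (DIM(real^('n::{finite,wellorder} option)) + 4) * kern_mass TYPE(real^('n::{finite,wellorder} option))" and ?B = "cball (0 :: real^('n::{finite,wellorder} option)) (M + \<delta>)"
  have "(\<integral>\<^sup>+x. ennreal (mollified \<delta> x) \<partial>lborel) \<le> (\<integral>\<^sup>+x. ennreal ?C * indicator ?B x \<partial>lborel)"
  proof (rule nn_integral_mono)
    fix x :: "real^('n::{finite,wellorder} option)"
    show "ennreal (mollified \<delta> x) \<le> ennreal ?C * indicator ?B x"
    proof (cases "x \<in> ?B")
      case True
      then show ?thesis using mollified_le[OF assms, of x] by (simp add: ennreal_leI)
    next
      case False
      then have "mollified \<delta> x = 0" using assms by (intro mollified_support(1)[OF _ M(2)]) auto
      then show ?thesis by simp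
    qed
  qed
  also have "\<dots> = ennreal ?C * emeasure lborel ?B" by (rule nn_integral_cmult_indicator) simp
  also have "\<dots> < \<infinity>" using emeasure_bounded_finite[of ?B] by (simp add: ennreal_mult_less_top)
  finally show ?thesis .
qed

text \<open>After exchanging the integrals, every boundary point contributes the full mass of the
  kernel.\<close>

lemma nn_integral_boundary_mollified:
  assumes "\<eta> > 0"
  shows "(\<integral>\<^sup>+x. ennreal (boundary_mollified \<eta> x) \<partial>lborel) =
    ennreal (measure \<sigma> (frontier \<Omega>) * (\<eta> ^ (DIM(real^('n::{finite,wellorder} option)) + 4) * kern_mass TYPE(real^('n::{finite,wellorder} option))))"
proof -
  let ?C = "\<eta> ^ (DIM(real^('n::{finite,wellorder} option)) + 4) * kern_mass TYPE(real^('n::{finite,wellorder} option))"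
  interpret P: pair_sigma_finite \<sigma> "lborel :: (real^('n::{finite,wellorder} option)) measure" ..
  have s: "sets (\<sigma> \<Otimes>\<^sub>M lborel) = sets (borel \<Otimes>\<^sub>M borel :: ((real^('n::{finite,wellorder} option)) \<times> (real^('n::{finite,wellorder} option))) measure)"
    by (intro sets_pair_measure_cong) auto
  have k: "(\<lambda>(x, z). kern \<eta> x z) \<in> borel_measurable (borel \<Otimes>\<^sub>M borel :: ((real^('n::{finite,wellorder} option)) \<times> (real^('n::{finite,wellorder} option))) measure)"
    using kern_measurable(1)[of \<eta>] unfolding borel_prod by (simp add: split_def)
  have "(\<lambda>(z, x). ennreal (indicator (frontier \<Omega>) z * kern \<eta> z x)) \<in> borel_measurable (borel \<Otimes>\<^sub>M borel)"
    using k by measurable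
  then have m: "(\<lambda>(z, x). ennreal (indicator (frontier \<Omega>) z * kern \<eta> z x)) \<in> borel_measurable (\<sigma> \<Otimes>\<^sub>M lborel)"
    by (simp only: measurable_cong_sets[OF s refl])
  have "(\<integral>\<^sup>+x. ennreal (boundary_mollified \<eta> x) \<partial>lborel) = (\<integral>\<^sup>+x. (\<integral>\<^sup>+z. ennreal (indicator (frontier \<Omega>) z * kern \<eta> z x) \<partial>\<sigma>) \<partial>lborel)"
  proof (intro nn_integral_cong)
    fix x
    have "(\<integral>\<^sup>+z. ennreal (indicator (frontier \<Omega>) z * kern \<eta> x z) \<partial>\<sigma>) = ennreal (boundary_mollified \<eta> x)"
      unfolding boundary_mollified_def
      by (rule nn_integral_eq_integral[OF boundary_mollified_integrable]) (simp add: kern_nonneg)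
    then show "ennreal (boundary_mollified \<eta> x) = (\<integral>\<^sup>+z. ennreal (indicator (frontier \<Omega>) z * kern \<eta> z x) \<partial>\<sigma>)"
      by (simp only: kern_sym[of \<eta> x])
  qed
  also have "\<dots> = (\<integral>\<^sup>+z. (\<integral>\<^sup>+x. ennreal (indicator (frontier \<Omega>) z * kern \<eta> z x) \<partial>lborel) \<partial>\<sigma>)"
    by (rule P.Fubini'[OF m])
  also have "\<dots> = (\<integral>\<^sup>+z. ennreal ?C * indicator (frontier \<Omega>) z \<partial>\<sigma>)"
  proof (intro nn_integral_cong)
    fix z :: "real^('n::{finite,wellorder} option)"
    have "(\<integral>\<^sup>+x. ennreal (kern \<eta> z x) \<partial>lborel) = ennreal ?C"
      using nn_integral_eq_integral[OF kern_integrable[of \<eta> z]] assms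
      by (simp add: kern_nonneg integral_kern)
    then show "(\<integral>\<^sup>+x. ennreal (indicator (frontier \<Omega>) z * kern \<eta> z x) \<partial>lborel) = ennreal ?C * indicator (frontier \<Omega>) z"
      by (cases "z \<in> frontier \<Omega>") auto
  qed
  also have "\<dots> = ennreal ?C * emeasure \<sigma> (frontier \<Omega>)" by (subst nn_integral_cmult_indicator) auto
  also have "\<dots> = ennreal (measure \<sigma> (frontier \<Omega>) * ?C)"
  proof -
    have "?C \<ge> 0"
      using assms kern_mass_pos[where 'a="real^('n::{finite,wellorder} option)"] by (intro mult_nonneg_nonneg) (auto simp: less_imp_le)
    then show ?thesis
      unfolding area.emeasure_eq_measure mult.commute[of "measure \<sigma> (frontier \<Omega>)"]
      by (rule ennreal_mult[symmetric]) (rule measure_nonneg)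
  qed
  finally show ?thesis .
qed

text \<open>Where the whole kernel ball fits into \<open>\<Omega>\<close>, the mollified function
  attains its maximal value. The set therefore lies in every superlevel set below that value and
  bounds their volumes from below, uniformly in the level.\<close>

definition inner_parallel where
  "inner_parallel \<delta> = {x. ball x \<delta> \<subseteq> \<Omega>}"

lemma inner_parallel_closed: "closed (inner_parallel \<delta>)"
proof -
  have "- inner_parallel \<delta> = (\<Union>z\<in>- \<Omega>. ball z \<delta>)"
    by (auto simp: inner_parallel_def dist_commute)
  then have "open (- inner_parallel \<delta>)" by (metis open_UN open_ball)
  then show ?thesis by (simp add: closed_def)
qed

lemma inner_parallel_borel [measurable]: "inner_parallel \<delta> \<in> sets borel"
  using inner_parallel_closed by (rule borel_closed)

lemma mollified_inner_parallel:
  assumes "\<delta> > 0" "x \<in> inner_parallel \<delta>"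
  shows "mollified \<delta> x = \<delta> ^ (DIM(real^('n::{finite,wellorder} option)) + 4) * kern_mass TYPE(real^('n::{finite,wellorder} option))"
proof -
  have "indicator \<Omega> z * kern \<delta> x z = kern \<delta> x z" for z
    using assms kern_eq_0[of \<delta> x z] by (cases "dist x z < \<delta>") (auto simp: inner_parallel_def indicator_def)
  then show ?thesis unfolding mollified_def by (simp only: integral_kern[OF assms(1), of x])
qed

text \<open>By \<open>mollified_increment\<close>, the superlevel set on the right contains the sum
  of the one on the left and the ball of radius \<open>\<epsilon>\<close>, to which Brunn-Minkowski
  applies. Only the term linear in \<open>\<epsilon>\<close> is kept, and the volume in it is
  lowered to that of the inner parallel set, so that the gain does not depend on
  \<open>t\<close>.\<close>

lemma mollified_level_sets:
  assumes d: "\<delta> > 0" and e: "\<epsilon> > 0" and eta: "\<eta> \<ge> 0" "\<eta>\<^sup>2 = \<delta>\<^sup>2 + 2 * \<epsilon> * (\<delta> + \<epsilon>)"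
    and t: "0 < t" "t < \<delta> ^ (DIM(real^('n::{finite,wellorder} option)) + 4) * kern_mass TYPE(real^('n::{finite,wellorder} option))"
    and pos: "measure lborel (inner_parallel \<delta>) > 0"
  shows "emeasure lborel {x. t < mollified \<delta> x} +
      ennreal (real DIM(real^('n::{finite,wellorder} option)) * (\<epsilon> * unit_ball_root TYPE(real^('n::{finite,wellorder} option))) * root DIM(real^('n::{finite,wellorder} option)) (measure lborel (inner_parallel \<delta>)) ^ (DIM(real^('n::{finite,wellorder} option)) - 1))
    \<le> emeasure lborel {x. t < mollified \<delta> x + \<epsilon> * boundary_mollified \<eta> x}"
proof -
  obtain M where M: "M \<ge> 0" "\<And>z. z \<in> \<Omega> \<Longrightarrow> norm z \<le> M" by (rule domain_bound, rule that)
  define A where "A = {x. t < mollified \<delta> x}"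
  define Z where "Z = {x. t < mollified \<delta> x + \<epsilon> * boundary_mollified \<eta> x}"
  let ?B = "ball (0 :: real^('n::{finite,wellorder} option)) \<epsilon>"
  have Am [measurable]: "A \<in> sets borel" and Zm [measurable]: "Z \<in> sets borel"
    unfolding A_def Z_def by measurable
  have "\<delta>\<^sup>2 \<le> \<eta>\<^sup>2" using d e eta by simp
  then have de: "\<delta> \<le> \<eta>" using eta(1) by (rule power2_le_imp_le)
  have "A \<subseteq> cball 0 (M + \<delta>)"
  proof
    fix x assume "x \<in> A"
    then have "mollified \<delta> x \<noteq> 0" using t by (auto simp: A_def)
    then have "\<not> norm x > M + \<delta>" using mollified_support(1)[of \<delta> M x] M d by auto
    then show "x \<in> cball 0 (M + \<delta>)" by simp
  qed
  then have bA: "bounded A" using bounded_cball bounded_subset by blast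
  have "Z \<subseteq> cball 0 (M + \<eta>)"
  proof
    fix x assume x: "x \<in> Z"
    show "x \<in> cball 0 (M + \<eta>)"
    proof (rule ccontr)
      assume "x \<notin> cball 0 (M + \<eta>)"
      then have n: "norm x > M + \<eta>" by simp
      then have "norm x > M + \<delta>" using de by linarith
      then have "mollified \<delta> x = 0" using mollified_support(1)[of \<delta> M x] M d by auto
      moreover have "boundary_mollified \<eta> x = 0" using mollified_support(2)[of \<eta> M x] M eta(1) n by auto
      ultimately show False using x t by (simp add: Z_def)
    qed
  qed
  then have bZ: "bounded Z" using bounded_cball bounded_subset by blast
  define \<alpha> where "\<alpha> = root DIM(real^('n::{finite,wellorder} option)) (measure lborel A)"
  define \<omega> where "\<omega> = root DIM(real^('n::{finite,wellorder} option)) (measure lborel (inner_parallel \<delta>))"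
  have sub: "inner_parallel \<delta> \<subseteq> A" using mollified_inner_parallel[OF d] t by (auto simp: A_def)
  have Afin: "emeasure lborel A < \<infinity>" "emeasure lborel Z < \<infinity>" using bA bZ emeasure_bounded_finite by auto
  have le: "measure lborel (inner_parallel \<delta>) \<le> measure lborel A"
    using sub Afin by (intro measure_mono_fmeasurable) (auto simp: fmeasurable_def)
  have \<omega>: "0 < \<omega>" unfolding \<omega>_def using pos by (intro real_root_gt_zero) auto
  have \<omega>\<alpha>: "\<omega> \<le> \<alpha>" unfolding \<omega>_def \<alpha>_def using le by (intro real_root_le_mono) auto
  have "measure lborel A = \<alpha> ^ DIM(real^('n::{finite,wellorder} option))"
    unfolding \<alpha>_def by (intro real_root_pow_pos2[symmetric]) auto
  moreover have "0 < \<alpha>" using \<omega> \<omega>\<alpha> by linarith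
  ultimately have \<alpha>: "0 < \<alpha>" "measure lborel A = \<alpha> ^ DIM(real^('n::{finite,wellorder} option))" by simp_all
  have "(\<alpha> + \<epsilon> * unit_ball_root TYPE(real^('n::{finite,wellorder} option))) ^ DIM(real^('n::{finite,wellorder} option)) \<le> measure lborel Z"
  proof (rule brunn_minkowski[of A ?B Z])
    show "bounded ?B" by simp
    show "x + y \<in> Z" if "x \<in> A" "y \<in> ?B" for x y
    proof -
      \<comment> \<open>The increment is applied backwards, from \<open>x + y\<close> to
        \<open>x\<close>, so that its error term sits at the point of \<open>Z\<close>.\<close>
      have "mollified \<delta> ((x + y) + (- y)) \<le> mollified \<delta> (x + y) + \<epsilon> * boundary_mollified \<eta> (x + y)"
        using that d by (intro mollified_increment eta) auto
      then show ?thesis using that by (simp add: A_def Z_def)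
    qed
    show "measure lborel ?B = (\<epsilon> * unit_ball_root TYPE(real^('n::{finite,wellorder} option))) ^ DIM(real^('n::{finite,wellorder} option))" by (rule measure_small_ball[OF e])
    show "0 < \<epsilon> * unit_ball_root TYPE(real^('n::{finite,wellorder} option))" using e unit_ball_root_pos[where 'a="real^('n::{finite,wellorder} option)"] by simp
  qed (use bA bZ \<alpha> in auto)
  moreover have "\<alpha> ^ DIM(real^('n::{finite,wellorder} option)) + real DIM(real^('n::{finite,wellorder} option)) * (\<epsilon> * unit_ball_root TYPE(real^('n::{finite,wellorder} option))) * \<alpha> ^ (DIM(real^('n::{finite,wellorder} option)) - 1) \<le> (\<alpha> + \<epsilon> * unit_ball_root TYPE(real^('n::{finite,wellorder} option))) ^ DIM(real^('n::{finite,wellorder} option))"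
    using \<alpha> e unit_ball_root_pos[where 'a="real^('n::{finite,wellorder} option)"] by (intro Bernoulli_power) auto
  moreover have "real DIM(real^('n::{finite,wellorder} option)) * (\<epsilon> * unit_ball_root TYPE(real^('n::{finite,wellorder} option))) * \<omega> ^ (DIM(real^('n::{finite,wellorder} option)) - 1) \<le> real DIM(real^('n::{finite,wellorder} option)) * (\<epsilon> * unit_ball_root TYPE(real^('n::{finite,wellorder} option))) * \<alpha> ^ (DIM(real^('n::{finite,wellorder} option)) - 1)"
    using \<omega> \<omega>\<alpha> e unit_ball_root_pos[where 'a="real^('n::{finite,wellorder} option)"] by (intro mult_left_mono power_mono) auto
  ultimately have *: "measure lborel A + real DIM(real^('n::{finite,wellorder} option)) * (\<epsilon> * unit_ball_root TYPE(real^('n::{finite,wellorder} option))) * \<omega> ^ (DIM(real^('n::{finite,wellorder} option)) - 1) \<le> measure lborel Z"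
    unfolding \<alpha>(2) by linarith
  have "emeasure lborel A + ennreal (real DIM(real^('n::{finite,wellorder} option)) * (\<epsilon> * unit_ball_root TYPE(real^('n::{finite,wellorder} option))) * \<omega> ^ (DIM(real^('n::{finite,wellorder} option)) - 1)) =
      ennreal (measure lborel A + real DIM(real^('n::{finite,wellorder} option)) * (\<epsilon> * unit_ball_root TYPE(real^('n::{finite,wellorder} option))) * \<omega> ^ (DIM(real^('n::{finite,wellorder} option)) - 1))"
    using Afin \<omega> e unit_ball_root_pos[where 'a="real^('n::{finite,wellorder} option)"] by (subst ennreal_plus) (auto simp: emeasure_eq_ennreal_measure)
  also have "\<dots> \<le> ennreal (measure lborel Z)" using * by (rule ennreal_leI)
  also have "\<dots> = emeasure lborel Z" using Afin by (simp add: emeasure_eq_ennreal_measure)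
  finally show ?thesis by (simp add: A_def Z_def \<omega>_def)
qed

text \<open>Integrated over the levels up to the maximal value \<open>T\<close>, the estimate adds
  \<open>c * T\<close> to the integral of the mollified function on the left, whereas the right side
  is the same integral plus \<open>\<epsilon>\<close> times area times kernel mass. The common
  integral is finite and cancels, and so does the factor
  \<open>\<epsilon> * \<kappa>\<close>.\<close>

lemma isoperimetric_approx:
  assumes d: "\<delta> > 0" and e: "\<epsilon> > 0" and pos: "measure lborel (inner_parallel \<delta>) > 0"
  shows "real DIM(real^('n::{finite,wellorder} option)) * unit_ball_root TYPE(real^('n::{finite,wellorder} option)) * root DIM(real^('n::{finite,wellorder} option)) (measure lborel (inner_parallel \<delta>)) ^ (DIM(real^('n::{finite,wellorder} option)) - 1) * \<delta> ^ (DIM(real^('n::{finite,wellorder} option)) + 4)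
    \<le> measure \<sigma> (frontier \<Omega>) * sqrt (\<delta>\<^sup>2 + 2 * \<epsilon> * (\<delta> + \<epsilon>)) ^ (DIM(real^('n::{finite,wellorder} option)) + 4)"
proof -
  define \<eta> where "\<eta> = sqrt (\<delta>\<^sup>2 + 2 * \<epsilon> * (\<delta> + \<epsilon>))"
  have sq: "\<delta>\<^sup>2 + 2 * \<epsilon> * (\<delta> + \<epsilon>) > 0" using d e by (simp add: add_pos_pos)
  have eta: "\<eta> > 0" "\<eta>\<^sup>2 = \<delta>\<^sup>2 + 2 * \<epsilon> * (\<delta> + \<epsilon>)"
    using sq unfolding \<eta>_def by (auto simp: less_imp_le)
  define \<kappa> where "\<kappa> = kern_mass TYPE(real^('n::{finite,wellorder} option))"
  have \<kappa>: "\<kappa> > 0" unfolding \<kappa>_def by (rule kern_mass_pos)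
  define c where "c = real DIM(real^('n::{finite,wellorder} option)) * (\<epsilon> * unit_ball_root TYPE(real^('n::{finite,wellorder} option))) * root DIM(real^('n::{finite,wellorder} option)) (measure lborel (inner_parallel \<delta>)) ^ (DIM(real^('n::{finite,wellorder} option)) - 1)"
  have c: "c \<ge> 0" unfolding c_def using e unit_ball_root_pos[where 'a="real^('n::{finite,wellorder} option)"] by (intro mult_nonneg_nonneg zero_le_power real_root_ge_zero) auto
  define T where "T = \<delta> ^ (DIM(real^('n::{finite,wellorder} option)) + 4) * \<kappa>"
  have T: "T > 0" using d \<kappa> by (simp add: T_def)
  let ?v = "\<lambda>x. mollified \<delta> x + \<epsilon> * boundary_mollified \<eta> x"
  have vnn: "0 \<le> \<epsilon> * boundary_mollified \<eta> x" for x using e mollified_nonneg by simp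
  have Ufin: "(\<integral>\<^sup>+x. ennreal (mollified \<delta> x) \<partial>lborel) < \<infinity>" by (rule nn_integral_mollified_finite[OF d])
  have lc: "(\<integral>\<^sup>+x. ennreal (f x) \<partial>lborel) = (\<integral>\<^sup>+t. indicator {0<..} t * emeasure lborel {x. t < f x} \<partial>lborel)"
    if "f \<in> borel_measurable borel" "\<And>x. 0 \<le> f x" for f :: "real^('n::{finite,wellorder} option) \<Rightarrow> real"
    using nn_integral_layer_cake[OF lborel.sigma_finite_measure_axioms, of f] that by simp
  have meas: "(\<lambda>t. indicator {0<..} t * emeasure lborel {x. t < mollified \<delta> x}) \<in> borel_measurable lborel"
  proof -
    have "(\<lambda>t. \<integral>\<^sup>+x. (if t < mollified \<delta> x then 1 else 0) \<partial>lborel) \<in> borel_measurable lborel" by measurable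
    moreover have "(\<integral>\<^sup>+x. (if t < mollified \<delta> x then 1 else 0) \<partial>lborel) = emeasure lborel {x. t < mollified \<delta> x}" for t
    proof -
      have "(\<lambda>x. if t < mollified \<delta> x then 1 else 0) = (indicator {x. t < mollified \<delta> x} :: _ \<Rightarrow> ennreal)"
        by (auto simp: indicator_def)
      then show ?thesis by (simp add: nn_integral_indicator)
    qed
    ultimately show ?thesis by simp
  qed
  have "(\<integral>\<^sup>+x. ennreal (mollified \<delta> x) \<partial>lborel) + ennreal (c * T)
     = (\<integral>\<^sup>+t. indicator {0<..} t * emeasure lborel {x. t < mollified \<delta> x} \<partial>lborel) + (\<integral>\<^sup>+t. ennreal c * indicator {0<..<T} t \<partial>lborel)"
    using lc[OF mollified_measurable(1) mollified_nonneg(1)] c T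
    by (simp add: nn_integral_cmult ennreal_mult)
  also have "\<dots> = (\<integral>\<^sup>+t. indicator {0<..} t * emeasure lborel {x. t < mollified \<delta> x} + ennreal c * indicator {0<..<T} t \<partial>lborel)"
    by (rule nn_integral_add[symmetric]) (use meas in auto)
  also have "\<dots> \<le> (\<integral>\<^sup>+t. indicator {0<..} t * emeasure lborel {x. t < ?v x} \<partial>lborel)"
  proof (rule nn_integral_mono)
    fix t :: real
    consider "t \<le> 0" | "0 < t" "t < T" | "T \<le> t" by linarith
    then show "indicator {0<..} t * emeasure lborel {x. t < mollified \<delta> x} + ennreal c * indicator {0<..<T} t
        \<le> indicator {0<..} t * emeasure lborel {x. t < ?v x}"
    proof cases
      case 2
      have "emeasure lborel {x. t < mollified \<delta> x} + ennreal c \<le> emeasure lborel {x. t < ?v x}"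
        unfolding c_def using 2 eta by (intro mollified_level_sets d e pos) (auto simp: T_def \<kappa>_def)
      then show ?thesis using 2 by simp
    next
      case 3
      have "{x. t < mollified \<delta> x} \<subseteq> {x. t < ?v x}" using vnn by (auto intro: less_le_trans)
      then have "emeasure lborel {x. t < mollified \<delta> x} \<le> emeasure lborel {x. t < ?v x}"
        by (intro emeasure_mono) auto
      then show ?thesis using 3 T by simp
    qed simp
  qed
  also have "\<dots> = (\<integral>\<^sup>+x. ennreal (?v x) \<partial>lborel)"
    using mollified_nonneg vnn by (intro lc[symmetric]) auto
  also have "\<dots> = (\<integral>\<^sup>+x. ennreal (mollified \<delta> x) + ennreal \<epsilon> * ennreal (boundary_mollified \<eta> x) \<partial>lborel)"
    using mollified_nonneg e by (intro nn_integral_cong) (simp add: ennreal_plus ennreal_mult)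
  also have "\<dots> = (\<integral>\<^sup>+x. ennreal (mollified \<delta> x) \<partial>lborel) + ennreal \<epsilon> * (\<integral>\<^sup>+x. ennreal (boundary_mollified \<eta> x) \<partial>lborel)"
    by (subst nn_integral_add) (auto simp: nn_integral_cmult)
  also have "\<dots> = (\<integral>\<^sup>+x. ennreal (mollified \<delta> x) \<partial>lborel) + ennreal (\<epsilon> * (measure \<sigma> (frontier \<Omega>) * (\<eta> ^ (DIM(real^('n::{finite,wellorder} option)) + 4) * \<kappa>)))"
    unfolding nn_integral_boundary_mollified[OF eta(1)] \<kappa>_def[symmetric] using e \<kappa> eta by (simp add: ennreal_mult)
  finally have "ennreal (c * T) \<le> ennreal (\<epsilon> * (measure \<sigma> (frontier \<Omega>) * (\<eta> ^ (DIM(real^('n::{finite,wellorder} option)) + 4) * \<kappa>)))"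
    using Ufin by (subst (asm) ennreal_add_left_cancel_le) auto
  then have "c * T \<le> \<epsilon> * (measure \<sigma> (frontier \<Omega>) * (\<eta> ^ (DIM(real^('n::{finite,wellorder} option)) + 4) * \<kappa>))"
    using e \<kappa> eta by (subst (asm) ennreal_le_iff) auto
  then have "(\<epsilon> * \<kappa>) * (real DIM(real^('n::{finite,wellorder} option)) * unit_ball_root TYPE(real^('n::{finite,wellorder} option)) * root DIM(real^('n::{finite,wellorder} option)) (measure lborel (inner_parallel \<delta>)) ^ (DIM(real^('n::{finite,wellorder} option)) - 1) * \<delta> ^ (DIM(real^('n::{finite,wellorder} option)) + 4))
     \<le> (\<epsilon> * \<kappa>) * (measure \<sigma> (frontier \<Omega>) * \<eta> ^ (DIM(real^('n::{finite,wellorder} option)) + 4))"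
    unfolding c_def T_def by (simp only: ac_simps)
  then show ?thesis unfolding \<eta>_def[symmetric]
    using e \<kappa> by (subst (asm) mult_le_cancel_left_pos) auto
qed

text \<open>Letting \<open>\<epsilon>\<close> tend to 0 for fixed \<open>\<delta>\<close> turns the
  wider radius into \<open>\<delta>\<close>, and the powers of \<open>\<delta>\<close>
  cancel.\<close>

lemma isoperimetric_inner_parallel:
  assumes d: "\<delta> > 0" and pos: "measure lborel (inner_parallel \<delta>) > 0"
  shows "real DIM(real^('n::{finite,wellorder} option)) * unit_ball_root TYPE(real^('n::{finite,wellorder} option)) * root DIM(real^('n::{finite,wellorder} option)) (measure lborel (inner_parallel \<delta>)) ^ (DIM(real^('n::{finite,wellorder} option)) - 1) \<le> measure \<sigma> (frontier \<Omega>)"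
proof -
  let ?C = "real DIM(real^('n::{finite,wellorder} option)) * unit_ball_root TYPE(real^('n::{finite,wellorder} option)) * root DIM(real^('n::{finite,wellorder} option)) (measure lborel (inner_parallel \<delta>)) ^ (DIM(real^('n::{finite,wellorder} option)) - 1)"
  let ?f = "\<lambda>\<epsilon>. measure \<sigma> (frontier \<Omega>) * sqrt (\<delta>\<^sup>2 + 2 * \<epsilon> * (\<delta> + \<epsilon>)) ^ (DIM(real^('n::{finite,wellorder} option)) + 4)"
  have "(?f \<longlongrightarrow> measure \<sigma> (frontier \<Omega>) * sqrt (\<delta>\<^sup>2 + 2 * 0 * (\<delta> + 0)) ^ (DIM(real^('n::{finite,wellorder} option)) + 4)) (at_right 0)"
    by (intro tendsto_intros)
  moreover have "\<forall>\<^sub>F \<epsilon> in at_right 0. ?C * \<delta> ^ (DIM(real^('n::{finite,wellorder} option)) + 4) \<le> ?f \<epsilon>"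
    using isoperimetric_approx[OF d _ pos] by (intro eventually_at_right_less[THEN eventually_mono]) auto
  ultimately have "?C * \<delta> ^ (DIM(real^('n::{finite,wellorder} option)) + 4) \<le> measure \<sigma> (frontier \<Omega>) * sqrt (\<delta>\<^sup>2 + 2 * 0 * (\<delta> + 0)) ^ (DIM(real^('n::{finite,wellorder} option)) + 4)"
    by (rule tendsto_lowerbound) simp
  then have "?C * \<delta> ^ (DIM(real^('n::{finite,wellorder} option)) + 4) \<le> measure \<sigma> (frontier \<Omega>) * \<delta> ^ (DIM(real^('n::{finite,wellorder} option)) + 4)"
    using d by simp
  then show ?thesis using d by (subst (asm) mult_le_cancel_right_pos) auto
qed

lemma measure_domain_pos: "measure lborel \<Omega> > 0"
proof -
  have "interior \<Omega> \<noteq> {}" using dom by (simp add: smooth_bounded_domain_def)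
  then obtain x where "x \<in> interior \<Omega>" by blast
  then obtain e where e: "e > 0" "ball x e \<subseteq> \<Omega>" using mem_interior by blast
  have "0 < measure lborel (ball x e)" using e(1) by (rule content_ball_pos)
  also have "\<dots> \<le> measure lborel \<Omega>"
    using e(2) emeasure_bounded_finite[OF compact_imp_bounded[OF compact_domain]]
    by (intro measure_mono_fmeasurable) (auto simp: fmeasurable_def)
  finally show ?thesis .
qed

text \<open>As the radius shrinks, the sets increase to the interior, and the boundary is a Lebesgue
  null set.\<close>

lemma measure_inner_parallel_tendsto:
  "(\<lambda>k. measure lborel (inner_parallel (1 / real (Suc k)))) \<longlonglongrightarrow> measure lborel \<Omega>"
proof -
  let ?I = "\<lambda>k. inner_parallel (1 / real (Suc k))"
  have fin: "emeasure lborel \<Omega> < \<infinity>" using emeasure_bounded_finite[OF compact_imp_bounded[OF compact_domain]] .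
  have "incseq ?I"
  proof (rule incseq_SucI, rule subsetI)
    fix k x assume "x \<in> ?I k"
    moreover have "ball x (1 / real (Suc (Suc k))) \<subseteq> ball x (1 / real (Suc k))"
      by (intro subset_ball) (simp add: field_simps)
    ultimately show "x \<in> ?I (Suc k)" unfolding inner_parallel_def by blast
  qed
  moreover have "(\<Union>k. ?I k) = interior \<Omega>"
  proof (intro equalityI subsetI)
    fix x assume "x \<in> (\<Union>k. ?I k)"
    then obtain k where "ball x (1 / real (Suc k)) \<subseteq> \<Omega>" by (auto simp: inner_parallel_def)
    moreover have "1 / real (Suc k) > 0" by simp
    ultimately show "x \<in> interior \<Omega>" using mem_interior by blast
  next
    fix x assume "x \<in> interior \<Omega>"
    then obtain e where e: "e > 0" "ball x e \<subseteq> \<Omega>" using mem_interior by blast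
    obtain k where "inverse (real (Suc k)) < e" using reals_Archimedean[OF e(1)] by blast
    then have "ball x (1 / real (Suc k)) \<subseteq> ball x e" by (intro subset_ball) (simp add: field_simps)
    then have "ball x (1 / real (Suc k)) \<subseteq> \<Omega>" using e(2) by (rule subset_trans)
    then show "x \<in> (\<Union>k. ?I k)" unfolding inner_parallel_def by blast
  qed
  moreover have "emeasure lborel (interior \<Omega>) \<noteq> \<infinity>"
  proof -
    have "emeasure lborel (interior \<Omega>) \<le> emeasure lborel \<Omega>" using interior_subset by (intro emeasure_mono) auto
    then show ?thesis using fin by auto
  qed
  ultimately have "(\<lambda>k. measure lborel (?I k)) \<longlonglongrightarrow> measure lborel (interior \<Omega>)"
    using Lim_measure_incseq[of ?I lborel] by (auto simp: image_subset_iff)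
  moreover have "emeasure lborel (interior \<Omega>) = emeasure lborel \<Omega>"
  proof (rule antisym)
    show "emeasure lborel (interior \<Omega>) \<le> emeasure lborel \<Omega>" using interior_subset by (intro emeasure_mono) auto
    have "emeasure lborel \<Omega> \<le> emeasure lborel (interior \<Omega> \<union> frontier \<Omega>)"
      using closure_subset by (intro emeasure_mono) (auto simp: frontier_def)
    also have "\<dots> \<le> emeasure lborel (interior \<Omega>) + emeasure lborel (frontier \<Omega>)"
      by (rule emeasure_subadditive) auto
    finally show "emeasure lborel \<Omega> \<le> emeasure lborel (interior \<Omega>)" by (simp add: frontier_null)
  qed
  ultimately show ?thesis by (simp add: measure_def)
qed

theorem isoperimetric:
  "real DIM(real^('n::{finite,wellorder} option)) * unit_ball_root TYPE(real^('n::{finite,wellorder} option)) * root DIM(real^('n::{finite,wellorder} option)) (measure lborel \<Omega>) ^ (DIM(real^('n::{finite,wellorder} option)) - 1) \<le> measure \<sigma> (frontier \<Omega>)"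
proof -
  let ?m = "\<lambda>k. measure lborel (inner_parallel (1 / real (Suc k)))"
  have "(\<lambda>k. real DIM(real^('n::{finite,wellorder} option)) * unit_ball_root TYPE(real^('n::{finite,wellorder} option)) * root DIM(real^('n::{finite,wellorder} option)) (?m k) ^ (DIM(real^('n::{finite,wellorder} option)) - 1)) \<longlonglongrightarrow> real DIM(real^('n::{finite,wellorder} option)) * unit_ball_root TYPE(real^('n::{finite,wellorder} option)) * root DIM(real^('n::{finite,wellorder} option)) (measure lborel \<Omega>) ^ (DIM(real^('n::{finite,wellorder} option)) - 1)"
    by (intro tendsto_intros measure_inner_parallel_tendsto)
  moreover have "\<forall>\<^sub>F k in sequentially. real DIM(real^('n::{finite,wellorder} option)) * unit_ball_root TYPE(real^('n::{finite,wellorder} option)) * root DIM(real^('n::{finite,wellorder} option)) (?m k) ^ (DIM(real^('n::{finite,wellorder} option)) - 1) \<le> measure \<sigma> (frontier \<Omega>)"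
    using order_tendstoD(1)[OF measure_inner_parallel_tendsto measure_domain_pos]
    by eventually_elim (rule isoperimetric_inner_parallel; simp)
  ultimately show ?thesis by (rule tendsto_upperbound) simp
qed

end

subsection \<open>Balls\<close>

text \<open>The origin is removed because it is the critical point of the quadratic; it lies off the
  sphere.\<close>

lemma cball_defining_function:
  fixes R :: real
  assumes "R > 0"
  shows "defining_function (cball (0 :: 'a::euclidean_space) R) (- {0}) (\<lambda>x. x \<bullet> x - R\<^sup>2)"
    and "x \<noteq> 0 \<Longrightarrow> grad (\<lambda>x. x \<bullet> x - R\<^sup>2) x = 2 *\<^sub>R (x :: 'a)"
proof -
  have d: "((\<lambda>x. x \<bullet> x - R\<^sup>2) has_derivative (\<lambda>v. (2 *\<^sub>R x) \<bullet> v)) (at x)" for x :: 'a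
    by (rule derivative_eq_intros refl)+ (auto simp: fun_eq_iff inner_commute)
  show g: "grad (\<lambda>x. x \<bullet> x - R\<^sup>2) x = 2 *\<^sub>R x" for x :: 'a using d by (rule grad_eqI)
  have "smooth_on (\<lambda>x :: 'a. x \<bullet> x - R\<^sup>2) (- {0})"
    unfolding smooth_on_def
  proof
    fix k
    have "Ck_on k (\<lambda>x :: 'a. (\<Sum>b\<in>Basis. (x \<bullet> b) * (x \<bullet> b)) + - R\<^sup>2) (- {0})"
      by (intro Ck_on_add Ck_on_sum Ck_on_mult Ck_on_linear Ck_on_const bounded_linear_inner_left) auto
    then show "Ck_on k (\<lambda>x :: 'a. x \<bullet> x - R\<^sup>2) (- {0})"
      by (rule Ck_on_cong[rotated 2]) (auto simp: euclidean_inner[of x x for x])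
  qed
  moreover have "cball (0 :: 'a) R \<inter> - {0} = {y \<in> - {0}. y \<bullet> y - R\<^sup>2 \<le> 0}"
  proof -
    have "norm y \<le> R \<longleftrightarrow> y \<bullet> y \<le> R\<^sup>2" for y :: 'a
      using assms by (simp add: norm_le_square)
    then have "y \<in> cball 0 R \<longleftrightarrow> y \<bullet> y - R\<^sup>2 \<le> 0" for y :: 'a
      by (simp only: mem_cball dist_0_norm diff_le_0_iff_le)
    then show ?thesis by blast
  qed
  moreover have "\<exists>v. frechet_derivative (\<lambda>x. x \<bullet> x - R\<^sup>2) (at y) v \<noteq> 0" if "y \<in> - {0}" for y :: 'a
  proof -
    have "frechet_derivative (\<lambda>x. x \<bullet> x - R\<^sup>2) (at y) = (\<lambda>v. (2 *\<^sub>R y) \<bullet> v)"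
      using d by (rule frechet_derivative_at[symmetric])
    then show ?thesis using that by (intro exI[of _ y]) simp
  qed
  ultimately show "defining_function (cball (0 :: 'a) R) (- {0}) (\<lambda>x. x \<bullet> x - R\<^sup>2)"
    unfolding defining_function_def by blast
qed

lemma smooth_bounded_domain_cball:
  assumes "R > 0"
  shows "smooth_bounded_domain (cball (0 :: 'a::euclidean_space) R)"
  unfolding smooth_bounded_domain_def
proof (intro conjI ballI)
  show "interior (cball (0 :: 'a) R) \<noteq> {}" using assms by simp
  fix x :: 'a assume "x \<in> frontier (cball 0 R)"
  then have "x \<in> - {0}" using assms by auto
  then show "\<exists>U f. x \<in> U \<and> defining_function (cball 0 R) U f"
    by (intro exI conjI) (assumption, rule cball_defining_function(1)[OF assms])
qed (auto intro: convex_connected)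

lemma eucl_normal_cball:
  fixes x :: "'a::euclidean_space"
  assumes "R > 0" "x \<in> sphere 0 R"
  shows "eucl_normal (cball 0 R) x = x /\<^sub>R R"
proof -
  have "x \<noteq> 0" using assms by auto
  then have "eucl_normal (cball 0 R) x = (2 *\<^sub>R x) /\<^sub>R norm (2 *\<^sub>R x)"
    using eucl_normal_eq[OF cball_defining_function(1)[OF assms(1)], of x]
      cball_defining_function(2)[OF assms(1) \<open>x \<noteq> 0\<close>] assms by simp
  then show ?thesis using assms by simp
qed

text \<open>On a centred sphere the support function is constantly \<open>R\<close>, so its integral
  is \<open>R\<close> times the area. The case \<open>R = 1\<close> evaluates
  \<open>unit_sphere_area\<close>; general \<open>R\<close> serves the equality case.\<close>

lemma area_sphere:
  assumes "R > 0"
  shows "R * measure (riem_area (\<lambda>x. (\<bullet>)) (sphere (0 :: real^('n::{finite,wellorder} option)) R)) (sphere 0 R) =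
    (real CARD('n) + 1) * measure lborel (cball (0 :: real^('n::{finite,wellorder} option)) R)"
proof -
  let ?B = "cball (0 :: real^('n::{finite,wellorder} option)) R"
  interpret smooth_domain ?B by unfold_locales (rule smooth_bounded_domain_cball[OF assms])
  have fr: "frontier ?B = sphere 0 R" by simp
  have "indicator (frontier ?B) x * (x \<bullet> N x) = indicator (frontier ?B) x * R" for x
  proof (cases "x \<in> frontier ?B")
    case True
    then have x: "x \<in> sphere 0 R" unfolding fr .
    have "x \<bullet> x = R\<^sup>2" using x by (simp add: dot_square_norm)
    then show ?thesis
      unfolding eucl_normal_cball[OF assms x] using assms by (simp add: power2_eq_square)
  qed simp
  then have "(\<integral>x. indicator (frontier ?B) x * (x \<bullet> N x) \<partial>\<sigma>) = (\<integral>x. indicator (frontier ?B) x * R \<partial>\<sigma>)"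
    by (simp only:)
  also have "\<dots> = measure \<sigma> (frontier ?B) * R" by (simp del: frontier_cball)
  finally show ?thesis
    using integral_support_function unfolding fr by (simp add: mult.commute add.commute)
qed

lemma unit_sphere_area_eq:
  "unit_sphere_area TYPE('n::{finite,wellorder}) = (real CARD('n) + 1) * unit_ball_root TYPE(real^('n option)) ^ (CARD('n) + 1)"
proof -
  have "measure lborel (cball (0 :: real^('n option)) 1) = unit_ball_root TYPE(real^('n option)) ^ DIM(real^('n option))"
    unfolding content_cball_conv_ball using measure_small_ball[of 1, where 'a="real^('n option)"] by simp
  then show ?thesis
    using area_sphere[of 1, where 'n='n] unfolding unit_sphere_area_def by simp
qed

subsection \<open>Hyperbolic quantities in the chart\<close>

lemma sqrt_one_plus_inner_ge_1: "sqrt (1 + x \<bullet> x) \<ge> 1"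
  by simp

lemma cosh_hyp_r: "cosh (hyp_r x) = sqrt (1 + x \<bullet> x)"
  unfolding hyp_r_eq by (rule cosh_arcosh_real[OF sqrt_one_plus_inner_ge_1])

text \<open>In the chart \<open>norm x\<close> is \<open>sinh r\<close>, and a Euclidean unit vector
  in the radial direction has hyperbolic length \<open>1 / cosh r\<close>; normalising it produces
  the factor \<open>sqrt (1 + x \<bullet> x)\<close>.\<close>

lemma hyp_V_eq: "hyp_V x = sqrt (1 + x \<bullet> x) *\<^sub>R x"
proof (cases "x = 0")
  case True
  then show ?thesis by (simp add: hyp_V_def hyp_radial_def)
next
  case False
  then have xx: "x \<bullet> x > 0" by simp
  have pos: "1 + x \<bullet> x > 0" by (rule one_plus_inner_pos)
  have "hyp_metric x x x = (x \<bullet> x) / (1 + x \<bullet> x)"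
    using pos unfolding hyp_metric_eq by (simp add: field_simps)
  then have r: "sqrt (hyp_metric x x x) = sqrt (x \<bullet> x) / sqrt (1 + x \<bullet> x)" by (simp add: real_sqrt_divide)
  have s: "sinh (hyp_r x) = sqrt (x \<bullet> x)"
    unfolding hyp_r_eq sinh_arcosh_real[OF sqrt_one_plus_inner_ge_1] using pos by simp
  have "sqrt (x \<bullet> x) > 0" using xx by simp
  then show ?thesis unfolding hyp_V_def hyp_radial_def r s by (simp add: divide_inverse)
qed

text \<open>By Cauchy-Schwarz the rank one term leaves at least
  \<open>y \<bullet> y / (1 + x \<bullet> x)\<close> of the Euclidean square.\<close>

lemma hyp_metric_pos_def:
  assumes "hyp_metric x y y = 0"
  shows "y = 0"
proof -
  have "(x \<bullet> y)\<^sup>2 \<le> (x \<bullet> x) * (y \<bullet> y)" by (rule Cauchy_Schwarz_ineq)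
  moreover have "(y \<bullet> y) * (1 + x \<bullet> x) = (x \<bullet> y) * (x \<bullet> y)"
    using assms one_plus_inner_pos[of x] unfolding hyp_metric_eq by (simp add: field_simps)
  ultimately have "y \<bullet> y \<le> 0" by (simp add: power2_eq_square algebra_simps)
  then have "y \<bullet> y = 0" using inner_ge_zero[of y] by linarith
  then show ?thesis by simp
qed

lemma hyp_ball_eq:
  assumes "R > 0"
  shows "hyp_ball 0 R = cball (0 :: 'a::real_inner) (sinh R)"
proof -
  have "hyp_r x \<le> R \<longleftrightarrow> norm x \<le> sinh R" for x :: 'a
  proof -
    have nn: "hyp_r x \<ge> 0" unfolding hyp_r_eq by (rule arcosh_nonneg_real) simp
    have "hyp_r x \<le> R \<longleftrightarrow> cosh (hyp_r x) \<le> cosh R"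
      using cosh_real_nonneg_le_iff[OF nn, of R] assms by simp
    also have "\<dots> \<longleftrightarrow> (sqrt (1 + x \<bullet> x))\<^sup>2 \<le> (cosh R)\<^sup>2"
      unfolding cosh_hyp_r by (rule power_mono_iff[symmetric]) (simp_all add: add_nonneg_nonneg)
    also have "\<dots> \<longleftrightarrow> x \<bullet> x \<le> (sinh R)\<^sup>2"
      using one_plus_inner_pos[of x] by (simp add: cosh_square_eq)
    also have "\<dots> \<longleftrightarrow> norm x \<le> sinh R" using assms by (simp add: norm_le_square)
    finally show ?thesis .
  qed
  then show ?thesis
    unfolding hyp_ball_def by (intro set_eqI) (simp only: mem_Collect_eq mem_cball dist_0_norm)
qed

lemma riem_density_id_hyp_metric:
  fixes x :: "real^'m::finite"
  shows "riem_density hyp_metric (\<lambda>z. z) x = 1 / sqrt (1 + x \<bullet> x)"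
proof -
  have pos: "1 + x \<bullet> x > 0" by (rule one_plus_inner_pos)
  have "(\<chi> i j. hyp_metric x (axis i 1) (axis j 1)) =
      (\<chi> i j. (if i = j then 1 else 0) + x $ i * ((- 1 / (1 + x \<bullet> x)) *\<^sub>R x) $ j)"
    unfolding hyp_metric_eq by (auto simp: vec_eq_iff inner_axis inner_axis_axis axis_one_nth)
  then have "riem_density hyp_metric (\<lambda>z. z) x = sqrt (1 + x \<bullet> ((- 1 / (1 + x \<bullet> x)) *\<^sub>R x))"
    unfolding riem_density_def frechet_derivative_ident by (simp only: det_identity_plus_outer_product)
  also have "1 + x \<bullet> ((- 1 / (1 + x \<bullet> x)) *\<^sub>R x) = 1 / (1 + x \<bullet> x)"
    using pos by (simp add: field_simps)
  finally show ?thesis by (simp add: real_sqrt_divide)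
qed

text \<open>The Riemannian density \<open>1 / sqrt (1 + x \<bullet> x)\<close> is cancelled by the
  weight \<open>cosh (hyp_r x)\<close>.\<close>

lemma Vol_w_eq:
  fixes \<Omega> :: "(real^'m::finite) set"
  assumes [measurable]: "\<Omega> \<in> sets borel"
  shows "Vol_w \<Omega> = measure lborel \<Omega>"
proof -
  have [measurable]: "(\<lambda>x :: real^'m. sqrt (1 + x \<bullet> x)) \<in> borel_measurable borel"
    by measurable
  have "Vol_w \<Omega> = (\<integral>x. indicator \<Omega> x *\<^sub>R sqrt (1 + x \<bullet> x) \<partial>density lborel (\<lambda>x. ennreal (1 / sqrt (1 + x \<bullet> x))))"
    unfolding Vol_w_def riem_volume_def set_lebesgue_integral_def cosh_hyp_r riem_density_id_hyp_metric ..
  also have "\<dots> = (\<integral>x. (1 / sqrt (1 + x \<bullet> x)) *\<^sub>R (indicator \<Omega> x *\<^sub>R sqrt (1 + x \<bullet> x)) \<partial>lborel)"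
    by (rule integral_density) auto
  also have "\<dots> = (\<integral>x. indicator \<Omega> x \<partial>lborel)"
  proof (intro Bochner_Integration.integral_cong refl)
    fix x :: "real^'m"
    have "sqrt (1 + x \<bullet> x) \<noteq> 0" using one_plus_inner_pos[of x] by simp
    then show "(1 / sqrt (1 + x \<bullet> x)) *\<^sub>R (indicator \<Omega> x *\<^sub>R sqrt (1 + x \<bullet> x)) = indicator \<Omega> x"
      by (simp add: indicator_def)
  qed
  also have "\<dots> = measure lborel \<Omega>" by simp
  finally show ?thesis .
qed

text \<open>Thus \<open>hyp_S\<close> is the chart radius of the centred ball that has the same
  weighted volume as \<open>\<Omega>\<close>.\<close>

lemma hyp_S_eq:
  fixes \<Omega> :: "(real^('n::{finite,wellorder} option)) set"
  assumes "\<Omega> \<in> sets borel" "measure lborel \<Omega> > 0"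
  shows "hyp_S \<Omega> = root (CARD('n) + 1) (measure lborel \<Omega>) / unit_ball_root TYPE(real^('n option))"
proof -
  define m where "m = real CARD('n) + 1"
  define \<beta> where "\<beta> = unit_ball_root TYPE(real^('n option))"
  have \<beta>: "\<beta> > 0" unfolding \<beta>_def by (rule unit_ball_root_pos)
  have m: "m > 0" "m = real (CARD('n) + 1)" by (simp_all add: m_def)
  have "hyp_S \<Omega> = m powr (1 / m) * (m * \<beta> ^ (CARD('n) + 1)) powr (- 1 / m) * measure lborel \<Omega> powr (1 / m)"
    unfolding hyp_S_def unit_sphere_area_eq Vol_w_eq[OF assms(1)] m_def[symmetric] \<beta>_def[symmetric] ..
  also have "\<beta> ^ (CARD('n) + 1) = \<beta> powr m" unfolding m(2) by (rule powr_realpow[symmetric]) (rule \<beta>)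
  also have "(m * \<beta> powr m) powr (- 1 / m) = m powr (- (1 / m)) * \<beta> powr (- 1)"
    using m(1) \<beta> by (simp add: powr_mult powr_powr)
  also have "m powr (1 / m) * (m powr (- (1 / m)) * \<beta> powr (- 1)) = inverse \<beta>"
    using m(1) \<beta> by (simp add: powr_minus)
  also have "measure lborel \<Omega> powr (1 / m) = root (CARD('n) + 1) (measure lborel \<Omega>)"
    unfolding m(2) by (rule root_powr_inverse[symmetric]) auto
  finally show ?thesis by (simp add: \<beta>_def divide_inverse mult.commute)
qed

subsection \<open>The one-dimensional inequality\<close>

definition profile :: "real \<Rightarrow> real \<Rightarrow> real" where
  "profile p s = sqrt (1 + s\<^sup>2) * (sqrt (1 + s\<^sup>2) - s) powr p"

lemma sqrt_one_plus_square_gt: "sqrt (1 + s\<^sup>2) > (s :: real)"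
  by (rule real_less_rsqrt) simp

text \<open>In terms of \<open>w = sqrt (1 + s\<^sup>2) - s\<close> one has \<open>s = (1 / w - w) / 2\<close> and
  \<open>profile p s = (w powr (p - 1) + w powr (p + 1)) / 2\<close>; the derivative with respect to \<open>w\<close> of
  \<open>profile p s + b s\<close> is a positive factor times the increasing function \<open>k\<close> below minus \<open>b\<close>.\<close>

lemma profile_tangent:
  fixes p S :: real
  assumes p: "p \<ge> 1" and S: "S > 0"
  obtains a b where "b > 0" "a > 0" "profile p S = a - b * S" "\<And>s. profile p s \<ge> a - b * s"
    "\<And>s. profile p s = a - b * s \<Longrightarrow> s = S"
proof -
  define w where "w s = sqrt (1 + s\<^sup>2) - s" for s :: real
  have wpos: "w s > 0" for s unfolding w_def using sqrt_one_plus_square_gt[of s] by simp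
  have winv: "1 / w s = sqrt (1 + s\<^sup>2) + s" for s
  proof -
    have "w s * (sqrt (1 + s\<^sup>2) + s) = (sqrt (1 + s\<^sup>2))\<^sup>2 - s\<^sup>2" unfolding w_def by (simp add: algebra_simps power2_eq_square)
    also have "\<dots> = 1" by (simp add: add_nonneg_nonneg)
    finally show ?thesis using wpos[of s] by (simp add: field_simps)
  qed
  have ws: "s = (1 / w s - w s) / 2" for s unfolding winv by (simp add: w_def)
  have wsq: "sqrt (1 + s\<^sup>2) = (1 / w s + w s) / 2" for s unfolding winv by (simp add: w_def)
  define k where "k u = u powr p * (p + 1 - 2 / (1 + u\<^sup>2))" for u :: real
  have kmono: "k u < k u'" if "0 < u" "u < u'" for u u'
    unfolding k_def
  proof (rule mult_strict_mono)
    show "u powr p < u' powr p" using that p by (intro powr_less_mono2) auto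
    have u2: "u\<^sup>2 < u'\<^sup>2" using that by (intro power_strict_mono) auto
    have "2 / (1 + u'\<^sup>2) < 2 / (1 + u\<^sup>2)" using u2 by (intro divide_strict_left_mono) (auto intro!: mult_pos_pos add_pos_nonneg)
    then show "p + 1 - 2 / (1 + u\<^sup>2) < p + 1 - 2 / (1 + u'\<^sup>2)" by simp
    \<comment> \<open>Together with \<open>p \<ge> 1\<close> this makes the second factor of
      \<open>k\<close> nonnegative, so that the product of two increasing factors increases.\<close>
    have "2 / (1 + u\<^sup>2) \<le> 2" by (simp add: field_simps add_pos_nonneg)
    then show "0 \<le> p + 1 - 2 / (1 + u\<^sup>2)" using p by linarith
    show "0 < u' powr p" using that by simp
  qed
  \<comment> \<open>The slope for which the derivative of \<open>\<phi>\<close> vanishes at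
    \<open>w S\<close>, that is, for which the line touches the profile at \<open>S\<close>.\<close>
  define b where "b = k (w S)"
  have bpos: "b > 0"
  proof -
    have "2 / (1 + (w S)\<^sup>2) < 2" using wpos[of S] by (simp add: field_simps add_pos_nonneg)
    then show ?thesis unfolding b_def k_def using p wpos[of S] by (intro mult_pos_pos) auto
  qed
  define \<phi> where "\<phi> u = (u powr (p - 1) + u powr (p + 1)) / 2 + b * ((1 / u - u) / 2)" for u :: real
  have prof: "profile p s + b * s = \<phi> (w s)" for s
  proof -
    have "profile p s = sqrt (1 + s\<^sup>2) * w s powr p" by (simp only: profile_def w_def)
    also have "\<dots> = (1 / w s + w s) / 2 * w s powr p" by (simp only: wsq[of s])
    also have "\<dots> = (w s powr (p - 1) + w s powr (p + 1)) / 2"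
      using wpos[of s] by (simp add: powr_diff powr_add field_simps)
    finally have "profile p s = (w s powr (p - 1) + w s powr (p + 1)) / 2" .
    then show ?thesis unfolding \<phi>_def ws[symmetric] by simp
  qed
  have d\<phi>: "(\<phi> has_real_derivative (1 + 1 / u\<^sup>2) / 2 * (k u - b)) (at u)" if u: "u > 0" for u
  proof -
    have D: "(\<phi> has_real_derivative ((p - 1) * u powr (p - 2) + (p + 1) * u powr p) / 2 + b * ((- (1 / u\<^sup>2) - 1) / 2)) (at u)"
    proof -
      have D1: "((\<lambda>u. u powr (p - 1)) has_real_derivative (p - 1) * u powr (p - 1 - 1)) (at u)"
        and D2: "((\<lambda>u. u powr (p + 1)) has_real_derivative (p + 1) * u powr (p + 1 - 1)) (at u)"
        by (rule has_real_derivative_powr[OF u])+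
      have D3: "((\<lambda>u. 1 / u) has_real_derivative - (1 / u\<^sup>2)) (at u)"
        using DERIV_inverse[of u] u by (simp add: inverse_eq_divide power2_eq_square)
      have "(\<phi> has_real_derivative ((p - 1) * u powr (p - 1 - 1) + (p + 1) * u powr (p + 1 - 1)) / 2 + b * ((- (1 / u\<^sup>2) - 1) / 2)) (at u)"
        unfolding \<phi>_def
        by (rule DERIV_add[OF DERIV_cdivide[OF DERIV_add[OF D1 D2]] DERIV_cmult[OF DERIV_cdivide[OF DERIV_diff[OF D3 DERIV_ident]]]])
      then show ?thesis by simp
    qed
    have c: "1 + u\<^sup>2 \<noteq> 0" using add_pos_nonneg[of 1 "u\<^sup>2"] by simp
    have "p + 1 - 2 / (1 + u\<^sup>2) = ((p - 1) + (p + 1) * u\<^sup>2) / (1 + u\<^sup>2)"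
      using c by (simp add: field_simps)
    moreover have "1 + 1 / u\<^sup>2 = (1 + u\<^sup>2) / u\<^sup>2" using u by (simp add: field_simps)
    ultimately have "(1 + 1 / u\<^sup>2) / 2 * k u = u powr p * ((p - 1) + (p + 1) * u\<^sup>2) / (2 * u\<^sup>2)"
      unfolding k_def using c by simp
    also have "\<dots> = ((p - 1) * (u powr p / u\<^sup>2) + (p + 1) * u powr p) / 2"
      using u by (simp add: field_simps)
    also have "u powr p / u\<^sup>2 = u powr (p - 2)"
      using u by (simp add: powr_diff powr_numeral)
    finally have "((p - 1) * u powr (p - 2) + (p + 1) * u powr p) / 2 = (1 + 1 / u\<^sup>2) / 2 * k u" ..
    moreover have "X + b * ((- i - 1) / 2) = (1 + i) / 2 * (K - b)" if "X = (1 + i) / 2 * K" for X i K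
      unfolding that by (simp add: field_simps)
    ultimately have "((p - 1) * u powr (p - 2) + (p + 1) * u powr p) / 2 + b * ((- (1 / u\<^sup>2) - 1) / 2) = (1 + 1 / u\<^sup>2) / 2 * (k u - b)"
      by blast
    then show ?thesis using D by (simp only:)
  qed
  have fac: "(1 + 1 / u\<^sup>2) / 2 > 0" for u :: real by (simp add: add_pos_nonneg)
  \<comment> \<open>Since \<open>k\<close> increases strictly, \<open>\<phi>\<close> decreases
    strictly before \<open>w S\<close> and increases strictly after it; the strictness makes the
    point of contact unique.\<close>
  have lt: "\<phi> (w S) < \<phi> u" if u: "u > 0" "u \<noteq> w S" for u
  proof (cases "u < w S")
    case True
    have cont: "continuous_on {u..w S} \<phi>"
      using d\<phi> u by (intro continuous_at_imp_continuous_on ballI DERIV_isCont) (auto intro!: d\<phi>)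
    show ?thesis
    proof (rule DERIV_neg_imp_decreasing_open[OF True _ cont])
      fix x assume x: "u < x" "x < w S"
      then have "k x - b < 0" using kmono[of x "w S"] u by (simp add: b_def)
      then have "(1 + 1 / x\<^sup>2) / 2 * (k x - b) < 0" using fac[of x] by (rule mult_pos_neg[rotated])
      then show "\<exists>y. (\<phi> has_real_derivative y) (at x) \<and> y < 0" using d\<phi>[of x] x u by auto
    qed
  next
    case False
    then have lt: "w S < u" using u by simp
    have cont: "continuous_on {w S..u} \<phi>"
      using wpos[of S] by (intro continuous_at_imp_continuous_on ballI DERIV_isCont[OF d\<phi>]) auto
    show ?thesis
    proof (rule DERIV_pos_imp_increasing_open[OF lt _ cont])
      fix x assume x: "w S < x" "x < u"
      then have "k x - b > 0" using kmono[of "w S" x] wpos[of S] by (simp add: b_def)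
      then have "(1 + 1 / x\<^sup>2) / 2 * (k x - b) > 0" using fac[of x] by (intro mult_pos_pos)
      moreover have "x > 0" using x wpos[of S] by linarith
      ultimately show "\<exists>y. (\<phi> has_real_derivative y) (at x) \<and> y > 0" using d\<phi>[of x] by auto
    qed
  qed
  define a where "a = profile p S + b * S"
  have a\<phi>: "a = \<phi> (w S)" unfolding a_def by (rule prof)
  have "profile p S > 0" unfolding profile_def
    using sqrt_one_plus_square_gt[of S] by (intro mult_pos_pos) (auto simp: add_pos_nonneg)
  then have apos: "a > 0" unfolding a_def using bpos S by (simp add: add_pos_pos)
  have lower: "profile p s \<ge> a - b * s" for s
    using lt[OF wpos[of s]] prof[of s] a\<phi> by (cases "w s = w S") auto
  have uniq: "s = S" if "profile p s = a - b * s" for s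
  proof -
    have "\<phi> (w s) = \<phi> (w S)" using prof[of s] a\<phi> that by simp
    then have "w s = w S" using lt[OF wpos[of s]] by force
    then show ?thesis using ws[of s] ws[of S] by simp
  qed
  show ?thesis by (rule that[OF bpos apos _ lower uniq]) (simp_all add: a_def)
qed

subsection \<open>The curvature-free form of the integral\<close>

text \<open>The inverse of the metric at \<open>x\<close> is the identity plus \<open>x x^T\<close>,
  so raising the Euclidean conormal \<open>n\<close> gives
  \<open>n + (x \<bullet> n) *\<^sub>R x\<close>, whose hyperbolic length is
  \<open>sqrt (1 + (x \<bullet> n)\<^sup>2)\<close>. The second formula reduces pairings with the
  hyperbolic normal to Euclidean products with \<open>n\<close>.\<close>

lemma is_outward_unit_normal_hyp:
  assumes dom: "smooth_bounded_domain \<Omega>" and x: "x \<in> frontier \<Omega>"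
  defines "n \<equiv> eucl_normal \<Omega> x"
  defines "\<nu> \<equiv> (n + (x \<bullet> n) *\<^sub>R x) /\<^sub>R sqrt (1 + (x \<bullet> n)\<^sup>2)"
  shows "hyp_normal \<Omega> x = \<nu>" and "hyp_metric x \<nu> v = (n \<bullet> v) / sqrt (1 + (x \<bullet> n)\<^sup>2)"
proof -
  define q where "q = sqrt (1 + (x \<bullet> n)\<^sup>2)"
  have q: "q > 0" "q * q = 1 + (x \<bullet> n)\<^sup>2" unfolding q_def by (simp_all add: add_pos_nonneg)
  have n1: "n \<bullet> n = 1" using eucl_normal_unit[OF dom x] by (simp add: n_def dot_square_norm)
  have met: "hyp_metric x \<nu> v = (n \<bullet> v) / q" for v
  proof -
    have pos: "1 + x \<bullet> x > 0" by (rule one_plus_inner_pos)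
    have xv: "x \<bullet> \<nu> = (x \<bullet> n) * (1 + x \<bullet> x) / q"
      unfolding \<nu>_def q_def[symmetric] by (simp add: inner_add_right divide_inverse algebra_simps)
    have "\<nu> \<bullet> v = (n \<bullet> v + (x \<bullet> n) * (x \<bullet> v)) / q"
      unfolding \<nu>_def q_def[symmetric] by (simp add: inner_add_left divide_inverse algebra_simps)
    moreover have "(x \<bullet> \<nu>) * (x \<bullet> v) / (1 + x \<bullet> x) = ((x \<bullet> n) * (x \<bullet> v)) / q"
      unfolding xv using pos by simp
    ultimately show ?thesis unfolding hyp_metric_eq by (simp add: add_divide_distrib)
  qed
  then show "hyp_metric x \<nu> v = (n \<bullet> v) / sqrt (1 + (x \<bullet> n)\<^sup>2)" unfolding q_def .
  have nv: "n \<bullet> \<nu> = q"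
  proof -
    have "n \<bullet> \<nu> = (1 + (x \<bullet> n)\<^sup>2) / q"
      unfolding \<nu>_def q_def[symmetric]
      by (simp add: inner_add_right n1 divide_inverse power2_eq_square inner_commute[of n x] mult.commute)
    then show ?thesis using q(1) unfolding q(2)[symmetric] by simp
  qed
  have grd: "\<exists>c>0. \<forall>v. frechet_derivative f (at x) v = c * (n \<bullet> v)" if "x \<in> U" "defining_function \<Omega> U f" for U f
  proof -
    have g0: "norm (grad f x) > 0" using defining_function_grad(2)[OF that(2,1)] by simp
    have "grad f x = norm (grad f x) *\<^sub>R n"
      unfolding n_def eucl_normal_eq[OF that(2,1) x] using g0 by simp
    then have "frechet_derivative f (at x) v = norm (grad f x) * (n \<bullet> v)" for v
      using defining_function_grad(1)[OF that(2,1), of v] by (metis inner_scaleR_left)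
    then show ?thesis using g0 by blast
  qed
  show "hyp_normal \<Omega> x = \<nu>"
    unfolding hyp_normal_def
  proof (rule the_equality)
    obtain U f where Uf: "x \<in> U" "defining_function \<Omega> U f" using dom x by (rule smooth_bounded_domain_frontierE)
    obtain c where c: "c > 0" "\<And>v. frechet_derivative f (at x) v = c * (n \<bullet> v)" using grd[OF Uf] by blast
    show "is_outward_unit_normal \<Omega> x \<nu>"
      unfolding is_outward_unit_normal_def
    proof (intro conjI exI[of _ U] exI[of _ f] allI impI)
      show "hyp_metric x \<nu> \<nu> = 1" using met[of \<nu>] nv q by simp
      show "hyp_metric x \<nu> v = 0" if "frechet_derivative f (at x) v = 0" for v
        using that c met[of v] by simp
      show "frechet_derivative f (at x) \<nu> > 0" using c nv q by simp
    qed (rule Uf)+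
  next
    fix \<nu>' assume "is_outward_unit_normal \<Omega> x \<nu>'"
    then obtain U f where unit: "hyp_metric x \<nu>' \<nu>' = 1" and Uf: "x \<in> U" "defining_function \<Omega> U f"
      and tan: "\<And>v. frechet_derivative f (at x) v = 0 \<Longrightarrow> hyp_metric x \<nu>' v = 0"
      and out: "frechet_derivative f (at x) \<nu>' > 0"
      unfolding is_outward_unit_normal_def by blast
    obtain c where c: "c > 0" "\<And>v. frechet_derivative f (at x) v = c * (n \<bullet> v)" using grd[OF Uf] by blast
    have add: "hyp_metric x y (v + w) = hyp_metric x y v + hyp_metric x y w" for y v w
      unfolding hyp_metric_eq by (simp add: inner_add_right algebra_simps add_divide_distrib)
    have scale: "hyp_metric x y (r *\<^sub>R v) = r * hyp_metric x y v" for y v r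
      unfolding hyp_metric_eq by (simp add: algebra_simps)
    have diff: "hyp_metric x (y - r *\<^sub>R z) v = hyp_metric x y v - r * hyp_metric x z v" for y z v r
      unfolding hyp_metric_eq by (simp add: inner_diff_left inner_diff_right algebra_simps diff_divide_distrib)
    \<comment> \<open>Removing the \<open>n\<close> component of \<open>v\<close> leaves a tangent
      vector, to which \<open>\<nu>'\<close> is orthogonal. Hence \<open>\<nu>'\<close> is
      determined by the single number \<open>hyp_metric x \<nu>' n\<close>.\<close>
    have nu': "hyp_metric x \<nu>' v = (n \<bullet> v) * hyp_metric x \<nu>' n" for v
    proof -
      have "frechet_derivative f (at x) (v - (n \<bullet> v) *\<^sub>R n) = 0"
        unfolding c(2) by (simp add: inner_diff_right n1)
      then have 0: "hyp_metric x \<nu>' (v - (n \<bullet> v) *\<^sub>R n) = 0" by (rule tan)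
      have "hyp_metric x \<nu>' v = hyp_metric x \<nu>' ((v - (n \<bullet> v) *\<^sub>R n) + (n \<bullet> v) *\<^sub>R n)" by simp
      also have "\<dots> = (n \<bullet> v) * hyp_metric x \<nu>' n" unfolding add scale 0 by simp
      finally show ?thesis .
    qed
    define r where "r = hyp_metric x \<nu>' n * q"
    have "hyp_metric x (\<nu>' - r *\<^sub>R \<nu>) v = 0" for v
      unfolding diff met nu'[of v] r_def using q(1) by simp
    then have "\<nu>' - r *\<^sub>R \<nu> = 0" by (intro hyp_metric_pos_def[of x])
    then have eq: "\<nu>' = r *\<^sub>R \<nu>" by simp
    have "n \<bullet> \<nu>' > 0" using out c by (simp add: zero_less_mult_iff)
    then have r0: "r > 0" unfolding eq using nv q by (simp add: zero_less_mult_iff)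
    have "hyp_metric x \<nu>' \<nu>' = r * (n \<bullet> \<nu>' / q)"
      using diff[of 0 "- r" \<nu> \<nu>'] met[of \<nu>'] by (simp add: eq[symmetric] hyp_metric_eq)
    also have "\<dots> = r * r" unfolding eq using nv q by simp
    finally have "r * r = 1" using unit by simp
    then have "r = 1" using r0 by (simp add: square_eq_1_iff)
    then show "\<nu>' = \<nu>" using eq by simp
  qed
qed

text \<open>A connected set that meets \<open>\<Omega>\<close> but not its frontier stays inside.
  The outward ray from a point of \<open>\<Omega>\<close> beyond the sphere would do so,
  contradicting boundedness; the open ball does so and is therefore contained in
  \<open>\<Omega>\<close>.\<close>

lemma subset_cball_if_frontier_in_sphere:
  fixes \<Omega> :: "'a::euclidean_space set"
  assumes comp: "compact \<Omega>" and int: "interior \<Omega> \<noteq> {}" and fr: "frontier \<Omega> \<subseteq> sphere 0 R" and R: "R > 0"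
  shows "\<Omega> = cball 0 R"
proof
  show sub: "\<Omega> \<subseteq> cball 0 R"
  proof
    fix y assume y: "y \<in> \<Omega>"
    show "y \<in> cball 0 R"
    proof (rule ccontr)
      assume "y \<notin> cball 0 R"
      then have ny: "norm y > R" by simp
      obtain M where M: "\<And>z. z \<in> \<Omega> \<Longrightarrow> norm z \<le> M" using compact_imp_bounded[OF comp] bounded_iff by blast
      let ?ray = "(\<lambda>t. t *\<^sub>R y) ` {1::real..}"
      have "connected ?ray"
        by (intro connected_continuous_image continuous_intros convex_connected convex_real_interval)
      moreover have "?ray \<inter> \<Omega> \<noteq> {}" using y by (auto intro!: image_eqI[of _ _ 1])
      moreover have "?ray - \<Omega> \<noteq> {}"
      proof -
        define t where "t = max 1 ((\<bar>M\<bar> + 1) / norm y)"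
        have y0: "norm y > 0" using ny R by linarith
        have "(\<bar>M\<bar> + 1) / norm y \<le> t" by (simp add: t_def)
        then have "\<bar>M\<bar> + 1 \<le> t * norm y" using y0 by (simp add: field_simps)
        moreover have "t \<ge> 1" by (simp add: t_def)
        ultimately have "norm (t *\<^sub>R y) > M" by simp
        then have "t *\<^sub>R y \<notin> \<Omega>" using M by fastforce
        then show ?thesis using \<open>t \<ge> 1\<close> by blast
      qed
      ultimately have "?ray \<inter> frontier \<Omega> \<noteq> {}" by (rule connected_Int_frontier)
      then obtain t where "t \<ge> 1" "t *\<^sub>R y \<in> frontier \<Omega>" by auto
      then have t: "t \<ge> 1" "t *\<^sub>R y \<in> sphere 0 R" using fr by blast+
      then have "R = t * norm y" by simp
      moreover have "1 * norm y \<le> t * norm y" using t by (intro mult_right_mono) auto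
      ultimately show False using ny by simp
    qed
  qed
  have "interior \<Omega> \<subseteq> ball 0 R" using interior_mono[OF sub] by simp
  then have ne: "ball 0 R \<inter> \<Omega> \<noteq> {}" using int interior_subset by blast
  have "ball 0 R \<subseteq> \<Omega>"
  proof (rule ccontr)
    assume "\<not> ball 0 R \<subseteq> \<Omega>"
    then have "ball 0 R \<inter> frontier \<Omega> \<noteq> {}"
      using ne by (intro connected_Int_frontier) auto
    then show False using fr by auto
  qed
  then have "closure (ball 0 R) \<subseteq> \<Omega>" using compact_imp_closed[OF comp] by (rule closure_minimal)
  then show "cball 0 R \<subseteq> \<Omega>" using R by simp
qed

section \<open>The integral against Euclidean area and its pointwise lower bound\<close>

context smooth_domain
begin

text \<open>What remains of the integrand against Euclidean area: the outer \<open>cosh r\<close>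
  cancels the denominator of \<open>hyp_weight\<close>, and with \<open>s = x \<bullet> N x\<close>
  the support function \<open>hyp_u\<close> is
  \<open>cosh r * s / sqrt (1 + s\<^sup>2)\<close>.\<close>

definition integrand :: "real \<Rightarrow> real^('n option) \<Rightarrow> real" where
  "integrand p x = sqrt (1 + (x \<bullet> N x)\<^sup>2) *
     (sqrt (1 + x \<bullet> x) * (1 - (x \<bullet> N x) / sqrt (1 + (x \<bullet> N x)\<^sup>2))) powr p"

lemma hyp_integral_eq:
  "(LINT x:frontier \<Omega>|riem_area hyp_metric (frontier \<Omega>). cosh (hyp_r x) * (cosh (hyp_r x) - hyp_u \<Omega> x) powr p) =
   (\<integral>x. indicator (frontier \<Omega>) x * integrand p x \<partial>\<sigma>)"
proof -
  let ?G = "\<lambda>x. cosh (hyp_r x) * (cosh (hyp_r x) - hyp_u \<Omega> x) powr p"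
  have G: "?G x = sqrt (1 + x \<bullet> x) * (sqrt (1 + x \<bullet> x) * (1 - (x \<bullet> N x) / sqrt (1 + (x \<bullet> N x)\<^sup>2))) powr p"
    if x: "x \<in> frontier \<Omega>" for x
  proof -
    have "hyp_u \<Omega> x = hyp_metric x (hyp_normal \<Omega> x) (hyp_V x)"
      unfolding hyp_u_def hyp_metric_eq by (simp add: inner_commute mult.commute)
    also have "\<dots> = (N x \<bullet> hyp_V x) / sqrt (1 + (x \<bullet> N x)\<^sup>2)"
      unfolding is_outward_unit_normal_hyp(1)[OF dom x] by (rule is_outward_unit_normal_hyp(2)[OF dom x])
    also have "\<dots> = sqrt (1 + x \<bullet> x) * ((x \<bullet> N x) / sqrt (1 + (x \<bullet> N x)\<^sup>2))"
      unfolding hyp_V_eq by (simp add: inner_commute)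
    finally show ?thesis unfolding cosh_hyp_r by (simp add: right_diff_distrib)
  qed
  have nz: "sqrt (1 + x \<bullet> x) \<noteq> 0" for x :: "real^('n::{finite,wellorder} option)"
    using one_plus_inner_pos[of x] by simp
  have Gm: "(\<lambda>x. indicator (frontier \<Omega>) x *\<^sub>R ?G x) \<in> borel_measurable borel"
  proof -
    \<comment> \<open>Continuity of \<open>N\<close> is known on the frontier alone, so the
      indicator is moved inside to obtain a function measurable on the whole space.\<close>
    have [measurable]: "(\<lambda>x. indicator (frontier \<Omega>) x *\<^sub>R N x) \<in> borel_measurable borel"
      by (rule borel_measurable_on_frontier[OF continuous_normal])
    have "(\<lambda>x. indicator (frontier \<Omega>) x *\<^sub>R (sqrt (1 + x \<bullet> x) * (sqrt (1 + x \<bullet> x) *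
        (1 - (x \<bullet> (indicator (frontier \<Omega>) x *\<^sub>R N x)) / sqrt (1 + (x \<bullet> (indicator (frontier \<Omega>) x *\<^sub>R N x))\<^sup>2))) powr p)) \<in> borel_measurable borel"
      by measurable
    also have "(\<lambda>x. indicator (frontier \<Omega>) x *\<^sub>R (sqrt (1 + x \<bullet> x) * (sqrt (1 + x \<bullet> x) *
        (1 - (x \<bullet> (indicator (frontier \<Omega>) x *\<^sub>R N x)) / sqrt (1 + (x \<bullet> (indicator (frontier \<Omega>) x *\<^sub>R N x))\<^sup>2))) powr p)) =
        (\<lambda>x. indicator (frontier \<Omega>) x *\<^sub>R ?G x)"
    proof
      fix x show "indicator (frontier \<Omega>) x *\<^sub>R (sqrt (1 + x \<bullet> x) * (sqrt (1 + x \<bullet> x) *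
        (1 - (x \<bullet> (indicator (frontier \<Omega>) x *\<^sub>R N x)) / sqrt (1 + (x \<bullet> (indicator (frontier \<Omega>) x *\<^sub>R N x))\<^sup>2))) powr p) =
        indicator (frontier \<Omega>) x *\<^sub>R ?G x"
        by (cases "x \<in> frontier \<Omega>") (simp_all add: G)
    qed
    finally show ?thesis .
  qed
  have wm: "(\<lambda>x. indicator (frontier \<Omega>) x * hyp_weight x) \<in> borel_measurable \<sigma>"
    using borel_measurable_on_frontier[OF hyp_weight_continuous] by simp
  have "(LINT x:frontier \<Omega>|riem_area hyp_metric (frontier \<Omega>). ?G x) =
      (\<integral>x. indicator (frontier \<Omega>) x *\<^sub>R ?G x \<partial>density \<sigma> (\<lambda>x. ennreal (indicator (frontier \<Omega>) x * hyp_weight x)))"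
    unfolding set_lebesgue_integral_def riem_area_hyp_metric ..
  also have "\<dots> = (\<integral>x. (indicator (frontier \<Omega>) x * hyp_weight x) *\<^sub>R (indicator (frontier \<Omega>) x *\<^sub>R ?G x) \<partial>\<sigma>)"
  proof (rule integral_density[OF _ wm])
    show "(\<lambda>x. indicator (frontier \<Omega>) x *\<^sub>R ?G x) \<in> borel_measurable \<sigma>" using Gm by simp
    show "AE x in \<sigma>. 0 \<le> indicator (frontier \<Omega>) x * hyp_weight x"
      by (intro AE_I2) (auto simp: hyp_weight_def indicator_def)
  qed
  also have "\<dots> = (\<integral>x. indicator (frontier \<Omega>) x * integrand p x \<partial>\<sigma>)"
  proof (intro Bochner_Integration.integral_cong refl)
    fix x
    show "(indicator (frontier \<Omega>) x * hyp_weight x) *\<^sub>R (indicator (frontier \<Omega>) x *\<^sub>R ?G x) = indicator (frontier \<Omega>) x * integrand p x"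
    proof (cases "x \<in> frontier \<Omega>")
      case True
      have "hyp_weight x * ?G x = integrand p x"
        unfolding G[OF True] hyp_weight_def integrand_def using nz[of x] by simp
      then show ?thesis using True by simp
    qed simp
  qed
  finally show ?thesis .
qed

lemma support_function_le: "x \<in> frontier \<Omega> \<Longrightarrow> (x \<bullet> N x)\<^sup>2 \<le> x \<bullet> x"
  using Cauchy_Schwarz_ineq[of x "N x"] norm_normal[of x] by (simp add: dot_square_norm)

lemma integrand_eq:
  assumes "x \<in> frontier \<Omega>"
  shows "integrand p x = sqrt (1 + (x \<bullet> N x)\<^sup>2) *
     ((sqrt (1 + x \<bullet> x) / sqrt (1 + (x \<bullet> N x)\<^sup>2)) * (sqrt (1 + (x \<bullet> N x)\<^sup>2) - x \<bullet> N x)) powr p"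
proof -
  have "sqrt (1 + (x \<bullet> N x)\<^sup>2) \<noteq> 0" using add_pos_nonneg[of 1 "(x \<bullet> N x)\<^sup>2"] by simp
  then show ?thesis unfolding integrand_def by (simp add: field_simps)
qed

text \<open>The base of the power is that of \<open>profile\<close> times \<open>q\<close>, and
  \<open>q \<ge> 1\<close> by Cauchy-Schwarz. Strict monotonicity of the power in its base turns
  equality into \<open>q = 1\<close>.\<close>

lemma integrand_ge_profile:
  assumes x: "x \<in> frontier \<Omega>" and p: "p > 0"
  shows "profile p (x \<bullet> N x) \<le> integrand p x"
    and "integrand p x = profile p (x \<bullet> N x) \<Longrightarrow> x \<bullet> x = (x \<bullet> N x)\<^sup>2"
proof -
  define s where "s = x \<bullet> N x"
  define q where "q = sqrt (1 + x \<bullet> x) / sqrt (1 + s\<^sup>2)"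
  have c: "sqrt (1 + s\<^sup>2) > 0" by (simp add: add_pos_nonneg)
  have w: "sqrt (1 + s\<^sup>2) - s > 0" using sqrt_one_plus_square_gt[of s] by simp
  have I: "integrand p x = sqrt (1 + s\<^sup>2) * (q * (sqrt (1 + s\<^sup>2) - s)) powr p"
    unfolding q_def s_def by (rule integrand_eq[OF x])
  have "sqrt (1 + s\<^sup>2) \<le> sqrt (1 + x \<bullet> x)" using support_function_le[OF x] by (simp add: s_def)
  then have q: "q \<ge> 1" unfolding q_def using c by simp
  have "1 * (sqrt (1 + s\<^sup>2) - s) \<le> q * (sqrt (1 + s\<^sup>2) - s)" using q w by (intro mult_right_mono) auto
  then show "profile p (x \<bullet> N x) \<le> integrand p x"
    unfolding I profile_def s_def[symmetric] using w p c by (intro mult_left_mono powr_mono2) auto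
  assume "integrand p x = profile p (x \<bullet> N x)"
  then have "(q * (sqrt (1 + s\<^sup>2) - s)) powr p = (sqrt (1 + s\<^sup>2) - s) powr p"
    unfolding I profile_def s_def[symmetric] using c by simp
  then have "q * (sqrt (1 + s\<^sup>2) - s) = sqrt (1 + s\<^sup>2) - s"
    using q w p powr_less_mono2[of p "sqrt (1 + s\<^sup>2) - s" "q * (sqrt (1 + s\<^sup>2) - s)"]
    by (cases "q = 1") (auto simp: less_le)
  then have "q = 1" using w by simp
  then have "sqrt (1 + x \<bullet> x) = sqrt (1 + s\<^sup>2)" unfolding q_def using c by simp
  then show "x \<bullet> x = (x \<bullet> N x)\<^sup>2" by (simp add: s_def)
qed

lemma integrand_continuous:
  "continuous_on (frontier \<Omega>) (integrand p)"
proof -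
  have c: "sqrt (1 + s\<^sup>2) > 0" for s :: real by (simp add: add_pos_nonneg)
  have "sqrt (1 + x \<bullet> x) * (1 - (x \<bullet> N x) / sqrt (1 + (x \<bullet> N x)\<^sup>2)) > 0" for x
  proof (rule mult_pos_pos)
    show "sqrt (1 + x \<bullet> x) > 0" using one_plus_inner_pos[of x] by simp
    show "1 - (x \<bullet> N x) / sqrt (1 + (x \<bullet> N x)\<^sup>2) > 0"
      using sqrt_one_plus_square_gt[of "x \<bullet> N x"] c[of "x \<bullet> N x"] by simp
  qed
  then have nz: "sqrt (1 + x \<bullet> x) * (1 - (x \<bullet> N x) / sqrt (1 + (x \<bullet> N x)\<^sup>2)) \<noteq> 0" for x
    by (metis less_irrefl)
  have "sqrt (1 + s\<^sup>2) \<noteq> 0" for s :: real using c[of s] by simp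
  then show ?thesis unfolding integrand_def[abs_def]
    by (intro continuous_intros continuous_normal ballI nz)
qed

text \<open>The difference is nonnegative with integral 0, hence zero almost everywhere. A point
  where it is nonzero would have a whole neighbourhood of such points, which has positive
  area.\<close>

lemma continuous_eq_on_frontier_if_integral_eq:
  assumes F: "continuous_on (frontier \<Omega>) F" and G: "continuous_on (frontier \<Omega>) G"
    and le: "\<And>x. x \<in> frontier \<Omega> \<Longrightarrow> G x \<le> (F x :: real)"
    and int: "(\<integral>x. indicator (frontier \<Omega>) x * F x \<partial>\<sigma>) \<le> (\<integral>x. indicator (frontier \<Omega>) x * G x \<partial>\<sigma>)"
    and x: "x \<in> frontier \<Omega>"
  shows "F x = G x"
proof (rule ccontr)
  assume ne: "F x \<noteq> G x"
  let ?D = "\<lambda>x. indicator (frontier \<Omega>) x * (F x - G x)"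
  have D: "continuous_on (frontier \<Omega>) (\<lambda>x. F x - G x)" by (intro continuous_intros F G)
  have iF: "integrable \<sigma> (\<lambda>x. indicator (frontier \<Omega>) x * F x)" and iG: "integrable \<sigma> (\<lambda>x. indicator (frontier \<Omega>) x * G x)"
    and iD: "integrable \<sigma> ?D"
    using integrable_on_frontier[OF F] integrable_on_frontier[OF G] integrable_on_frontier[OF D]
    by (simp_all add: set_integrable_def)
  have nn: "0 \<le> ?D x" for x using le by (simp add: indicator_def)
  have "(\<integral>x. ?D x \<partial>\<sigma>) = (\<integral>x. indicator (frontier \<Omega>) x * F x \<partial>\<sigma>) - (\<integral>x. indicator (frontier \<Omega>) x * G x \<partial>\<sigma>)"
    using Bochner_Integration.integral_diff[OF iF iG] by (simp add: right_diff_distrib)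
  then have "(\<integral>x. ?D x \<partial>\<sigma>) = 0"
    using int Bochner_Integration.integral_nonneg[of \<sigma> ?D] nn by fastforce
  then have ae: "AE x in \<sigma>. ?D x = 0"
    using integral_nonneg_eq_0_iff_AE[OF iD] nn by simp
  have "openin (top_of_set (frontier \<Omega>)) (frontier \<Omega> \<inter> (\<lambda>x. F x - G x) -` (- {0}))"
    by (intro continuous_openin_preimage_gen[OF D]) auto
  then obtain U where U: "open U" "frontier \<Omega> \<inter> (\<lambda>x. F x - G x) -` (- {0}) = frontier \<Omega> \<inter> U"
    unfolding openin_open by blast
  have "x \<in> U" using ne x U by auto
  then have "emeasure \<sigma> (frontier \<Omega> \<inter> U) > 0" by (rule area_pos_open[OF U(1) x])
  moreover have "emeasure \<sigma> (frontier \<Omega> \<inter> U) = 0"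
  proof (rule emeasure_eq_0_AE[THEN trans[rotated]])
    show "emeasure \<sigma> (frontier \<Omega> \<inter> U) = emeasure \<sigma> {x \<in> space \<sigma>. x \<in> frontier \<Omega> \<inter> U}" by (auto intro!: arg_cong[where f="emeasure \<sigma>"])
    show "AE x in \<sigma>. \<not> (x \<in> frontier \<Omega> \<inter> U)"
      using ae
    proof eventually_elim
      case (elim y)
      show ?case
      proof
        assume y: "y \<in> frontier \<Omega> \<inter> U"
        then have "y \<in> frontier \<Omega> \<inter> (\<lambda>x. F x - G x) -` (- {0})" using U(2) by simp
        then show False using elim by simp
      qed
    qed
  qed
  ultimately show False by simp
qed

end

section \<open>The integrated tangent bound and the case of equality\<close>

theorem theorem11p7:
  fixes \<Omega> :: "(real ^ ('n::{finite,wellorder} option)) set" and p :: real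
  assumes "smooth_bounded_domain \<Omega>" and "p \<ge> 1"
  shows
    "let I = (LINT x:frontier \<Omega>|riem_area hyp_metric (frontier \<Omega>).
                cosh (hyp_r x) * (cosh (hyp_r x) - hyp_u \<Omega> x) powr p);
         S = hyp_S \<Omega>;
         J = unit_sphere_area TYPE('n) * S ^ CARD('n) * sqrt (S\<^sup>2 + 1) *
             (S + sqrt (S\<^sup>2 + 1)) powr (- p)
     in I \<ge> J \<and> (I = J \<longleftrightarrow> (\<exists>R>0. \<Omega> = hyp_ball 0 R))"
proof -
  interpret smooth_domain \<Omega> by unfold_locales (rule assms(1))
  define n where "n = CARD('n)"
  define \<beta> where "\<beta> = unit_ball_root TYPE(real^('n option))"
  define \<rho> where "\<rho> = root (n + 1) (measure lborel \<Omega>)"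
  define S where "S = hyp_S \<Omega>"
  define A where "A = measure \<sigma> (frontier \<Omega>)"
  define \<omega> where "\<omega> = unit_sphere_area TYPE('n)"
  define I where "I = (\<integral>x. indicator (frontier \<Omega>) x * integrand p x \<partial>\<sigma>)"
  have \<beta>: "\<beta> > 0" unfolding \<beta>_def by (rule unit_ball_root_pos)
  have \<omega>: "\<omega> = (real n + 1) * \<beta> ^ (n + 1)" unfolding \<omega>_def n_def \<beta>_def by (rule unit_sphere_area_eq)
  have \<rho>: "\<rho> > 0" "\<rho> ^ (n + 1) = measure lborel \<Omega>"
    using measure_domain_pos real_root_gt_zero[of "n + 1"] real_root_pow_pos2[of "n + 1" "measure lborel \<Omega>"]
    unfolding \<rho>_def by (simp_all del: power_Suc)
  have S: "S = \<rho> / \<beta>" unfolding S_def \<rho>_def \<beta>_def n_def using measure_domain_pos by (intro hyp_S_eq) auto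
  have Spos: "S > 0" using S \<rho> \<beta> by simp
  have dimE: "DIM(real^('n option)) = n + 1" by (simp add: n_def)
  \<comment> \<open>Rewritten with \<open>\<omega>\<close> and \<open>S\<close>, the Euclidean
    isoperimetric bound is the area of the sphere of radius \<open>S\<close>.\<close>
  have iso: "\<omega> * S ^ n \<le> A"
  proof -
    have "\<omega> * S ^ n = (real n + 1) * \<beta> * \<rho> ^ n"
      unfolding \<omega> S using \<beta> by (simp add: power_divide)
    also have "\<dots> \<le> A" using isoperimetric unfolding dimE A_def \<rho>_def \<beta>_def by (simp add: add.commute)
    finally show ?thesis .
  qed
  have supp: "(\<integral>x. indicator (frontier \<Omega>) x * (x \<bullet> N x) \<partial>\<sigma>) = \<omega> * S ^ (n + 1)"
  proof -
    have "\<omega> * S ^ (n + 1) = (real n + 1) * \<rho> ^ (n + 1)"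
      unfolding \<omega> S using \<beta> by (simp add: power_divide)
    then show ?thesis unfolding integral_support_function dimE \<rho>(2) by simp
  qed
  \<comment> \<open>The numbers \<open>sqrt (1 + S\<^sup>2) - S\<close> and
    \<open>S + sqrt (1 + S\<^sup>2)\<close> are reciprocal, so the right side of the theorem is the
    profile at \<open>S\<close> times the area of the comparison sphere.\<close>
  have J: "\<omega> * S ^ n * sqrt (S\<^sup>2 + 1) * (S + sqrt (S\<^sup>2 + 1)) powr (- p) = \<omega> * S ^ n * profile p S"
  proof -
    have "(sqrt (1 + S\<^sup>2) - S) * (S + sqrt (1 + S\<^sup>2)) = (sqrt (1 + S\<^sup>2))\<^sup>2 - S\<^sup>2"
      by (simp add: algebra_simps power2_eq_square)
    also have "\<dots> = 1" by (simp add: add_nonneg_nonneg)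
    finally have "sqrt (1 + S\<^sup>2) - S = 1 / (S + sqrt (1 + S\<^sup>2))"
      using Spos by (intro eq_divide_imp) (auto simp: add_pos_nonneg less_imp_neq[symmetric] add_pos_pos)
    then have "(sqrt (1 + S\<^sup>2) - S) powr p = (S + sqrt (1 + S\<^sup>2)) powr (- p)"
      using Spos by (simp add: powr_minus powr_divide divide_inverse add_pos_nonneg inverse_powr)
    then show ?thesis unfolding profile_def by (simp add: add.commute)
  qed
  obtain a b where b: "b > 0" and a: "a > 0" "profile p S = a - b * S"
    and tang: "\<And>s. profile p s \<ge> a - b * s" and tang_eq: "\<And>s. profile p s = a - b * s \<Longrightarrow> s = S"
    by (rule profile_tangent[OF assms(2) Spos], rule that)
  have cont: "continuous_on (frontier \<Omega>) (\<lambda>x. a - b * (x \<bullet> N x))"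
    by (intro continuous_intros continuous_normal)
  have lower: "a - b * (x \<bullet> N x) \<le> integrand p x" if "x \<in> frontier \<Omega>" for x
    using tang[of "x \<bullet> N x"] integrand_ge_profile(1)[OF that, of p] assms(2) by linarith
  have intT: "(\<integral>x. indicator (frontier \<Omega>) x * (a - b * (x \<bullet> N x)) \<partial>\<sigma>) = a * A - b * (\<omega> * S ^ (n + 1))"
  proof -
    have c1: "continuous_on (frontier \<Omega>) (\<lambda>x. x \<bullet> N x)" by (intro continuous_intros continuous_normal)
    have i1: "integrable \<sigma> (\<lambda>x. indicator (frontier \<Omega>) x * (x \<bullet> N x))"
      using integrable_on_frontier[OF c1] by (simp add: set_integrable_def)
    have i2: "integrable \<sigma> (\<lambda>x. indicator (frontier \<Omega>) x :: real)"
      using integrable_on_frontier[of "\<lambda>_. 1 :: real"] by (simp add: set_integrable_def)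
    have "(\<integral>x. indicator (frontier \<Omega>) x * (a - b * (x \<bullet> N x)) \<partial>\<sigma>) =
       (\<integral>x. a * indicator (frontier \<Omega>) x - b * (indicator (frontier \<Omega>) x * (x \<bullet> N x)) \<partial>\<sigma>)"
      by (intro Bochner_Integration.integral_cong refl) (simp add: algebra_simps)
    also have "\<dots> = a * (\<integral>x. indicator (frontier \<Omega>) x \<partial>\<sigma>) - b * (\<integral>x. indicator (frontier \<Omega>) x * (x \<bullet> N x) \<partial>\<sigma>)"
      using i1 i2 by simp
    finally show ?thesis unfolding supp by (simp add: A_def)
  qed
  have iI: "integrable \<sigma> (\<lambda>x. indicator (frontier \<Omega>) x * integrand p x)"
    using integrable_on_frontier[OF integrand_continuous] by (simp add: set_integrable_def)
  have iT: "integrable \<sigma> (\<lambda>x. indicator (frontier \<Omega>) x * (a - b * (x \<bullet> N x)))"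
    using integrable_on_frontier[OF cont] by (simp add: set_integrable_def)
  have "a * A - b * (\<omega> * S ^ (n + 1)) \<le> I"
    unfolding intT[symmetric] I_def using lower by (intro integral_mono iI iT) (simp add: indicator_def)
  \<comment> \<open>The volume term is the same on both sides; what remains is the isoperimetric
    inequality multiplied by \<open>a\<close>.\<close>
  moreover have Jle: "\<omega> * S ^ n * profile p S \<le> a * A - b * (\<omega> * S ^ (n + 1))"
  proof -
    have "\<omega> * S ^ n * profile p S = a * (\<omega> * S ^ n) - b * (\<omega> * S ^ (n + 1))"
      unfolding a(2) by (simp add: algebra_simps)
    moreover have "a * (\<omega> * S ^ n) \<le> a * A" using iso a(1) by (intro mult_left_mono) auto
    ultimately show ?thesis by linarith
  qed
  ultimately have ineq: "\<omega> * S ^ n * profile p S \<le> I" by linarith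
  have eq: "I = \<omega> * S ^ n * profile p S \<longleftrightarrow> (\<exists>R>0. \<Omega> = hyp_ball 0 R)"
  proof
    assume "I = \<omega> * S ^ n * profile p S"
    \<comment> \<open>Equality makes the integrand and its linear lower bound have the same
      integral, so they agree at every boundary point. Both pointwise estimates are then sharp,
      which fixes \<open>x \<bullet> N x\<close> and the norm of \<open>x\<close>.\<close>
    then have le: "I \<le> (\<integral>x. indicator (frontier \<Omega>) x * (a - b * (x \<bullet> N x)) \<partial>\<sigma>)"
      using Jle unfolding intT by linarith
    have "frontier \<Omega> \<subseteq> sphere 0 S"
    proof
      fix x assume x: "x \<in> frontier \<Omega>"
      have e: "integrand p x = a - b * (x \<bullet> N x)"
        by (rule continuous_eq_on_frontier_if_integral_eq[OF integrand_continuous cont lower le[unfolded I_def] x])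
      have ge: "profile p (x \<bullet> N x) \<le> integrand p x" using integrand_ge_profile(1)[OF x, of p] assms(2) by linarith
      have pe: "profile p (x \<bullet> N x) = a - b * (x \<bullet> N x)" using tang[of "x \<bullet> N x"] e ge by linarith
      then have "x \<bullet> N x = S" by (rule tang_eq)
      moreover have "x \<bullet> x = (x \<bullet> N x)\<^sup>2"
        by (rule integrand_ge_profile(2)[OF x, of p]) (use assms(2) e pe in auto)
      ultimately have "(norm x)\<^sup>2 = S\<^sup>2" by (simp add: power2_norm_eq_inner)
      then show "x \<in> sphere 0 S" using Spos by (simp add: power2_eq_iff_nonneg)
    qed
    then have "\<Omega> = cball 0 S"
      using assms(1) Spos unfolding smooth_bounded_domain_def by (intro subset_cball_if_frontier_in_sphere) auto
    moreover have "hyp_ball 0 (arsinh S) = cball (0 :: real^('n option)) S"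
      using hyp_ball_eq[of "arsinh S"] Spos by simp
    ultimately show "\<exists>R>0. \<Omega> = hyp_ball 0 R" using Spos by (intro exI[of _ "arsinh S"]) simp
  next
    assume "\<exists>R>0. \<Omega> = hyp_ball 0 R"
    then obtain R where R: "R > 0" "\<Omega> = hyp_ball 0 R" by blast
    define r where "r = sinh R"
    have r: "r > 0" using R(1) by (simp add: r_def)
    have Om: "\<Omega> = cball 0 r" unfolding R(2) r_def by (rule hyp_ball_eq[OF R(1)])
    have fr: "frontier \<Omega> = sphere 0 r" unfolding Om by simp
    have vol: "measure lborel \<Omega> = (r * \<beta>) ^ (n + 1)"
      unfolding Om content_cball_conv_ball using measure_small_ball[OF r, where 'a="real^('n option)"]
      unfolding dimE \<beta>_def .
    then have "\<rho> = r * \<beta>" unfolding \<rho>_def vol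
      using r \<beta> by (intro real_root_power_cancel) auto
    then have Sr: "S = r" using S \<beta> by simp
    have "integrand p x = profile p S" if x: "x \<in> frontier \<Omega>" for x
    proof -
      have xs: "x \<in> sphere 0 r" using x unfolding fr .
      have xx: "x \<bullet> x = r\<^sup>2" using xs by (simp add: dot_square_norm)
      have xN: "x \<bullet> N x = r"
        unfolding Om eucl_normal_cball[OF r xs] using r xx by (simp add: power2_eq_square)
      have "sqrt (1 + r\<^sup>2) \<noteq> 0" using add_pos_nonneg[of 1 "r\<^sup>2"] by simp
      then show ?thesis unfolding integrand_eq[OF x] xN xx profile_def Sr by simp
    qed
    then have "I = (\<integral>x. indicator (frontier \<Omega>) x * profile p S \<partial>\<sigma>)"
      unfolding I_def by (intro Bochner_Integration.integral_cong refl) (simp add: indicator_def)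
    also have "\<dots> = A * profile p S" by (simp add: A_def)
    \<comment> \<open>Here the area follows from the volume through \<open>area_sphere\<close>,
      after cancelling the radius.\<close>
    also have "A = \<omega> * S ^ n"
    proof -
      have "r * A = (real n + 1) * measure lborel \<Omega>"
        using area_sphere[OF r, where 'n='n] unfolding A_def n_def fr by (simp only: Om)
      also have "\<dots> = r * (\<omega> * S ^ n)" unfolding vol \<omega> Sr by (simp add: power_mult_distrib)
      finally show ?thesis using r by simp
    qed
    finally show "I = \<omega> * S ^ n * profile p S" .
  qed
  show ?thesis
    unfolding Let_def hyp_integral_eq I_def[symmetric] S_def[symmetric] \<omega>_def[symmetric] n_def[symmetric] J
    using ineq eq by blast
qed

end
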